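(* Let $n\ge1$, let $-1/n\leq p\leq\infty$, let $f,g:\mathbb{R}^n\to\mathbb{R}_{\geq0}\cup\{\infty\}$ be $p$-concave functions (finite-valued when $p=0$), and let $\lambda\in(0,1)$. If there exists a hyperplane $H\in\mathcal{L}^n_{n-1}$ such that $$\int_H \mathrm{proj}_H(f)(x)\,\mathrm{d} x=\int_H \mathrm{proj}_H(g)(x)\,\mathrm{d} x,$$ then $$\int_{\mathbb{R}^n}(1-\lambda) f\star_p\lambda g\,\mathrm{d} x \;\geq\;(1-\lambda)\int_{\mathbb{R}^n}f\,\mathrm{d} x +\lambda\int_{\mathbb{R}^n}g\,\mathrm{d} x.$$
   Context: Integrals over $H$ are with respect to $(n-1)$-dimensional Lebesgue measure on $H$; integrals of non-negative functions take values in $[0,\infty]$ (infinite values are allowed in the hypothesis). $\mathcal{L}^n_{n-1}$ is the set of $(n-1)$-dimensional linear subspaces of $\mathbb{R}^n$. $p$-th means: for $a,b\ge0$ and $\lambda\in(0,1)$, if $a=0$ or $b=0$ then $M_p(a,b,\lambda)=0$ for every $p\in\mathbb{R}\cup\{\pm\infty\}$. For $a,b>0$: $M_p(a,b,\lambda)=((1-\lambda)a^p+\lambda b^p)^{1/p}$ if $p\in\mathbb{R}\setminus\{0\}$; $M_0(a,b,\lambda)=a^{1-\lambda}b^{\lambda}$; $M_\infty(a,b,\lambda)=\max\{a,b\}$; $M_{-\infty}(a,b,\lambda)=\min\{a,b\}$. For $p\ne0$ the values $a=\infty$ or $b=\infty$ (the other being positive) are allowed, and $M_p$ is then defined by continuity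 (e.g. $M_p(a,\infty,\lambda)=\infty$ for $0<p\le\infty$, and $M_p(a,\infty,\lambda)=(1-\lambda)^{1/p}a$ for $-\infty<p<0$, $0<a<\infty$). For non-negative (extended, if $p\neq0$) functions $f,g$ on $\mathbb{R}^n$, $$\bigl((1-\lambda)f\star_p\lambda g\bigr)(x)=\sup_{(1-\lambda)x_1+\lambda x_2=x}M_p(f(x_1),g(x_2),\lambda).$$ A non-negative function $f$ on $\mathbb{R}^n$ (extended-valued allowed if $p\ne0$, finite-valued if $p=0$) is $p$-concave if $f((1-\lambda)x_1+\lambda x_2)\ge M_p(f(x_1),f(x_2),\lambda)$ for all $x_1,x_2\in\mathbb{R}^n$ and all $\lambda\in(0,1)$. For $f:\mathbb{R}^n\to\mathbb{R}_{\ge0}\cup\{\infty\}$ and $H\in\mathcal{L}^n_{n-1}$ with unit normal vector $\nu$, $\mathrm{proj}_H(f):H\to\mathbb{R}_{\ge0}\cup\{\infty\}$ is defined by $\mathrm{proj}_H(f)(h)=\sup_{\alpha\in\mathbb{R}} f(h+\alpha\nu)$. *)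

theory Defs
  imports "HOL-Analysis.Analysis"
begin

text \<open>Real powers on \<open>[0, \<infinity>]\<close>, extended to \<open>0\<close> and \<open>\<infinity>\<close> by continuity.\<close>

definition ennreal_powr :: "ennreal \<Rightarrow> real \<Rightarrow> ennreal" where
  "ennreal_powr x r =
     (if r = 0 then 1
      else if x = 0 then (if r < 0 then \<infinity> else 0)
      else if x = \<infinity> then (if r < 0 then 0 else \<infinity>)
      else ennreal (enn2real x powr r))"

text \<open>
  The conventions of \<^const>\<open>ennreal_powr\<close> make the last branch agree with the extension of
  the mean to infinite arguments by continuity; see \<open>p_mean_top_right\<close> below. For \<open>p = 0\<close>
  the mean is only meant to be applied to finite arguments.
\<close>

definition p_mean :: "ereal \<Rightarrow> ennreal \<Rightarrow> ennreal \<Rightarrow> real \<Rightarrow> ennreal" where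
  "p_mean p a b t =
     (if a = 0 \<or> b = 0 then 0
      else if p = \<infinity> then max a b
      else if p = -\<infinity> then min a b
      else if p = 0 then ennreal_powr a (1 - t) * ennreal_powr b t
      else ennreal_powr
             (ennreal (1 - t) * ennreal_powr a (real_of_ereal p)
               + ennreal t * ennreal_powr b (real_of_ereal p))
             (1 / real_of_ereal p))"

lemma p_mean_ennreal:
  assumes "a > 0" "b > 0" "0 < t" "t < 1" "r \<noteq> 0"
  shows "p_mean (ereal r) (ennreal a) (ennreal b) t =
           ennreal (((1 - t) * a powr r + t * b powr r) powr (1 / r))"
proof -
  have "(1 - t) * a powr r + t * b powr r > 0"
    using assms by (intro add_pos_pos mult_pos_pos) auto
  moreover have "ennreal (1 - t) * ennreal (a powr r) + ennreal t * ennreal (b powr r) =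
      ennreal ((1 - t) * a powr r + t * b powr r)"
    using assms by (simp add: ennreal_mult'')
  ultimately show ?thesis
    using assms by (simp add: p_mean_def ennreal_powr_def zero_ereal_def del: ennreal_plus)
qed

lemma p_mean_zero_ennreal:
  assumes "a > 0" "b > 0" "0 < t" "t < 1"
  shows "p_mean 0 (ennreal a) (ennreal b) t = ennreal (a powr (1 - t) * b powr t)"
  using assms by (simp add: p_mean_def ennreal_powr_def ennreal_mult'')

lemma p_mean_top_right:
  assumes "a > 0" "0 < t" "t < 1" "r \<noteq> 0"
  shows "p_mean (ereal r) (ennreal a) \<infinity> t =
           (if r > 0 then \<infinity> else ennreal ((1 - t) powr (1 / r) * a))"
proof (cases "r > 0")
  case True
  then show ?thesis
    using assms by (simp add: p_mean_def ennreal_powr_def zero_ereal_def ennreal_mult_top)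
next
  case False
  have "((1 - t) * a powr r) powr (1 / r) = (1 - t) powr (1 / r) * a"
    using assms by (simp add: powr_mult powr_powr)
  moreover have "ennreal (1 - t) * ennreal (a powr r) = ennreal ((1 - t) * a powr r)"
    using assms by (simp add: ennreal_mult'')
  ultimately show ?thesis
    using False assms by (simp add: p_mean_def ennreal_powr_def zero_ereal_def)
qed

definition sup_convolution ::
  "ereal \<Rightarrow> real \<Rightarrow> ('a::real_vector \<Rightarrow> ennreal) \<Rightarrow> ('a \<Rightarrow> ennreal) \<Rightarrow> 'a \<Rightarrow> ennreal" where
  "sup_convolution p t f g x =
     (SUP (x1, x2) \<in> {(x1, x2). (1 - t) *\<^sub>R x1 + t *\<^sub>R x2 = x}. p_mean p (f x1) (g x2) t)"

definition p_concave :: "ereal \<Rightarrow> ('a::real_vector \<Rightarrow> ennreal) \<Rightarrow> bool" where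
  "p_concave p f \<longleftrightarrow>
     (\<forall>x1 x2. \<forall>t\<in>{0<..<1}. f ((1 - t) *\<^sub>R x1 + t *\<^sub>R x2) \<ge> p_mean p (f x1) (f x2) t)"

text \<open>
  For a hyperplane \<open>H\<close> the unit normal is determined up to sign, and the projection of a function
  does not depend on the sign (\<open>hyperplane_proj_eq\<close>). As a function on the
  whole space, the projection is only meaningful on \<open>H\<close>.
\<close>

definition unit_normal :: "'a::real_inner set \<Rightarrow> 'a" where
  "unit_normal H = (SOME v. norm v = 1 \<and> (\<forall>h\<in>H. orthogonal v h))"

definition hyperplane_proj :: "'a::real_inner set \<Rightarrow> ('a \<Rightarrow> ennreal) \<Rightarrow> 'a \<Rightarrow> ennreal" where
  "hyperplane_proj H f h = (SUP \<alpha>::real. f (h + \<alpha> *\<^sub>R unit_normal H))"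

definition orthonormal_basis_of :: "'a::euclidean_space set \<Rightarrow> 'a set \<Rightarrow> bool" where
  "orthonormal_basis_of H B \<longleftrightarrow> pairwise orthogonal B \<and> (\<forall>b\<in>B. norm b = 1) \<and> span B = H"

text \<open>
  Lebesgue measure of dimension \<open>dim H\<close> on a linear subspace \<open>H\<close>: the construction of
  \<^const>\<open>lborel\<close> and \<^const>\<open>lebesgue\<close>, with an orthonormal basis of \<open>H\<close> in place of
  \<^const>\<open>Basis\<close>. By rotation invariance the choice of the basis is immaterial.
  For \<open>H = {0}\<close> this is the unit point mass at \<open>0\<close>.
\<close>

definition subspace_lebesgue :: "'a::euclidean_space set \<Rightarrow> 'a measure" where
  "subspace_lebesgue H =
     (let B = (SOME B. orthonormal_basis_of H B)
      in completion (distr (\<Pi>\<^sub>M b\<in>B. lborel) (restrict_space borel H) (\<lambda>c. \<Sum>b\<in>B. c b *\<^sub>R b)))"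

lemma unit_normal:
  fixes H :: "'a::euclidean_space set"
  assumes "subspace H" "dim H = DIM('a) - 1"
  shows "norm (unit_normal H) = 1" "\<And>h. h \<in> H \<Longrightarrow> orthogonal (unit_normal H) h"
proof -
  have "dim H < DIM('a)"
    using assms(2) DIM_positive[where 'a='a] by linarith
  then obtain w where w: "w \<noteq> 0" "\<And>h. h \<in> span H \<Longrightarrow> orthogonal w h"
    using orthogonal_to_subspace_exists by blast
  have "norm (sgn w) = 1 \<and> (\<forall>h\<in>H. orthogonal (sgn w) h)"
    using w by (auto simp: norm_sgn sgn_div_norm orthogonal_def span_base)
  then have "norm (unit_normal H) = 1 \<and> (\<forall>h\<in>H. orthogonal (unit_normal H) h)"
    unfolding unit_normal_def by (rule someI)
  then show "norm (unit_normal H) = 1" "\<And>h. h \<in> H \<Longrightarrow> orthogonal (unit_normal H) h"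
    by auto
qed

lemma hyperplane_proj_eq:
  fixes H :: "'a::euclidean_space set"
  assumes H: "subspace H" "dim H = DIM('a) - 1"
    and v: "norm v = 1" "\<And>h. h \<in> H \<Longrightarrow> orthogonal v h"
  shows "hyperplane_proj H f h = (SUP \<alpha>::real. f (h + \<alpha> *\<^sub>R v))"
proof -
  let ?u = "unit_normal H"
  note u = unit_normal[OF H]
  have "dim {x. \<forall>h\<in>H. orthogonal h x} + dim H = DIM('a)"
    using dim_subspace_orthogonal_to_vectors[OF H(1) subspace_UNIV] by (simp add: dim_UNIV)
  then have d: "dim {x. \<forall>h\<in>H. orthogonal h x} = 1"
    using H(2) DIM_positive[where 'a='a] by linarith
  have sub: "{?u, v} \<subseteq> {x. \<forall>h\<in>H. orthogonal h x}"
    using u(2) v(2) by (auto simp: orthogonal_commute)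
  have "dim {v} = 1"
    using v(1) dim_singleton by (metis norm_zero zero_neq_one)
  then have "span {v} = span {x. \<forall>h\<in>H. orthogonal h x}"
    using sub d by (intro dim_eq_span) auto
  then have "?u \<in> span {v}"
    using sub by (auto intro: span_base)
  then obtain k where k: "?u = k *\<^sub>R v"
    by (auto simp: span_singleton)
  then have "\<bar>k\<bar> = 1"
    using u(1) v(1) by simp
  then have k0: "k \<noteq> 0" by auto
  have "range (\<lambda>\<alpha>. f (h + \<alpha> *\<^sub>R ?u)) = range (\<lambda>\<alpha>. f (h + \<alpha> *\<^sub>R v))"
  proof (intro set_eqI iffI; clarsimp)
    fix \<alpha> show "f (h + \<alpha> *\<^sub>R ?u) \<in> range (\<lambda>\<alpha>. f (h + \<alpha> *\<^sub>R v))"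
      unfolding k by (auto intro: range_eqI[where x = "\<alpha> * k"])
    show "f (h + \<alpha> *\<^sub>R v) \<in> range (\<lambda>\<alpha>. f (h + \<alpha> *\<^sub>R ?u))"
      unfolding k using k0 by (auto intro!: range_eqI[where x = "\<alpha> / k"])
  qed
  then show ?thesis
    by (simp add: hyperplane_proj_def)
qed

lemma orthonormal_basis_of_some:
  assumes "subspace H"
  shows "orthonormal_basis_of H (SOME B. orthonormal_basis_of H B)"
proof -
  obtain B where "B \<subseteq> H" "pairwise orthogonal B" "\<And>x. x \<in> B \<Longrightarrow> norm x = 1"
    "independent B" "card B = dim H" "span B = H"
    using orthonormal_basis_subspace[OF assms] by blast
  then have "orthonormal_basis_of H B"
    by (simp add: orthonormal_basis_of_def)
  then show ?thesis by (rule someI)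
qed

lemma basis_coordinates_measurable:
  assumes "orthonormal_basis_of H B"
  shows "(\<lambda>c. \<Sum>b\<in>B. c b *\<^sub>R b) \<in> (\<Pi>\<^sub>M b\<in>B. lborel) \<rightarrow>\<^sub>M restrict_space borel H"
proof (rule measurable_restrict_space2)
  have "span B = H"
    using assms by (simp add: orthonormal_basis_of_def)
  then show "(\<lambda>c. \<Sum>b\<in>B. c b *\<^sub>R b) \<in> space (\<Pi>\<^sub>M b\<in>B. lborel) \<rightarrow> H"
    by (auto intro!: span_sum intro: span_scale span_base)
qed measurable

end

theory Submission imports Defs begin

text \<open>
  Split \<open>\<real>\<^sup>n\<close> into \<open>H\<close> and its normal. On the fibers over \<open>x\<^sub>1, x\<^sub>2 \<in> H\<close>, divide \<open>f\<close> and \<open>g\<close> by their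
  suprema \<open>a\<close> and \<open>b\<close>. The one-dimensional Brunn-Minkowski inequality for the superlevel sets bounds the
  integral of the sup-convolution over the fiber through \<open>(1 - t) x\<^sub>1 + t x\<^sub>2\<close> from below by
  \<open>M\<^sub>p(a, b, t) ((1 - t) \<phi>(x\<^sub>1) + t \<gamma>(x\<^sub>2))\<close>, where \<open>\<phi>\<close> and \<open>\<gamma>\<close> are the fiber integrals of \<open>f / a\<close> and \<open>g / b\<close>.
  What remains is an inequality on \<open>H\<close> in which \<open>a\<close> and \<open>b\<close> are densities of equal total mass. If all
  functions are constant on finitely many boxes, it follows by the cutting argument of Hadwiger and
  Ohmann: the case of two single boxes is the arithmetic-geometric mean inequality and uses \<open>p \<ge> -1/n\<close>.
  Such step functions approximate from below every function that is lower semicontinuous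
  along \<open>H\<close>, and a \<open>p\<close>-concave function agrees with such a function up to null sets, provided that its
  support is not flat. A function supported in a hyperplane transversal to the normal is treated by
  shearing the coordinates.
\<close>

section \<open>Power means\<close>

text \<open>Two boxes with sides u_i and v_i, densities a and b and equal masses satisfy prod (v_i /
  u_i) = a / b. The arithmetic-geometric mean inequality for these n - 1 ratios and one more ratio
  1, which accounts for the normal direction, shows that the combined box exceeds the first one in
  volume by at least the factor ((1-t) + t (a/b)^(1/n))^n. The mean of a and b with exponent -1/n is
  a divided by this very factor. This explains the bound on p, and why the cuts must keep the masses
  of the two halves equal. Two obstacles shape the rest. The sup-convolution is not known to be
  measurable, so its integral serves only as an upper bound for integrals of measurable functions
  below it. And the step functions are infima over dyadic cells in which every fiber is kept whole;
  they converge only under lower semicontinuity in the directions of the cells, so these directions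
  have to follow a flat support. If the common mass is infinite, both functions are cut off by tents
  whose heights are tuned until the truncated masses agree.\<close>

lemma ennreal_powr_mono: "x \<le> y \<Longrightarrow> 0 < r \<Longrightarrow> ennreal_powr x r \<le> ennreal_powr y r"
  by (cases x; cases y)
    (auto simp: ennreal_powr_def top_unique powr_mono2 ennreal_less_zero_iff intro!: ennreal_leI)

lemma ennreal_powr_antimono: "x \<le> y \<Longrightarrow> r < 0 \<Longrightarrow> ennreal_powr y r \<le> ennreal_powr x r"
  by (cases x; cases y)
    (auto simp: ennreal_powr_def top_unique powr_mono2' ennreal_less_zero_iff intro!: ennreal_leI)

lemma p_mean_mono:
  assumes "a \<le> a'" "b \<le> b'" "0 < t" "t < 1"
  shows "p_mean p a b t \<le> p_mean p a' b' t"
proof (cases "a = 0 \<or> b = 0")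
  case True
  then show ?thesis by (simp add: p_mean_def)
next
  case False
  then have nz: "a \<noteq> 0" "b \<noteq> 0" "a' \<noteq> 0" "b' \<noteq> 0"
    using assms by auto
  consider "p = \<infinity>" | "p = -\<infinity>" | "p = 0" | r where "p = ereal r" "r > 0" | r where "p = ereal r" "r < 0"
    by (cases p) (metis ereal_less_eq(3) linorder_neqE_linordered_idom zero_ereal_def, auto)
  then show ?thesis
  proof cases
    case 1
    then show ?thesis using assms nz by (auto simp: p_mean_def max.coboundedI1 max.coboundedI2)
  next
    case 2
    then show ?thesis using assms nz by (auto simp: p_mean_def min.coboundedI1 min.coboundedI2)
  next
    case 3
    then show ?thesis using assms nz
      by (auto simp: p_mean_def intro!: mult_mono ennreal_powr_mono)
  next
    case (4 r)
    then show ?thesis using assms nz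
      by (auto simp: p_mean_def zero_ereal_def intro!: add_mono mult_left_mono ennreal_powr_mono)
  next
    case (5 r)
    then show ?thesis using assms nz
      by (auto simp: p_mean_def zero_ereal_def
          intro!: add_mono mult_left_mono ennreal_powr_antimono)
  qed
qed

lemma p_mean_same:
  assumes "0 < s" "0 < t" "t < 1"
  shows "p_mean p (ennreal s) (ennreal s) t = ennreal s"
proof -
  consider "p = \<infinity>" | "p = -\<infinity>" | "p = 0" | r where "p = ereal r" "r \<noteq> 0"
    by (cases p) (auto simp: zero_ereal_def)
  then show ?thesis
  proof cases
    case 3
    then show ?thesis using assms by (simp add: p_mean_zero_ennreal powr_add[symmetric])
  next
    case (4 r)
    have "(1 - t) * s powr r + t * s powr r = s powr r" by (simp add: algebra_simps)
    then show ?thesis using assms 4 by (simp add: p_mean_ennreal powr_powr)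
  qed (use assms in \<open>auto simp: p_mean_def\<close>)
qed

text \<open>A finite positive number below both arguments is its own mean, so monotonicity suffices.
  Approaching the minimum by such numbers covers infinite arguments without a case
  distinction.\<close>

lemma p_mean_ge_min:
  assumes "0 < t" "t < 1"
  shows "min a b \<le> p_mean p a b t"
proof (rule dense_le)
  fix y assume y: "y < min a b"
  show "y \<le> p_mean p a b t"
  proof (cases "y = 0")
    case False
    then obtain s where s: "y = ennreal s" "0 < s"
      using y by (cases y) (auto simp: ennreal_less_zero_iff)
    have "p_mean p (ennreal s) (ennreal s) t \<le> p_mean p a b t"
      using y s assms by (intro p_mean_mono) auto
    then show ?thesis using p_mean_same s assms by simp
  qed simp
qed

lemma p_mean_homogeneous:
  assumes "0 < s" "0 < a" "0 < b" "0 < t" "t < 1"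
  shows "p_mean p (ennreal (s * a)) (ennreal (s * b)) t = ennreal s * p_mean p (ennreal a) (ennreal b) t"
proof -
  consider "p = \<infinity>" | "p = -\<infinity>" | "p = 0" | r where "p = ereal r" "r \<noteq> 0"
    by (cases p) (auto simp: zero_ereal_def)
  then show ?thesis
  proof cases
    case 3
    have "(s * a) powr (1 - t) * (s * b) powr t = (s powr (1 - t) * s powr t) * (a powr (1 - t) * b powr t)"
      using assms by (simp add: powr_mult mult_ac)
    also have "s powr (1 - t) * s powr t = s"
      using assms by (simp add: powr_add[symmetric])
    finally show ?thesis using assms 3 by (simp add: p_mean_zero_ennreal ennreal_mult'[symmetric])
  next
    case (4 r)
    have "(1 - t) * (s * a) powr r + t * (s * b) powr r = s powr r * ((1 - t) * a powr r + t * b powr r)"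
      using assms by (simp add: powr_mult algebra_simps)
    moreover have "(1 - t) * a powr r + t * b powr r > 0"
      using assms by (intro add_pos_pos mult_pos_pos) auto
    ultimately have "((1 - t) * (s * a) powr r + t * (s * b) powr r) powr (1/r)
        = s * ((1 - t) * a powr r + t * b powr r) powr (1/r)"
      using assms 4 by (simp add: powr_mult powr_powr)
    then show ?thesis using assms 4 by (simp add: p_mean_ennreal ennreal_mult'[symmetric])
  qed (use assms in \<open>auto simp: p_mean_def max_def min_def ennreal_mult'[symmetric]\<close>)
qed

lemma p_mean_real:
  assumes "0 < a" "0 < b" "0 < t" "t < 1"
  obtains c where "0 < c" "p_mean p (ennreal a) (ennreal b) t = ennreal c"
proof -
  have "p_mean p (ennreal a) (ennreal b) t \<le> p_mean p (ennreal (max a b)) (ennreal (max a b)) t"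
    using assms by (intro p_mean_mono) auto
  then have "p_mean p (ennreal a) (ennreal b) t \<le> ennreal (max a b)"
    using p_mean_same[of "max a b"] assms by simp
  moreover have "min (ennreal a) (ennreal b) \<le> p_mean p (ennreal a) (ennreal b) t"
    using assms by (intro p_mean_ge_min)
  ultimately show ?thesis
    using assms that by (cases "p_mean p (ennreal a) (ennreal b) t")
      (auto simp: min_def top_unique ennreal_less_zero_iff split: if_splits)
qed

section \<open>Comparison of means and the inequality for two boxes\<close>

lemma weighted_amgm:
  fixes x y :: real
  assumes "0 < x" "0 < y" "0 < t" "t < 1"
  shows "x powr (1 - t) * y powr t \<le> (1 - t) * x + t * y"
  using Youngs_inequality_0[of "1 - t" t x y] assms by simp

text \<open>Young's inequality with weights \<open>e\<close> and \<open>1 - e\<close> says that the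
  graph of \<open>w powr e\<close> lies below its tangent at \<open>z\<close>. The tangent bounds at
  \<open>x\<close> and \<open>y\<close> are averaged.\<close>

lemma powr_concave_2:
  fixes x y :: real
  assumes "0 < x" "0 < y" "0 < t" "t < 1" "0 < e" "e \<le> 1"
  shows "(1 - t) * x powr e + t * y powr e \<le> ((1 - t) * x + t * y) powr e"
proof -
  define z where "z = (1 - t) * x + t * y"
  have z: "0 < z" unfolding z_def using assms by (intro add_pos_pos mult_pos_pos) auto
  have young: "w powr e * z powr (1 - e) \<le> e * w + (1 - e) * z" if "0 < w" for w
    using Youngs_inequality_0[of e "1 - e" w z] that z assms by simp
  have "((1 - t) * x powr e + t * y powr e) * z powr (1 - e)
      = (1 - t) * (x powr e * z powr (1 - e)) + t * (y powr e * z powr (1 - e))"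
    by (simp add: algebra_simps)
  also have "\<dots> \<le> (1 - t) * (e * x + (1 - e) * z) + t * (e * y + (1 - e) * z)"
    using young assms by (intro add_mono mult_left_mono) auto
  also have "\<dots> = z"
    by (simp add: z_def algebra_simps)
  also have "z = z powr e * z powr (1 - e)"
    using z by (simp add: powr_add[symmetric])
  finally show ?thesis
    using z by (simp add: z_def)
qed

text \<open>Power means grow with the exponent: for \<open>p \<ge> 0\<close> the geometric mean lies
  in between, for negative exponents concavity of a power decides. All later estimates use
  \<open>p\<close> only through its lower bound.\<close>

lemma p_mean_ge_power_mean:
  assumes "0 < a" "0 < b" "0 < t" "t < 1" "0 < q" and p: "ereal (-q) \<le> p"
  shows "ennreal (((1 - t) * a powr (-q) + t * b powr (-q)) powr (-1/q)) \<le> p_mean p (ennreal a) (ennreal b) t"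
proof -
  have pos: "(1 - t) * a powr r + t * b powr r > 0" for r
    using assms by (intro add_pos_pos mult_pos_pos) auto
  have geo: "((1 - t) * a powr (-q) + t * b powr (-q)) powr (-1/q) \<le> a powr (1 - t) * b powr t"
  proof -
    have *: "(a powr (1 - t) * b powr t) powr (-q) \<le> (1 - t) * a powr (-q) + t * b powr (-q)"
      using weighted_amgm[of "a powr (-q)" "b powr (-q)" t] assms
      by (simp add: powr_mult powr_powr mult.commute)
    have "((1 - t) * a powr (-q) + t * b powr (-q)) powr (-1/q) \<le> ((a powr (1 - t) * b powr t) powr (-q)) powr (-1/q)"
      using assms pos * by (intro powr_mono2') auto
    then show ?thesis using assms by (simp add: powr_powr powr_mult)
  qed
  consider "p = \<infinity>" | "p = 0" | r where "p = ereal r" "r > 0" | r where "p = ereal r" "r < 0" "-q \<le> r"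
    using p by (cases p) (auto simp: zero_ereal_def, linarith?)
  then show ?thesis
  proof cases
    case 1
    have "a powr (1 - t) * b powr t \<le> max a b powr (1 - t) * max a b powr t"
      using assms by (intro mult_mono powr_mono2) auto
    also have "\<dots> = max a b" using assms by (simp add: powr_add[symmetric])
    finally have "ennreal (((1 - t) * a powr (-q) + t * b powr (-q)) powr (-1/q)) \<le> ennreal (max a b)"
      using geo by (intro ennreal_leI) simp
    also have "\<dots> = max (ennreal a) (ennreal b)"
      using assms by (auto simp: max_def)
    finally show ?thesis using 1 assms by (simp add: p_mean_def)
  next
    case 2
    then show ?thesis using assms geo by (simp add: p_mean_zero_ennreal ennreal_leI)
  next
    case (3 r)
    have "a powr (1 - t) * b powr t = ((a powr r) powr (1 - t) * (b powr r) powr t) powr (1/r)"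
      using assms 3 by (simp add: powr_powr powr_mult)
    also have "\<dots> \<le> ((1 - t) * a powr r + t * b powr r) powr (1/r)"
      using assms 3 by (intro powr_mono2 weighted_amgm) auto
    finally show ?thesis using assms 3 geo by (simp add: p_mean_ennreal ennreal_leI)
  next
    case (4 r)
    \<comment> \<open>The power \<open>e\<close> turns \<open>a powr (-q)\<close> into
      \<open>a powr r\<close>. The outer exponent \<open>1/r\<close> is negative and reverses the
      concavity estimate.\<close>
    define e where "e = - r / q"
    have e: "0 < e" "e \<le> 1" "- q * e = r" "(-1/q) = e * (1/r)"
      using 4 assms by (auto simp: e_def field_simps)
    have "(1 - t) * (a powr (-q)) powr e + t * (b powr (-q)) powr e
        \<le> ((1 - t) * a powr (-q) + t * b powr (-q)) powr e"
      using e assms by (intro powr_concave_2) auto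
    then have "(1 - t) * a powr r + t * b powr r \<le> ((1 - t) * a powr (-q) + t * b powr (-q)) powr e"
      using e(3) by (simp add: powr_powr)
    then have "(((1 - t) * a powr (-q) + t * b powr (-q)) powr e) powr (1/r) \<le> ((1 - t) * a powr r + t * b powr r) powr (1/r)"
      using 4 pos by (intro powr_mono2') (auto intro: less_imp_le)
    then show ?thesis using assms 4 e(4) by (simp add: p_mean_ennreal ennreal_leI powr_powr)
  qed
qed

text \<open>The additional number \<open>y\<close> receives the index \<open>None\<close>; it will
  stand for the direction of the normal.\<close>

lemma arith_geom_mean_Suc:
  fixes x :: "'i \<Rightarrow> real"
  assumes "finite I" "\<And>i. i \<in> I \<Longrightarrow> 0 \<le> x i" "0 \<le> y"
  shows "((\<Prod>i\<in>I. x i) * y) powr (1 / (card I + 1)) \<le> ((\<Sum>i\<in>I. x i) + y) / (card I + 1)"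
proof -
  let ?S = "insert None (Some ` I)" and ?x = "case_option y x"
  have c: "card ?S = card I + 1"
    using assms by (subst card_insert_disjoint) (auto simp: card_image)
  have "(\<Prod>i\<in>?S. ?x i) powr (1 / card ?S) \<le> (\<Sum>i\<in>?S. ?x i / card ?S)"
    using assms by (intro arith_geom_mean) auto
  moreover have "(\<Prod>i\<in>?S. ?x i) = (\<Prod>i\<in>I. x i) * y"
    using assms by (subst prod.insert) (auto simp: prod.reindex mult.commute)
  moreover have "(\<Sum>i\<in>?S. ?x i / card ?S) = ((\<Sum>i\<in>I. x i) + y) / (card I + 1)"
    unfolding c using assms
    by (subst sum.insert) (auto simp: sum.reindex add_divide_distrib sum_divide_distrib)
  ultimately show ?thesis using c by simp
qed

text \<open>Brunn-Minkowski for boxes of dimension \<open>n\<close> whose last sides have ratio 1.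
  Apply the arithmetic-geometric mean inequality to the numbers \<open>(1 - t) / ?d i\<close> with
  extra term \<open>1 - t\<close>, and to \<open>t * r i / ?d i\<close> with extra term
  \<open>t\<close>. The two arithmetic means add up to 1, which bounds the sum of the two geometric
  means.\<close>

lemma prod_convex_comb_ge:
  fixes r :: "'i \<Rightarrow> real" and n :: real
  assumes "finite I" "\<And>i. i \<in> I \<Longrightarrow> 0 < r i" "0 < t" "t < 1"
  defines "n \<equiv> card I + 1"
  shows "((1 - t) + t * (\<Prod>i\<in>I. r i) powr (1/n)) powr n \<le> (\<Prod>i\<in>I. (1 - t) + t * r i)"
proof -
  let ?d = "\<lambda>i. (1 - t) + t * r i" and ?R = "\<Prod>i\<in>I. r i"
  let ?D = "\<Prod>i\<in>I. ?d i"
  have n: "n > 0" by (simp add: n_def)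
  have d: "0 < ?d i" if "i \<in> I" for i
    using assms that by (intro add_pos_pos mult_pos_pos) auto
  have D: "0 < ?D" using d by (intro prod_pos) auto
  have R: "0 < ?R" using assms by (intro prod_pos) auto
  have 1: "((\<Prod>i\<in>I. (1 - t) / ?d i) * (1 - t)) powr (1/n) \<le> ((\<Sum>i\<in>I. (1 - t) / ?d i) + (1 - t)) / n"
    unfolding n_def using assms d by (intro arith_geom_mean_Suc) (auto intro: less_imp_le)
  have 2: "((\<Prod>i\<in>I. t * r i / ?d i) * t) powr (1/n) \<le> ((\<Sum>i\<in>I. t * r i / ?d i) + t) / n"
    unfolding n_def using assms d by (intro arith_geom_mean_Suc) (auto intro: less_imp_le)
  have "(\<Sum>i\<in>I. (1 - t) / ?d i) + (\<Sum>i\<in>I. t * r i / ?d i) = (\<Sum>i\<in>I. 1)"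
    unfolding sum.distrib[symmetric] using d
    by (intro sum.cong) (auto simp: add_divide_distrib[symmetric] less_imp_neq[symmetric])
  then have sum: "((\<Sum>i\<in>I. (1 - t) / ?d i) + (1 - t)) / n + ((\<Sum>i\<in>I. t * r i / ?d i) + t) / n = 1"
    by (simp add: n_def add_divide_distrib[symmetric])
  have pw: "x ^ card I * x = x powr n" if "0 < x" for x :: real
    using that by (simp add: n_def powr_add powr_realpow)
  have 3: "(\<Prod>i\<in>I. (1 - t) / ?d i) * (1 - t) = (1 - t) powr n / ?D"
    using pw[of "1 - t"] assms(4) by (simp add: prod_dividef)
  have 4: "(\<Prod>i\<in>I. t * r i / ?d i) * t = t powr n * ?R / ?D"
    using pw[of t] assms(3) by (simp add: prod_dividef prod.distrib)
  have "((1 - t) powr n / ?D) powr (1/n) = (1 - t) / ?D powr (1/n)"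
    using assms D n by (simp add: powr_divide powr_powr)
  moreover have "(t powr n * ?R / ?D) powr (1/n) = t * ?R powr (1/n) / ?D powr (1/n)"
    using assms D n R by (simp add: powr_divide powr_mult powr_powr)
  ultimately have "(1 - t) / ?D powr (1/n) + t * ?R powr (1/n) / ?D powr (1/n) \<le> 1"
    using 1 2 sum unfolding 3 4 by linarith
  then have "(1 - t) + t * ?R powr (1/n) \<le> ?D powr (1/n)"
    using D by (simp add: add_divide_distrib[symmetric] divide_le_eq)
  then have "((1 - t) + t * ?R powr (1/n)) powr n \<le> (?D powr (1/n)) powr n"
    using assms n R by (intro powr_mono2) (auto intro!: add_nonneg_nonneg)
  then show ?thesis using n D by (simp add: powr_powr)
qed

text \<open>By equality of the masses the product of the ratios \<open>v i / u i\<close> is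
  \<open>a / b\<close>, so the combined box has volume at least \<open>?U * ?m powr n\<close>. The
  mean with exponent \<open>-1/n\<close> equals \<open>a * ?m powr (-n)\<close>, and the powers of
  \<open>?m\<close> cancel.\<close>

lemma p_mean_box:
  fixes u v :: "'i \<Rightarrow> real"
  assumes "finite I" and uv: "\<And>i. i \<in> I \<Longrightarrow> 0 < u i" "\<And>i. i \<in> I \<Longrightarrow> 0 < v i"
    and t: "0 < t" "t < 1" and ab: "0 < a" "0 < b"
    and eq: "a * (\<Prod>i\<in>I. u i) = b * (\<Prod>i\<in>I. v i)"
    and p: "ereal (- 1 / real (card I + 1)) \<le> p"
    and c: "p_mean p (ennreal a) (ennreal b) t = ennreal c" "0 < c"
  shows "a * (\<Prod>i\<in>I. u i) \<le> c * (\<Prod>i\<in>I. (1 - t) * u i + t * v i)"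
proof -
  define n :: real where "n = card I + 1"
  have n: "n > 0" by (simp add: n_def)
  let ?U = "\<Prod>i\<in>I. u i" and ?V = "\<Prod>i\<in>I. v i"
  have U: "0 < ?U" "0 < ?V" using uv by (auto intro!: prod_pos)
  let ?m = "(1 - t) + t * (a / b) powr (1/n)"
  have m: "0 < ?m" using t ab by (intro add_pos_pos mult_pos_pos) auto
  have "(\<Prod>i\<in>I. (1 - t) * u i + t * v i) = (\<Prod>i\<in>I. u i * ((1 - t) + t * (v i / u i)))"
    using uv by (intro prod.cong) (auto simp: algebra_simps less_imp_neq[symmetric])
  also have "\<dots> = ?U * (\<Prod>i\<in>I. (1 - t) + t * (v i / u i))"
    by (simp add: prod.distrib)
  also have "\<dots> \<ge> ?U * (((1 - t) + t * (\<Prod>i\<in>I. v i / u i) powr (1/n)) powr n)"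
    unfolding n_def using U uv t assms(1) by (intro mult_left_mono prod_convex_comb_ge) auto
  also have "(\<Prod>i\<in>I. v i / u i) = a / b"
    using eq U ab by (simp add: prod_dividef field_simps)
  finally have 1: "?U * ?m powr n \<le> (\<Prod>i\<in>I. (1 - t) * u i + t * v i)" .
  have "ereal (-(1/n)) \<le> p" using p by (simp add: n_def)
  then have "ennreal (((1 - t) * a powr (-(1/n)) + t * b powr (-(1/n))) powr (-1/(1/n))) \<le> ennreal c"
    unfolding c(1)[symmetric] using ab t n by (intro p_mean_ge_power_mean) auto
  then have 2: "((1 - t) * a powr (-(1/n)) + t * b powr (-(1/n))) powr (- n) \<le> c"
    using c by (simp add: ennreal_le_iff)
  have "(1 - t) * a powr (-(1/n)) + t * b powr (-(1/n)) = a powr (-(1/n)) * ?m"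
    using ab by (simp add: powr_divide powr_minus field_simps)
  then have "((1 - t) * a powr (-(1/n)) + t * b powr (-(1/n))) powr (- n) = a * ?m powr (-n)"
    using ab m n by (simp add: powr_mult powr_powr)
  from 2[unfolded this] have "a * ?m powr (-n) * ?m powr n \<le> c * ?m powr n"
    by (rule mult_right_mono) simp
  moreover have "a * ?m powr (-n) * ?m powr n = a"
    using m by (simp add: powr_minus)
  ultimately have "a \<le> c * ?m powr n" by simp
  then have "a * ?U \<le> c * ?m powr n * ?U" using U by (intro mult_right_mono) auto
  also have "\<dots> = c * (?U * ?m powr n)" by simp
  also have "\<dots> \<le> c * (\<Prod>i\<in>I. (1 - t) * u i + t * v i)"
    using 1 c by (intro mult_left_mono) auto
  finally show ?thesis .
qed

section \<open>Cutting systems of boxes\<close>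

definition box_vol :: "'i set \<Rightarrow> ('i \<Rightarrow> real) \<Rightarrow> ('i \<Rightarrow> real) \<Rightarrow> real" where
  "box_vol I l u = (\<Prod>k\<in>I. u k - l k)"

text \<open>Half-open sides let a cut divide a box without overlap, and let dyadic cells tile the
  space.\<close>

definition half_open_box :: "'i set \<Rightarrow> ('i \<Rightarrow> real) \<Rightarrow> ('i \<Rightarrow> real) \<Rightarrow> ('i \<Rightarrow> real) set" where
  "half_open_box I l u = (\<Pi>\<^sub>E k\<in>I. {l k..<u k})"

abbreviation lborel_on :: "'i set \<Rightarrow> ('i \<Rightarrow> real) measure" where
  "lborel_on I \<equiv> \<Pi>\<^sub>M i\<in>I. lborel"

abbreviation double_integral :: "('i \<Rightarrow> real) measure \<Rightarrow> (('i \<Rightarrow> real) \<Rightarrow> real \<Rightarrow> ennreal) \<Rightarrow> ennreal" where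
  "double_integral M F \<equiv> \<integral>\<^sup>+c. \<integral>\<^sup>+\<alpha>. F c \<alpha> \<partial>lborel \<partial>M"

interpretation lborel_product: product_sigma_finite "\<lambda>_::'i. lborel :: real measure"
  by standard

lemma half_open_box_sets [measurable]:
  "finite I \<Longrightarrow> half_open_box I l u \<in> sets (lborel_on I)"
  unfolding half_open_box_def by (intro sets_PiM_I_finite) auto

lemma emeasure_half_open_box:
  assumes "finite I" "\<And>k. k \<in> I \<Longrightarrow> l k \<le> u k"
  shows "emeasure (lborel_on I) (half_open_box I l u) = ennreal (box_vol I l u)"
proof -
  have "emeasure (lborel_on I) (half_open_box I l u) = (\<Prod>k\<in>I. emeasure lborel {l k..<u k})"
    unfolding half_open_box_def using assms(1) by (intro lborel_product.emeasure_PiM) auto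
  also have "\<dots> = (\<Prod>k\<in>I. ennreal (u k - l k))"
    using assms by (intro prod.cong) auto
  also have "\<dots> = ennreal (box_vol I l u)"
    unfolding box_vol_def using assms by (intro prod_ennreal) auto
  finally show ?thesis .
qed

lemma box_vol_pos: "(\<And>k. k \<in> I \<Longrightarrow> l k < u k) \<Longrightarrow> 0 < box_vol I l u"
  unfolding box_vol_def by (intro prod_pos) auto

text \<open>Linearity in one side length. The cut \<open>c\<close> may lie outside the side, in
  which case one of the terms is a signed volume.\<close>

lemma box_vol_cut:
  assumes "finite I" "k \<in> I"
  shows "box_vol I l u = box_vol I l (u(k := c)) + box_vol I (l(k := c)) u"
proof -
  define r where "r = (\<Prod>j\<in>I - {k}. u j - l j)"
  have rem: "box_vol I l' u' = (u' k - l' k) * (\<Prod>j\<in>I - {k}. u' j - l' j)" for l' u'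
    unfolding box_vol_def using assms by (rule prod.remove)
  have "(\<Prod>j\<in>I - {k}. (u(k := c)) j - l j) = r"
    "(\<Prod>j\<in>I - {k}. u j - (l(k := c)) j) = r"
    unfolding r_def by (auto intro!: prod.cong)
  then have "box_vol I l (u(k := c)) = (c - l k) * r" "box_vol I (l(k := c)) u = (u k - c) * r"
    unfolding rem by simp_all
  moreover have "box_vol I l u = (u k - l k) * r" unfolding rem r_def ..
  ultimately show ?thesis by (simp add: algebra_simps)
qed

text \<open>Disjointness is stated as separation by a coordinate hyperplane because the induction
  cuts along exactly this hyperplane.\<close>

definition box_system :: "'i set \<Rightarrow> 'j set \<Rightarrow> ('j \<Rightarrow> 'i \<Rightarrow> real) \<Rightarrow> ('j \<Rightarrow> 'i \<Rightarrow> real) \<Rightarrow> ('j \<Rightarrow> real) \<Rightarrow> bool" where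
  "box_system I F l u a \<longleftrightarrow> finite F \<and> (\<forall>i\<in>F. 0 < a i \<and> (\<forall>k\<in>I. l i k < u i k)) \<and>
     (\<forall>i\<in>F. \<forall>j\<in>F. i \<noteq> j \<longrightarrow> (\<exists>k\<in>I. u i k \<le> l j k \<or> u j k \<le> l i k))"

definition box_mass :: "'i set \<Rightarrow> 'j set \<Rightarrow> ('j \<Rightarrow> 'i \<Rightarrow> real) \<Rightarrow> ('j \<Rightarrow> 'i \<Rightarrow> real) \<Rightarrow> ('j \<Rightarrow> real) \<Rightarrow> real" where
  "box_mass I F l u a = (\<Sum>i\<in>F. a i * box_vol I (l i) (u i))"

text \<open>A cut position outside the side is moved to its end, so a box missed by a half-space
  turns into one of volume 0 rather than into an inverted one.\<close>

definition clamp :: "real \<Rightarrow> real \<Rightarrow> real \<Rightarrow> real" where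
  "clamp l u c = max l (min u c)"

definition cut_upper :: "'i \<Rightarrow> real \<Rightarrow> ('j \<Rightarrow> 'i \<Rightarrow> real) \<Rightarrow> ('j \<Rightarrow> 'i \<Rightarrow> real) \<Rightarrow> 'j \<Rightarrow> 'i \<Rightarrow> real" where
  "cut_upper k c l u i = (u i)(k := clamp (l i k) (u i k) c)"

definition cut_lower :: "'i \<Rightarrow> real \<Rightarrow> ('j \<Rightarrow> 'i \<Rightarrow> real) \<Rightarrow> ('j \<Rightarrow> 'i \<Rightarrow> real) \<Rightarrow> 'j \<Rightarrow> 'i \<Rightarrow> real" where
  "cut_lower k c l u i = (l i)(k := clamp (l i k) (u i k) c)"

text \<open>These are the boxes that keep positive volume on the given side of the cut. A box
  crossed by the cut belongs to both sets, under the same index.\<close>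

definition below :: "'i \<Rightarrow> real \<Rightarrow> ('j \<Rightarrow> 'i \<Rightarrow> real) \<Rightarrow> 'j set \<Rightarrow> 'j set" where
  "below k c l F = {i\<in>F. l i k < c}"

definition above :: "'i \<Rightarrow> real \<Rightarrow> ('j \<Rightarrow> 'i \<Rightarrow> real) \<Rightarrow> 'j set \<Rightarrow> 'j set" where
  "above k c u F = {i\<in>F. c < u i k}"

lemma box_system_finite: "box_system I F l u a \<Longrightarrow> finite F"
  by (simp add: box_system_def)

lemma box_system_disjoint:
  assumes "box_system I F l u a" "i \<in> F" "j \<in> F" "i \<noteq> j"
  obtains k where "k \<in> I" "u i k \<le> l j k \<or> u j k \<le> l i k"
  using assms unfolding box_system_def by blast

lemma box_system_subboxes:
  assumes "box_system I F l u a" "F' \<subseteq> F"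
    and sub: "\<And>i k. i \<in> F' \<Longrightarrow> k \<in> I \<Longrightarrow> l i k \<le> l' i k \<and> l' i k < u' i k \<and> u' i k \<le> u i k"
  shows "box_system I F' l' u' a"
  unfolding box_system_def
proof (intro conjI ballI impI)
  show "finite F'" using assms(1,2) by (auto simp: box_system_def intro: finite_subset)
  show "0 < a i" "k \<in> I \<Longrightarrow> l' i k < u' i k" if "i \<in> F'" for i k
    using that assms by (auto simp: box_system_def)
  fix i j assume ij: "i \<in> F'" "j \<in> F'" "i \<noteq> j"
  then obtain k where k: "k \<in> I" "u i k \<le> l j k \<or> u j k \<le> l i k"
    using box_system_disjoint[OF assms(1), of i j] assms(2) by blast
  then show "\<exists>k\<in>I. u' i k \<le> l' j k \<or> u' j k \<le> l' i k"
    using sub[OF ij(1) k(1)] sub[OF ij(2) k(1)] by (meson order_trans)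
qed

lemma box_system_below:
  "box_system I F l u a \<Longrightarrow> box_system I (below k c l F) l (cut_upper k c l u) a"
  by (rule box_system_subboxes)
    (auto simp: below_def cut_upper_def clamp_def box_system_def less_imp_le)

lemma box_system_above:
  "box_system I F l u a \<Longrightarrow> box_system I (above k c u F) (cut_lower k c l u) u a"
  by (rule box_system_subboxes)
    (auto simp: above_def cut_lower_def clamp_def box_system_def)

lemma box_system_vol_pos: "box_system I F l u a \<Longrightarrow> i \<in> F \<Longrightarrow> 0 < a i * box_vol I (l i) (u i)"
  by (auto simp: box_system_def intro!: mult_pos_pos box_vol_pos)

lemma box_mass_pos: "box_system I F l u a \<Longrightarrow> F \<noteq> {} \<Longrightarrow> 0 < box_mass I F l u a"
  unfolding box_mass_def by (intro sum_pos box_system_vol_pos box_system_finite)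

lemma box_mass_eq_nonempty:
  assumes "box_mass I F l u a = box_mass I G l' u' b" "box_system I F l u a" "F \<noteq> {}"
  shows "G \<noteq> {}"
  using box_mass_pos[OF assms(2,3)] assms(1) by (auto simp: box_mass_def)

lemma cut_split:
  assumes S: "box_system I F l u a" and I: "finite I" "k \<in> I" and i: "i \<in> F"
  shows "box_vol I (l i) (u i) = box_vol I (l i) (cut_upper k c l u i) + box_vol I (cut_lower k c l u i) (u i)"
    and "i \<notin> below k c l F \<Longrightarrow> box_vol I (l i) (cut_upper k c l u i) = 0"
    and "i \<notin> above k c u F \<Longrightarrow> box_vol I (cut_lower k c l u i) (u i) = 0"
    and "0 \<le> box_vol I (l i) (cut_upper k c l u i)"
    and "0 \<le> box_vol I (cut_lower k c l u i) (u i)"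
proof -
  show "box_vol I (l i) (u i) = box_vol I (l i) (cut_upper k c l u i) + box_vol I (cut_lower k c l u i) (u i)"
    unfolding cut_upper_def cut_lower_def by (rule box_vol_cut[OF I])
  have lu: "\<And>k. k \<in> I \<Longrightarrow> l i k < u i k" using S i by (auto simp: box_system_def)
  show "box_vol I (l i) (cut_upper k c l u i) = 0" if "i \<notin> below k c l F"
  proof -
    have "cut_upper k c l u i k - l i k = 0"
      using that i lu[OF I(2)] by (simp add: below_def cut_upper_def clamp_def)
    then show ?thesis unfolding box_vol_def using I prod_zero_iff by blast
  qed
  show "box_vol I (cut_lower k c l u i) (u i) = 0" if "i \<notin> above k c u F"
  proof -
    have "u i k - cut_lower k c l u i k = 0"
      using that i lu[OF I(2)] by (simp add: above_def cut_lower_def clamp_def)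
    then show ?thesis unfolding box_vol_def using I prod_zero_iff by blast
  qed
  show "0 \<le> box_vol I (l i) (cut_upper k c l u i)" "0 \<le> box_vol I (cut_lower k c l u i) (u i)"
    unfolding box_vol_def using lu
    by (auto intro!: prod_nonneg simp: cut_upper_def cut_lower_def clamp_def less_imp_le)
qed

lemma box_mass_cut_below:
  assumes S: "box_system I F l u a" and I: "finite I" "k \<in> I"
  shows "box_mass I (below k c l F) l (cut_upper k c l u) a = box_mass I F l (cut_upper k c l u) a"
  unfolding box_mass_def using cut_split[OF S I] box_system_finite[OF S]
  by (intro sum.mono_neutral_left) (auto simp: below_def)

lemma box_mass_cut_above:
  assumes S: "box_system I F l u a" and I: "finite I" "k \<in> I"
  shows "box_mass I (above k c u F) (cut_lower k c l u) u a = box_mass I F (cut_lower k c l u) u a"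
  unfolding box_mass_def using cut_split[OF S I] box_system_finite[OF S]
  by (intro sum.mono_neutral_left) (auto simp: above_def)

lemma box_mass_cut:
  assumes S: "box_system I F l u a" and I: "finite I" "k \<in> I"
  shows "box_mass I F l u a = box_mass I (below k c l F) l (cut_upper k c l u) a
    + box_mass I (above k c u F) (cut_lower k c l u) u a"
  unfolding box_mass_cut_below[OF S I] box_mass_cut_above[OF S I]
  unfolding box_mass_def sum.distrib[symmetric] distrib_left[symmetric]
  using cut_split(1)[OF S I] by (intro sum.cong) auto

lemma box_integral_cut:
  assumes S: "box_system I F l u a" and I: "finite I" "k \<in> I"
  shows "(\<Sum>i\<in>F. ennreal (a i * box_vol I (l i) (u i)) * \<phi> i) =
     (\<Sum>i\<in>below k c l F. ennreal (a i * box_vol I (l i) (cut_upper k c l u i)) * \<phi> i) +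
     (\<Sum>i\<in>above k c u F. ennreal (a i * box_vol I (cut_lower k c l u i) (u i)) * \<phi> i)"
proof -
  note c = cut_split[OF S I] and fin = box_system_finite[OF S]
  have "(\<Sum>i\<in>F. ennreal (a i * box_vol I (l i) (u i)) * \<phi> i) =
      (\<Sum>i\<in>F. ennreal (a i * box_vol I (l i) (cut_upper k c l u i)) * \<phi> i
        + ennreal (a i * box_vol I (cut_lower k c l u i) (u i)) * \<phi> i)"
  proof (intro sum.cong refl)
    fix i assume i: "i \<in> F"
    have "0 < a i" using S i by (auto simp: box_system_def)
    then show "ennreal (a i * box_vol I (l i) (u i)) * \<phi> i =
        ennreal (a i * box_vol I (l i) (cut_upper k c l u i)) * \<phi> i
        + ennreal (a i * box_vol I (cut_lower k c l u i) (u i)) * \<phi> i"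
      unfolding c(1)[OF i, of c] using c(4,5)[OF i]
      by (simp add: distrib_left distrib_right[symmetric] ennreal_plus[symmetric] del: ennreal_plus)
  qed
  also have "\<dots> = (\<Sum>i\<in>F. ennreal (a i * box_vol I (l i) (cut_upper k c l u i)) * \<phi> i)
      + (\<Sum>i\<in>F. ennreal (a i * box_vol I (cut_lower k c l u i) (u i)) * \<phi> i)"
    by (rule sum.distrib)
  also have "(\<Sum>i\<in>F. ennreal (a i * box_vol I (l i) (cut_upper k c l u i)) * \<phi> i)
     = (\<Sum>i\<in>below k c l F. ennreal (a i * box_vol I (l i) (cut_upper k c l u i)) * \<phi> i)"
    using c fin by (intro sum.mono_neutral_right) (auto simp: below_def)
  also have "(\<Sum>i\<in>F. ennreal (a i * box_vol I (cut_lower k c l u i) (u i)) * \<phi> i)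
     = (\<Sum>i\<in>above k c u F. ennreal (a i * box_vol I (cut_lower k c l u i) (u i)) * \<phi> i)"
    using c fin by (intro sum.mono_neutral_right) (auto simp: above_def)
  finally show ?thesis .
qed

text \<open>The mass below the cut depends continuously on \<open>c\<close>, because
  \<open>clamp\<close> does, and runs from 0 to the full mass. The intermediate value theorem
  applies.\<close>

lemma box_mass_cut_attains:
  assumes S: "box_system I F l u a" and I: "finite I" "k \<in> I"
    and m: "0 \<le> m" "m \<le> box_mass I F l u a"
  obtains c where "box_mass I (below k c l F) l (cut_upper k c l u) a = m"
proof -
  note fin = box_system_finite[OF S]
  define g where "g c = box_mass I F l (cut_upper k c l u) a" for c
  \<comment> \<open>The inserted 0 keeps both extrema meaningful for empty \<open>F\<close> and
    yields \<open>lo \<le> hi\<close>.\<close>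
  define lo where "lo = Min (insert 0 ((\<lambda>i. l i k) ` F))"
  define hi where "hi = Max (insert 0 ((\<lambda>i. u i k) ` F))"
  have lo: "lo \<le> l i k" and hi: "u i k \<le> hi" if "i \<in> F" for i
    using fin that by (auto simp: lo_def hi_def)
  have "lo \<le> 0" "0 \<le> hi" using fin by (auto simp: lo_def hi_def)
  have "g lo = 0"
    unfolding g_def box_mass_def
    using cut_split(2)[OF S I] lo by (intro sum.neutral) (force simp: below_def)
  moreover have "g hi = box_mass I F l u a"
    unfolding g_def box_mass_def
  proof (intro sum.cong refl)
    fix i assume "i \<in> F"
    then have "cut_upper k hi l u i = u i"
      using hi[of i] S I(2) by (auto simp: cut_upper_def clamp_def box_system_def fun_eq_iff less_imp_le max_def)
    then show "a i * box_vol I (l i) (cut_upper k hi l u i) = a i * box_vol I (l i) (u i)" by simp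
  qed
  moreover have "continuous_on {lo..hi} g"
  proof -
    have "continuous_on UNIV (\<lambda>c. cut_upper k c l u i j)" for i j
      by (cases "j = k") (auto simp: cut_upper_def clamp_def intro!: continuous_intros)
    then have "continuous_on UNIV g"
      unfolding g_def box_mass_def box_vol_def
      by (intro continuous_intros) auto
    then show ?thesis by (rule continuous_on_subset) auto
  qed
  ultimately obtain c where "g c = m"
    using IVT'[of g lo m hi] m \<open>lo \<le> 0\<close> \<open>0 \<le> hi\<close> by auto
  then show thesis
    using that[of c] box_mass_cut_below[OF S I] by (simp add: g_def)
qed

text \<open>Cut \<open>F\<close> at a face that separates two of its boxes: one of them is missing
  from the upper half and the other from the lower half, so both halves have fewer boxes. In
  \<open>G\<close> the parallel cut is placed where the lower masses agree.\<close>

lemma box_system_cut_exists: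
  assumes S: "box_system I F l u a" and T: "box_system I G l' u' b" and I: "finite I"
    and mass: "box_mass I F l u a = box_mass I G l' u' b" and card: "2 \<le> card F"
  obtains k c d where "k \<in> I"
    "card (below k c l F) < card F" "card (above k c u F) < card F"
    "box_mass I (below k c l F) l (cut_upper k c l u) a =
      box_mass I (below k d l' G) l' (cut_upper k d l' u') b"
    "below k c l F \<noteq> {}" "above k c u F \<noteq> {}"
proof -
  have "\<not> F \<subseteq> {i}" for i
    using card card_mono[of "{i}" F] by auto
  then obtain i j where ij: "i \<in> F" "j \<in> F" "i \<noteq> j"
    by blast
  have "\<exists>i j k. i \<in> F \<and> j \<in> F \<and> i \<noteq> j \<and> k \<in> I \<and> u i k \<le> l j k"
    using box_system_disjoint[OF S ij] ij by metis
  then obtain i j k where ij: "i \<in> F" "j \<in> F" "i \<noteq> j" and k: "k \<in> I" "u i k \<le> l j k"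
    by blast
  define c where "c = u i k"
  have lu: "l i k < u i k" "l j k < u j k" using S ij k by (auto simp: box_system_def)
  have 1: "i \<in> below k c l F" "j \<notin> below k c l F" "j \<in> above k c u F" "i \<notin> above k c u F"
    using ij k lu by (auto simp: below_def above_def c_def)
  then have psub: "below k c l F \<subset> F" "above k c u F \<subset> F"
    using ij by (auto simp: below_def above_def)
  have pos: "0 < box_mass I (below k c l F) l (cut_upper k c l u) a"
       "0 < box_mass I (above k c u F) (cut_lower k c l u) u a"
    using 1 by (auto intro!: box_mass_pos box_system_above box_system_below S)
  obtain d where d: "box_mass I (below k d l' G) l' (cut_upper k d l' u') b
      = box_mass I (below k c l F) l (cut_upper k c l u) a"
    using box_mass_cut_attains[OF T I k(1), of "box_mass I (below k c l F) l (cut_upper k c l u) a"] pos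
      box_mass_cut[OF S I k(1), of c] mass by auto
  show thesis
    using 1 by (intro that[OF k(1) _ _ d[symmetric]] psubset_card_mono[OF box_system_finite[OF S]] psub) auto
qed

text \<open>Base case of the cutting argument. The function \<open>h\<close> is bounded below by a
  constant on the box of convex combinations, and the hypothesis on \<open>C\<close> compares the
  volume of this box with the common mass.\<close>

lemma two_box_integral:
  assumes I: "finite I" and t: "0 < t" "t < 1"
    and C: "\<And>u v. (\<And>i. i \<in> I \<Longrightarrow> 0 < u i) \<Longrightarrow> (\<And>i. i \<in> I \<Longrightarrow> 0 < v i) \<Longrightarrow>
      a * (\<Prod>i\<in>I. u i) = b * (\<Prod>i\<in>I. v i) \<Longrightarrow>
      a * (\<Prod>i\<in>I. u i) \<le> C * (\<Prod>i\<in>I. (1 - t) * u i + t * v i)"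
    and C0: "0 \<le> C"
    and lu: "\<And>k. k \<in> I \<Longrightarrow> l k < u k" "\<And>k. k \<in> I \<Longrightarrow> l' k < u' k"
    and eq: "a * box_vol I l u = b * box_vol I l' u'"
    and h: "\<And>z. z \<in> half_open_box I (\<lambda>k. (1 - t) * l k + t * l' k) (\<lambda>k. (1 - t) * u k + t * u' k) \<Longrightarrow>
       ennreal C * \<phi> \<le> h z"
  shows "ennreal (a * box_vol I l u) * \<phi> \<le> (nn_integral (lborel_on I) h)"
proof -
  let ?l = "\<lambda>k. (1 - t) * l k + t * l' k" and ?u = "\<lambda>k. (1 - t) * u k + t * u' k"
  have "a * box_vol I l u \<le> C * (\<Prod>i\<in>I. (1 - t) * (u i - l i) + t * (u' i - l' i))"
    using eq lu unfolding box_vol_def by (intro C) auto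
  also have "(\<Prod>i\<in>I. (1 - t) * (u i - l i) + t * (u' i - l' i)) = box_vol I ?l ?u"
    unfolding box_vol_def by (intro prod.cong) (auto simp: algebra_simps)
  finally have "ennreal (a * box_vol I l u) * \<phi> \<le> ennreal (C * box_vol I ?l ?u) * \<phi>"
    by (intro mult_right_mono ennreal_leI) auto
  also have "\<dots> = (ennreal C * \<phi>) * emeasure (lborel_on I) (half_open_box I ?l ?u)"
  proof -
    have "?l k \<le> ?u k" if "k \<in> I" for k
      using lu[OF that] t by (intro add_mono mult_left_mono) auto
    then show ?thesis
      using I C0 by (subst emeasure_half_open_box) (auto simp: ennreal_mult' mult_ac)
  qed
  also have "\<dots> = (\<integral>\<^sup>+z. (ennreal C * \<phi>) * indicator (half_open_box I ?l ?u) z \<partial>lborel_on I)"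
    using I by (intro nn_integral_cmult_indicator[symmetric]) measurable
  also have "\<dots> \<le> (nn_integral (lborel_on I) h)"
    using h by (intro nn_integral_mono) (auto simp: indicator_def)
  finally show ?thesis .
qed

text \<open>
  The cutting argument of Hadwiger and Ohmann: as long as one of the systems has two boxes, a
  coordinate hyperplane separates them, and a parallel hyperplane splits the other system in the same
  proportion. The sums of the two lower halves and of the two upper halves do not overlap.
\<close>

lemma box_system_integral:
  assumes I: "finite I" and t: "0 < t" "t < 1"
    and C: "\<And>a b u v. 0 < a \<Longrightarrow> 0 < b \<Longrightarrow> (\<And>i. i \<in> I \<Longrightarrow> 0 < u i) \<Longrightarrow> (\<And>i. i \<in> I \<Longrightarrow> 0 < v i) \<Longrightarrow>
      a * (\<Prod>i\<in>I. u i) = b * (\<Prod>i\<in>I. v i) \<Longrightarrow>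
      a * (\<Prod>i\<in>I. u i) \<le> C a b * (\<Prod>i\<in>I. (1 - t) * u i + t * v i)"
    and C0: "\<And>a b. 0 < a \<Longrightarrow> 0 < b \<Longrightarrow> 0 \<le> C a b"
    and "box_system I F l u a" "box_system I G l' u' b" "F \<noteq> {}" "G \<noteq> {}"
    and "box_mass I F l u a = box_mass I G l' u' b"
    and "h \<in> borel_measurable (lborel_on I)"
    and "\<And>i j z. i \<in> F \<Longrightarrow> j \<in> G \<Longrightarrow>
      z \<in> half_open_box I (\<lambda>k. (1 - t) * l i k + t * l' j k) (\<lambda>k. (1 - t) * u i k + t * u' j k) \<Longrightarrow>
      ennreal (C (a i) (b j)) * (ennreal (1 - t) * \<phi> i + ennreal t * \<gamma> j) \<le> h z"
  shows "ennreal (1 - t) * (\<Sum>i\<in>F. ennreal (a i * box_vol I (l i) (u i)) * \<phi> i)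
      + ennreal t * (\<Sum>j\<in>G. ennreal (b j * box_vol I (l' j) (u' j)) * \<gamma> j)
    \<le> (nn_integral (lborel_on I) h)"
  using assms(6-)
\<comment> \<open>Each piece keeps the index of its box, so the densities and the values
  \<open>\<phi>\<close> and \<open>\<gamma>\<close> stay fixed while sides, index sets and
  \<open>h\<close> vary.\<close>
proof (induction "card F + card G" arbitrary: F G l u l' u' h rule: less_induct)
  case less
  note S = less.prems(1) and T = less.prems(2) and ne = less.prems(3,4) and mass = less.prems(5)
    and [measurable] = less.prems(6) and h = less.prems(7)
  note fin = box_system_finite[OF S] box_system_finite[OF T]
  show ?case
  proof (cases "card F = 1 \<and> card G = 1")
    case True
    then obtain i j where ij: "F = {i}" "G = {j}" by (meson card_1_singletonE)
    have pos: "0 < a i" "0 < b j" and lu: "\<And>k. k \<in> I \<Longrightarrow> l i k < u i k" "\<And>k. k \<in> I \<Longrightarrow> l' j k < u' j k"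
      using S T ij by (auto simp: box_system_def)
    have eq: "a i * box_vol I (l i) (u i) = b j * box_vol I (l' j) (u' j)"
      using mass ij by (simp add: box_mass_def)
    have "ennreal (a i * box_vol I (l i) (u i)) * (ennreal (1 - t) * \<phi> i + ennreal t * \<gamma> j)
        \<le> (nn_integral (lborel_on I) h)"
      by (rule two_box_integral[OF I t C[OF pos] C0[OF pos] lu eq]) (use h ij in auto)
    \<comment> \<open>The masses of the two boxes are equal, so a single factor serves both
      \<open>\<phi> i\<close> and \<open>\<gamma> j\<close>.\<close>
    then show ?thesis using ij eq by (simp add: distrib_left mult_ac)
  next
    case False
    obtain k c d where k: "k \<in> I"
      and meq: "box_mass I (below k c l F) l (cut_upper k c l u) a =
        box_mass I (below k d l' G) l' (cut_upper k d l' u') b"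
      and ne1: "below k c l F \<noteq> {}" "above k c u F \<noteq> {}" "below k d l' G \<noteq> {}" "above k d u' G \<noteq> {}"
      and lt: "card (below k c l F) + card (below k d l' G) < card F + card G"
        "card (above k c u F) + card (above k d u' G) < card F + card G"
    proof -
      have le: "card (below k c l F) \<le> card F" "card (above k c u F) \<le> card F"
        "card (below k d l' G) \<le> card G" "card (above k d u' G) \<le> card G" for k c d
        using fin by (auto intro!: card_mono simp: below_def above_def)
      have "card F \<noteq> 0" "card G \<noteq> 0" using ne fin by auto
      with False consider "2 \<le> card F" | "2 \<le> card G" by linarith
      then show thesis
      proof cases
        case 1
        obtain k c d where *: "k \<in> I"
          "card (below k c l F) < card F" "card (above k c u F) < card F"
          "box_mass I (below k c l F) l (cut_upper k c l u) a =
            box_mass I (below k d l' G) l' (cut_upper k d l' u') b"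
          "below k c l F \<noteq> {}" "above k c u F \<noteq> {}"
          using box_system_cut_exists[OF S T I mass 1] by blast
        have "box_mass I (above k c u F) (cut_lower k c l u) u a =
            box_mass I (above k d u' G) (cut_lower k d l' u') u' b"
          using mass *(4) box_mass_cut[OF S I *(1), of c] box_mass_cut[OF T I *(1), of d] by linarith
        then have "above k d u' G \<noteq> {}"
          by (rule box_mass_eq_nonempty) (rule box_system_above[OF S], rule *(6))
        moreover have "below k d l' G \<noteq> {}"
          by (rule box_mass_eq_nonempty[OF *(4) box_system_below[OF S] *(5)])
        ultimately show thesis using * le(3,4)[of k d]
          by (intro that[of k c d]) (assumption | rule add_less_le_mono)+
      next
        case 2
        obtain k c d where *: "k \<in> I"
          "card (below k d l' G) < card G" "card (above k d u' G) < card G"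
          "box_mass I (below k d l' G) l' (cut_upper k d l' u') b =
            box_mass I (below k c l F) l (cut_upper k c l u) a"
          "below k d l' G \<noteq> {}" "above k d u' G \<noteq> {}"
          using box_system_cut_exists[OF T S I mass[symmetric] 2] by blast
        have "box_mass I (above k d u' G) (cut_lower k d l' u') u' b =
            box_mass I (above k c u F) (cut_lower k c l u) u a"
          using mass *(4) box_mass_cut[OF S I *(1), of c] box_mass_cut[OF T I *(1), of d] by linarith
        then have "above k c u F \<noteq> {}"
          by (rule box_mass_eq_nonempty) (rule box_system_above[OF T], rule *(6))
        moreover have "below k c l F \<noteq> {}"
          by (rule box_mass_eq_nonempty[OF *(4) box_system_below[OF T] *(5)])
        ultimately show thesis using * le(1,2)[of k c]
          by (intro that[of k c d]) (assumption | rule add_le_less_mono | rule sym)+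
      qed
    qed
    have meq': "box_mass I (above k c u F) (cut_lower k c l u) u a =
        box_mass I (above k d u' G) (cut_lower k d l' u') u' b"
      using mass meq box_mass_cut[OF S I k, of c] box_mass_cut[OF T I k, of d] by linarith
    \<comment> \<open>Combinations of two lower pieces satisfy \<open>z k < e\<close>, those of two
      upper pieces \<open>e \<le> z k\<close>. Hence \<open>h\<close> splits into \<open>h1\<close>
      and \<open>h2\<close>, and no mixed combinations have to be considered.\<close>
    define e where "e = (1 - t) * c + t * d"
    define h1 where "h1 z = h z * indicator {z. z k < e} z" for z
    define h2 where "h2 z = h z * indicator {z. e \<le> z k} z" for z
    have [measurable]: "(\<lambda>z. z k) \<in> borel_measurable (lborel_on I)"
      using measurable_component_singleton[OF k, of "\<lambda>_. lborel :: real measure"] by simp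
    have [measurable]: "h1 \<in> borel_measurable (lborel_on I)"
       "h2 \<in> borel_measurable (lborel_on I)"
      unfolding h1_def[abs_def] h2_def[abs_def] by measurable
    have low: "ennreal (1 - t) * (\<Sum>i\<in>below k c l F. ennreal (a i * box_vol I (l i) (cut_upper k c l u i)) * \<phi> i)
      + ennreal t * (\<Sum>j\<in>below k d l' G. ennreal (b j * box_vol I (l' j) (cut_upper k d l' u' j)) * \<gamma> j)
      \<le> (nn_integral (lborel_on I) h1)"
    proof (rule less.hyps[OF lt(1) box_system_below[OF S] box_system_below[OF T] ne1(1,3) meq])
      fix i j z assume ij: "i \<in> below k c l F" "j \<in> below k d l' G"
        and z: "z \<in> half_open_box I (\<lambda>k. (1 - t) * l i k + t * l' j k)
          (\<lambda>k'. (1 - t) * cut_upper k c l u i k' + t * cut_upper k d l' u' j k')"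
      have up: "cut_upper k c l u i k' \<le> u i k'" "cut_upper k d l' u' j k' \<le> u' j k'" if "k' \<in> I" for k'
        using ij that S T by (auto simp: below_def cut_upper_def clamp_def box_system_def less_imp_le)
      have ce: "cut_upper k c l u i k \<le> c" "cut_upper k d l' u' j k \<le> d"
        using ij by (auto simp: below_def cut_upper_def clamp_def)
      have "z k < (1 - t) * cut_upper k c l u i k + t * cut_upper k d l' u' j k"
        using z k by (auto simp: half_open_box_def PiE_iff)
      also have "\<dots> \<le> e"
        unfolding e_def using ce t by (intro add_mono mult_left_mono) auto
      finally have "h1 z = h z" by (simp add: h1_def)
      moreover have "z \<in> half_open_box I (\<lambda>k. (1 - t) * l i k + t * l' j k) (\<lambda>k. (1 - t) * u i k + t * u' j k)"
        unfolding half_open_box_def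
      proof (rule PiE_I)
        fix k' assume k': "k' \<in> I"
        have "(1 - t) * cut_upper k c l u i k' + t * cut_upper k d l' u' j k'
            \<le> (1 - t) * u i k' + t * u' j k'"
          using up[OF k'] t by (intro add_mono mult_left_mono) auto
        then show "z k' \<in> {(1 - t) * l i k' + t * l' j k'..<(1 - t) * u i k' + t * u' j k'}"
          using z k' by (auto simp: half_open_box_def PiE_iff intro: less_le_trans)
      qed (use z in \<open>auto simp: half_open_box_def PiE_iff extensional_def\<close>)
      ultimately show "ennreal (C (a i) (b j)) * (ennreal (1 - t) * \<phi> i + ennreal t * \<gamma> j) \<le> h1 z"
        using h[of i j z] ij by (auto simp: below_def)
    qed measurable
    have high: "ennreal (1 - t) * (\<Sum>i\<in>above k c u F. ennreal (a i * box_vol I (cut_lower k c l u i) (u i)) * \<phi> i)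
      + ennreal t * (\<Sum>j\<in>above k d u' G. ennreal (b j * box_vol I (cut_lower k d l' u' j) (u' j)) * \<gamma> j)
      \<le> (nn_integral (lborel_on I) h2)"
    proof (rule less.hyps[OF lt(2) box_system_above[OF S] box_system_above[OF T] ne1(2,4) meq'])
      fix i j z assume ij: "i \<in> above k c u F" "j \<in> above k d u' G"
        and z: "z \<in> half_open_box I (\<lambda>k'. (1 - t) * cut_lower k c l u i k' + t * cut_lower k d l' u' j k')
          (\<lambda>k. (1 - t) * u i k + t * u' j k)"
      have up: "l i k' \<le> cut_lower k c l u i k'" "l' j k' \<le> cut_lower k d l' u' j k'" for k'
        by (auto simp: cut_lower_def clamp_def)
      have ce: "c \<le> cut_lower k c l u i k" "d \<le> cut_lower k d l' u' j k"
        using ij by (auto simp: above_def cut_lower_def clamp_def)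
      have "e \<le> (1 - t) * cut_lower k c l u i k + t * cut_lower k d l' u' j k"
        unfolding e_def using ce t by (intro add_mono mult_left_mono) auto
      also have "\<dots> \<le> z k"
        using z k by (auto simp: half_open_box_def PiE_iff)
      finally have "h2 z = h z" by (simp add: h2_def)
      moreover have "z \<in> half_open_box I (\<lambda>k. (1 - t) * l i k + t * l' j k) (\<lambda>k. (1 - t) * u i k + t * u' j k)"
        unfolding half_open_box_def
      proof (rule PiE_I)
        fix k' assume k': "k' \<in> I"
        have "(1 - t) * l i k' + t * l' j k' \<le>
            (1 - t) * cut_lower k c l u i k' + t * cut_lower k d l' u' j k'"
          using up t by (intro add_mono mult_left_mono) auto
        then show "z k' \<in> {(1 - t) * l i k' + t * l' j k'..<(1 - t) * u i k' + t * u' j k'}"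
          using z k' by (auto simp: half_open_box_def PiE_iff intro: order_trans)
      qed (use z in \<open>auto simp: half_open_box_def PiE_iff extensional_def\<close>)
      ultimately show "ennreal (C (a i) (b j)) * (ennreal (1 - t) * \<phi> i + ennreal t * \<gamma> j) \<le> h2 z"
        using h[of i j z] ij by (auto simp: above_def)
    qed measurable
    have "(nn_integral (lborel_on I) h1) + (nn_integral (lborel_on I) h2)
        = (\<integral>\<^sup>+z. h1 z + h2 z \<partial>lborel_on I)"
      by (rule nn_integral_add[symmetric]) measurable
    also have "\<dots> = nn_integral (lborel_on I) h"
      by (intro nn_integral_cong) (auto simp: h1_def h2_def indicator_def)
    finally show ?thesis
      using add_mono[OF low high]
      by (simp add: box_integral_cut[OF S I k, of \<phi> c] box_integral_cut[OF T I k, of \<gamma> d] distrib_left add_ac)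
  qed
qed

section \<open>Quasi-concave functions on the line\<close>

text \<open>Strict superlevel sets are the ones that turn suprema into unions, and the level 0 gives
  the set where \<open>f\<close> is positive.\<close>

definition quasi_concave :: "('a::real_vector \<Rightarrow> ennreal) \<Rightarrow> bool" where
  "quasi_concave f \<longleftrightarrow> (\<forall>s. convex {x. s < f x})"

lemma quasi_concave_borel:
  fixes f :: "real \<Rightarrow> ennreal"
  assumes "quasi_concave f"
  shows "f \<in> borel_measurable borel"
proof (rule borel_measurableI_greater)
  fix s
  have "is_interval {x. s < f x}"
    using assms by (simp add: quasi_concave_def is_interval_convex_1)
  then show "{x \<in> space borel. s < f x} \<in> sets borel"
    by (simp add: real_interval_borel_measurable)
qed

text \<open>Set to 0 for negative levels, so that the levels can be integrated over the whole line;
  written as an integral so that Fubini's theorem applies directly.\<close>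

definition superlevel_length :: "(real \<Rightarrow> ennreal) \<Rightarrow> real \<Rightarrow> ennreal" where
  "superlevel_length f s = (\<integral>\<^sup>+x. (if 0 \<le> s \<and> ennreal s < f x then 1 else 0) \<partial>lborel)"

lemma superlevel_length_measurable [measurable]:
  assumes [measurable]: "f \<in> borel_measurable borel"
  shows "superlevel_length f \<in> borel_measurable borel"
  unfolding superlevel_length_def[abs_def] by measurable

text \<open>Fubini's theorem for the region under the graph of \<open>f\<close>.\<close>

lemma layer_cake:
  assumes [measurable]: "f \<in> borel_measurable borel"
  shows "(nn_integral lborel f) = nn_integral lborel (superlevel_length f)"
proof -
  have "f x = (\<integral>\<^sup>+s. (if 0 \<le> s \<and> ennreal s < f x then 1 else 0) \<partial>lborel)" for x
  proof -
    have "(\<integral>\<^sup>+s. (if 0 \<le> s \<and> ennreal s < f x then 1 else 0) \<partial>lborel) =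
        (\<integral>\<^sup>+s. indicator {s. 0 \<le> s \<and> ennreal s < f x} s \<partial>lborel)"
      by (intro nn_integral_cong) (auto simp: indicator_def)
    also have "\<dots> = emeasure lborel {s. 0 \<le> s \<and> ennreal s < f x}"
      by (subst nn_integral_indicator) measurable
    also have "\<dots> = f x"
    proof (cases "f x")
      case (real r)
      then have "{s. 0 \<le> s \<and> ennreal s < f x} = {0..<r}"
        by (auto simp: ennreal_less_iff)
      then show ?thesis using real by simp
    next
      case top
      then have "{s. 0 \<le> s \<and> ennreal s < f x} = {0..}"
        by auto
      moreover have "emeasure lborel {0::real..} = top"
      proof (rule ccontr)
        assume "emeasure lborel {0::real..} \<noteq> top"
        then obtain n where n: "emeasure lborel {0::real..} < of_nat n"
          using ennreal_Ex_less_of_nat less_top by blast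
        have "emeasure lborel {0..real n} \<le> emeasure lborel {0::real..}"
          by (intro emeasure_mono) auto
        with n show False by (simp add: ennreal_of_nat_eq_real_of_nat)
      qed
      ultimately show ?thesis using top by simp
    qed
    finally show ?thesis by simp
  qed
  then have "(nn_integral lborel f) =
      (\<integral>\<^sup>+x. \<integral>\<^sup>+s. (if 0 \<le> s \<and> ennreal s < f x then 1 else 0) \<partial>lborel \<partial>lborel)"
    by (intro nn_integral_cong) auto
  also have "\<dots> = nn_integral lborel (superlevel_length f)"
    unfolding superlevel_length_def by (rule lborel_pair.Fubini'[symmetric]) measurable
  finally show ?thesis .
qed

lemma superlevel_length_eq:
  assumes [measurable]: "f \<in> borel_measurable borel" and "0 \<le> s"
  shows "superlevel_length f s = emeasure lborel {x. ennreal s < f x}"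
proof -
  have "superlevel_length f s = (\<integral>\<^sup>+x. indicator {x. ennreal s < f x} x \<partial>lborel)"
    unfolding superlevel_length_def using assms(2)
    by (intro nn_integral_cong) (auto simp: indicator_def)
  also have "\<dots> = emeasure lborel {x. ennreal s < f x}"
    by (subst nn_integral_indicator) measurable
  finally show ?thesis .
qed

lemma emeasure_convex_real_le:
  fixes A :: "real set"
  assumes "A \<noteq> {}" and le: "\<And>x y. x \<in> A \<Longrightarrow> y \<in> A \<Longrightarrow> x \<le> y \<Longrightarrow> ennreal (y - x) \<le> c"
  shows "emeasure lborel A \<le> c"
proof (cases c)
  case (real r)
  have d: "y - x \<le> r" if "x \<in> A" "y \<in> A" for x y
    using le[OF that] real by (cases "x \<le> y") (auto simp: ennreal_le_iff)
  obtain a where a: "a \<in> A" using assms by auto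
  have bd: "bdd_above A" "bdd_below A"
    using d[OF a] d[OF _ a] by (auto intro!: bdd_aboveI[of _ "a + r"] bdd_belowI[of _ "a - r"] simp: algebra_simps)
  have "Sup A \<le> y + r" if "y \<in> A" for y
    using d[OF that] assms(1) by (intro cSup_least) (auto simp: algebra_simps)
  then have "Sup A - r \<le> Inf A"
    using assms(1) by (intro cInf_greatest) (auto simp: algebra_simps)
  moreover have "A \<subseteq> {Inf A..Sup A}"
    using bd by (auto intro: cInf_lower cSup_upper)
  then have "emeasure lborel A \<le> emeasure lborel {Inf A..Sup A}"
    by (intro emeasure_mono) auto
  moreover have "Inf A \<le> Sup A"
    using bd a by (meson cInf_lower cSup_upper order_trans)
  ultimately show ?thesis
    using real by (auto intro: order_trans ennreal_leI)
qed simp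

lemma SUP_add_SUP_le_ennreal:
  fixes f :: "'i \<Rightarrow> ennreal" and g :: "'j \<Rightarrow> ennreal"
  assumes "A \<noteq> {}" "B \<noteq> {}" "\<And>i j. i \<in> A \<Longrightarrow> j \<in> B \<Longrightarrow> f i + g j \<le> c"
  shows "(SUP i\<in>A. f i) + (SUP j\<in>B. g j) \<le> c"
proof -
  have "(SUP i\<in>A. f i) + (SUP j\<in>B. g j) = (SUP i\<in>A. f i + (SUP j\<in>B. g j))"
    by (rule ennreal_SUP_add_left[OF assms(1), symmetric])
  also have "\<dots> \<le> c"
    unfolding ennreal_SUP_add_right[OF assms(2)] using assms(3) by (intro SUP_least)
  finally show ?thesis .
qed

text \<open>The length of a set is at most the supremum of the distances of its points. Pairs
  \<open>x \<le> x'\<close> in \<open>A\<close> and \<open>y \<le> y'\<close> in \<open>B\<close>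
  yield two points of \<open>S\<close> whose distance is
  \<open>(1 - t) * (x' - x) + t * (y' - y)\<close>, and the interval \<open>S\<close> contains the
  segment between them. Working with suprema covers infinite lengths as well.\<close>

lemma brunn_minkowski_real:
  fixes A B S :: "real set"
  assumes S: "convex S" and ne: "A \<noteq> {}" "B \<noteq> {}" and t: "0 < t" "t < 1"
    and sub: "\<And>x y. x \<in> A \<Longrightarrow> y \<in> B \<Longrightarrow> (1 - t) * x + t * y \<in> S"
  shows "ennreal (1 - t) * emeasure lborel A + ennreal t * emeasure lborel B \<le> emeasure lborel S"
proof -
  let ?d = "\<lambda>(x::real, x'). ennreal (x' - x)"
  have int: "is_interval S" using S by (simp add: is_interval_convex_1)
  then have meas: "S \<in> sets borel" by (simp add: real_interval_borel_measurable)
  have seg: "ennreal (z' - z) \<le> emeasure lborel S" if "z \<in> S" "z' \<in> S" for z z'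
  proof (cases "z \<le> z'")
    case True
    have "{z..z'} \<subseteq> S"
      using int that unfolding is_interval_1 by (metis atLeastAtMost_iff subsetI)
    then have "emeasure lborel {z..z'} \<le> emeasure lborel S"
      using meas by (intro emeasure_mono) auto
    then show ?thesis using True by simp
  qed (simp add: ennreal_neg)
  have len: "emeasure lborel A \<le> (SUP x\<in>{(x, x'). x \<in> A \<and> x' \<in> A \<and> x \<le> x'}. ?d x)" if "A \<noteq> {}" for A
  proof (rule emeasure_convex_real_le[OF that])
    fix x y assume "x \<in> A" "y \<in> A" "x \<le> y"
    then show "ennreal (y - x) \<le> (SUP x\<in>{(x, x'). x \<in> A \<and> x' \<in> A \<and> x \<le> x'}. ?d x)"
      by (intro SUP_upper2[of "(x, y)"]) auto
  qed
  have "ennreal (1 - t) * emeasure lborel A + ennreal t * emeasure lborel B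
    \<le> ennreal (1 - t) * (SUP x\<in>{(x, x'). x \<in> A \<and> x' \<in> A \<and> x \<le> x'}. ?d x)
     + ennreal t * (SUP x\<in>{(x, x'). x \<in> B \<and> x' \<in> B \<and> x \<le> x'}. ?d x)"
    using len ne by (intro add_mono mult_left_mono) auto
  also have "\<dots> = (SUP x\<in>{(x, x'). x \<in> A \<and> x' \<in> A \<and> x \<le> x'}. ennreal (1 - t) * ?d x)
     + (SUP x\<in>{(x, x'). x \<in> B \<and> x' \<in> B \<and> x \<le> x'}. ennreal t * ?d x)"
    by (simp add: SUP_mult_left_ennreal)
  also have "\<dots> \<le> emeasure lborel S"
  proof (rule SUP_add_SUP_le_ennreal)
    fix p q assume "p \<in> {(x, x'). x \<in> A \<and> x' \<in> A \<and> x \<le> x'}" "q \<in> {(y, y'). y \<in> B \<and> y' \<in> B \<and> y \<le> y'}"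
    then obtain x x' y y' where pq: "p = (x, x')" "q = (y, y')"
      and *: "x \<in> A" "x' \<in> A" "x \<le> x'" "y \<in> B" "y' \<in> B" "y \<le> y'"
      by auto
    have "ennreal (1 - t) * ?d p + ennreal t * ?d q =
        ennreal ((1 - t) * (x' - x) + t * (y' - y))"
      using * t pq by (simp add: ennreal_mult'[symmetric])
    also have "(1 - t) * (x' - x) + t * (y' - y) = ((1 - t) * x' + t * y') - ((1 - t) * x + t * y)"
      by (simp add: algebra_simps)
    also have "\<dots> \<le> emeasure lborel S"
      using * by (intro seg sub)
    finally show "ennreal (1 - t) * ?d p + ennreal t * ?d q \<le> emeasure lborel S" .
  qed (use ne in auto)
  finally show ?thesis .
qed

lemma ennreal_less_scale_iff:
  assumes "0 < a"
  shows "s < ennreal (1 / a) * y \<longleftrightarrow> ennreal a * s < y"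
proof (cases s; cases y)
  fix r q assume "0 \<le> r" "s = ennreal r" "0 \<le> q" "y = ennreal q"
  then show ?thesis
    using assms by (simp add: ennreal_mult'[symmetric] ennreal_less_iff field_simps)
qed (use assms in \<open>auto simp: ennreal_mult_top ennreal_mult_less_top ennreal_mult_eq_top_iff less_top[symmetric] not_less\<close>)

lemma quasi_concave_scale:
  assumes "quasi_concave f" "0 < a"
  shows "quasi_concave (\<lambda>x. ennreal a * f x)"
  using assms ennreal_less_scale_iff[of "1 / a"]
  by (simp add: quasi_concave_def)

text \<open>By homogeneity, functions with suprema \<open>a\<close> and \<open>b\<close> have a mean
  of at least \<open>c\<close> times the minimum of the normalized functions. This reduces a fiber
  to the exponent of the minimum.\<close>

lemma p_mean_ge_scaled_min:
  assumes ab: "0 < a" "0 < b" and t: "0 < t" "t < 1"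
    and c: "p_mean p (ennreal a) (ennreal b) t = ennreal c"
    and m: "ennreal a * m \<le> x" "ennreal b * m \<le> y" "m < \<infinity>"
  shows "ennreal c * m \<le> p_mean p x y t"
proof (cases "m = 0")
  case False
  then obtain r where r: "m = ennreal r" "0 < r"
    using m(3) by (cases m) (auto simp: less_le)
  have "ennreal c * m = p_mean p (ennreal (r * a)) (ennreal (r * b)) t"
    unfolding p_mean_homogeneous[OF r(2) ab t] using r c by (simp add: mult.commute)
  also have "\<dots> \<le> p_mean p x y t"
    using m r ab t by (intro p_mean_mono) (auto simp: ennreal_mult' mult.commute)
  finally show ?thesis .
qed simp

text \<open>Here \<open>v\<close> is the sup-convolution of the normalized functions for the
  minimum, and its superlevel sets are the Minkowski combinations of theirs. After normalization the
  superlevel sets of both functions are nonempty at the same levels, namely below 1, so the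
  inequality for lengths holds at every level and can be integrated. The function \<open>u\<close>
  is \<open>c\<close> times \<open>v\<close>.\<close>

lemma fiber_integral:
  fixes f g :: "real \<Rightarrow> ennreal"
  assumes qc: "quasi_concave f" "quasi_concave g" and t: "0 < t" "t < 1"
    and ab: "0 < a" "0 < b" and sup: "(SUP x. f x) = ennreal a" "(SUP x. g x) = ennreal b"
    and c: "p_mean p (ennreal a) (ennreal b) t = ennreal c"
  obtains u where "u \<in> borel_measurable borel" "\<And>z. u z \<le> sup_convolution p t f g z"
    "ennreal c * (ennreal (1 - t) * (ennreal (1 / a) * (nn_integral lborel f))
      + ennreal t * (ennreal (1 / b) * (nn_integral lborel g))) \<le> (nn_integral lborel u)"
proof
  define f' where "f' x = ennreal (1 / a) * f x" for x
  define g' where "g' x = ennreal (1 / b) * g x" for x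
  define v where "v z = (SUP x. min (f' x) (g' ((z - (1 - t) * x) / t)))" for z
  let ?u = "\<lambda>z. ennreal c * v z"
  have qc': "quasi_concave f'" "quasi_concave g'"
    unfolding f'_def g'_def using ab qc by (auto intro!: quasi_concave_scale)
  have [measurable]: "f \<in> borel_measurable borel" "g \<in> borel_measurable borel"
    "f' \<in> borel_measurable borel" "g' \<in> borel_measurable borel"
    using qc qc' by (auto intro: quasi_concave_borel)
  have sup': "(SUP x. f' x) = 1" "(SUP x. g' x) = 1"
    unfolding f'_def g'_def using sup ab
    by (auto simp: SUP_mult_left_ennreal[symmetric] ennreal_mult[symmetric])
  have le1: "f' x \<le> 1" "g' x \<le> 1" for x
    using SUP_upper[of x UNIV f'] SUP_upper[of x UNIV g'] sup' by auto
  have less_v: "s < v z \<longleftrightarrow> (\<exists>x y. z = (1 - t) * x + t * y \<and> s < f' x \<and> s < g' y)" for s z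
  proof
    assume "s < v z"
    then obtain x where "s < min (f' x) (g' ((z - (1 - t) * x) / t))"
      unfolding v_def less_SUP_iff by blast
    then show "\<exists>x y. z = (1 - t) * x + t * y \<and> s < f' x \<and> s < g' y"
      using t by (intro exI[of _ x] exI[of _ "(z - (1 - t) * x) / t"]) auto
  next
    assume "\<exists>x y. z = (1 - t) * x + t * y \<and> s < f' x \<and> s < g' y"
    then obtain x y where xy: "z = (1 - t) * x + t * y" "s < f' x" "s < g' y" by blast
    have "(z - (1 - t) * x) / t = y" using xy(1) t by simp
    then show "s < v z" unfolding v_def less_SUP_iff using xy by (intro bexI[of _ x]) auto
  qed
  have qcv: "quasi_concave v"
    unfolding quasi_concave_def
  proof
    fix s
    have "{z. s < v z} = (\<Union>x\<in>(\<lambda>x. (1 - t) * x) ` {x. s < f' x}. \<Union>y\<in>(\<lambda>y. t * y) ` {y. s < g' y}. {x + y})"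
      unfolding less_v by auto
    moreover have "convex ((\<lambda>x. (1 - t) * x) ` {x. s < f' x})" "convex ((\<lambda>y. t * y) ` {y. s < g' y})"
      using qc' unfolding quasi_concave_def
      by (auto intro!: convex_linear_image linearI simp: algebra_simps)
    ultimately show "convex {z. s < v z}"
      using convex_sums by metis
  qed
  then have [measurable]: "v \<in> borel_measurable borel" by (rule quasi_concave_borel)
  show "?u \<in> borel_measurable borel" by measurable
  show "?u z \<le> sup_convolution p t f g z" for z
    unfolding v_def SUP_mult_left_ennreal
  proof (rule SUP_least)
    fix x
    let ?y = "(z - (1 - t) * x) / t"
    let ?m = "min (f' x) (g' ?y)"
    have "ennreal a * f' x = f x" "ennreal b * g' ?y = g ?y"
      unfolding f'_def g'_def using ab
      by (simp_all add: mult.assoc[symmetric] ennreal_mult[symmetric])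
    then have "ennreal a * ?m \<le> f x" "ennreal b * ?m \<le> g ?y"
      by (metis min.cobounded1 mult_left_mono zero_le, metis min.cobounded2 mult_left_mono zero_le)
    moreover have "?m < \<infinity>"
      using le1[of x] by (auto simp: min_less_iff_disj le_less_trans)
    ultimately have "ennreal c * ?m \<le> p_mean p (f x) (g ?y) t"
      using p_mean_ge_scaled_min[OF ab t c] by blast
    also have "\<dots> \<le> sup_convolution p t f g z"
      unfolding sup_convolution_def using t
      by (intro SUP_upper2[of "(x, ?y)"]) auto
    finally show "ennreal c * ?m \<le> sup_convolution p t f g z" .
  qed
  have "ennreal (1 - t) * (nn_integral lborel f') + ennreal t * (nn_integral lborel g')
      = (\<integral>\<^sup>+s. ennreal (1 - t) * superlevel_length f' s + ennreal t * superlevel_length g' s \<partial>lborel)"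
    by (subst (1 2) layer_cake) (auto simp: nn_integral_add nn_integral_cmult)
  also have "\<dots> \<le> (nn_integral lborel (superlevel_length v))"
  proof (intro nn_integral_mono)
    fix s :: real
    consider "s < 0" | "0 \<le> s" "s < 1" | "1 \<le> s" by linarith
    then show "ennreal (1 - t) * superlevel_length f' s + ennreal t * superlevel_length g' s \<le> superlevel_length v s"
    proof cases
      case 1
      then show ?thesis by (simp add: superlevel_length_def)
    next
      case 2
      then have "ennreal s < (SUP x. f' x)" "ennreal s < (SUP x. g' x)"
        unfolding sup' by (auto simp: ennreal_less_one_iff)
      then have "{x. ennreal s < f' x} \<noteq> {}" "{x. ennreal s < g' x} \<noteq> {}"
        by (auto simp: less_SUP_iff)
      then have "ennreal (1 - t) * emeasure lborel {x. ennreal s < f' x} + ennreal t * emeasure lborel {x. ennreal s < g' x}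
          \<le> emeasure lborel {x. ennreal s < v x}"
        using qcv t by (intro brunn_minkowski_real) (auto simp: quasi_concave_def less_v)
      then show ?thesis using 2 by (simp add: superlevel_length_eq)
    next
      case 3
      then have "1 \<le> ennreal s" by simp
      then have "\<not> ennreal s < f' x" "\<not> ennreal s < g' x" for x
        using le1[of x] by (auto simp: not_less intro: order_trans)
      then show ?thesis by (simp add: superlevel_length_def)
    qed
  qed
  also have "\<dots> = nn_integral lborel v"
    by (rule layer_cake[symmetric]) measurable
  finally have "ennreal c * (ennreal (1 - t) * (nn_integral lborel f') + ennreal t * (nn_integral lborel g'))
      \<le> ennreal c * (nn_integral lborel v)"
    by (intro mult_left_mono) auto
  then show "ennreal c * (ennreal (1 - t) * (ennreal (1 / a) * (nn_integral lborel f))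
      + ennreal t * (ennreal (1 / b) * (nn_integral lborel g))) \<le> (nn_integral lborel ?u)"
    unfolding f'_def g'_def by (simp add: nn_integral_cmult)
qed

section \<open>From boxes to semicontinuous functions\<close>

text \<open>Take \<open>x\<close> and \<open>y\<close> at the same relative position in their boxes
  as \<open>z\<close>; \<open>e k\<close> is this position in the direction
  \<open>k\<close>.\<close>

lemma half_open_box_combination:
  assumes z: "z \<in> half_open_box I (\<lambda>k. (1 - t) * l k + t * l' k) (\<lambda>k. (1 - t) * u k + t * u' k)"
    and t: "0 < t" "t < 1" and lu: "\<And>k. k \<in> I \<Longrightarrow> l k < u k" "\<And>k. k \<in> I \<Longrightarrow> l' k < u' k"
  obtains x y where "x \<in> half_open_box I l u" "y \<in> half_open_box I l' u'"
    "z = (\<lambda>k\<in>I. (1 - t) * x k + t * y k)"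
proof
  define e where "e k = (z k - ((1 - t) * l k + t * l' k)) / ((1 - t) * (u k - l k) + t * (u' k - l' k))" for k
  have pos: "0 < (1 - t) * (u k - l k) + t * (u' k - l' k)" if "k \<in> I" for k
    using lu[OF that] t by (intro add_pos_pos mult_pos_pos) auto
  have e: "0 \<le> e k" "e k < 1" if "k \<in> I" for k
    using pos[OF that] z that by (auto simp: e_def half_open_box_def PiE_iff field_simps)
  show "(\<lambda>k\<in>I. l k + e k * (u k - l k)) \<in> half_open_box I l u"
    "(\<lambda>k\<in>I. l' k + e k * (u' k - l' k)) \<in> half_open_box I l' u'"
  proof -
    have *: "r + e k * (s - r) \<in> {r..<s}" if "r < s" "k \<in> I" for r s k
    proof -
      define d where "d = s - r"
      have "e k * d < 1 * d" "0 \<le> e k * d"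
        using e that by (auto simp: d_def intro!: mult_strict_right_mono mult_nonneg_nonneg)
      then have "r + e k * d \<in> {r..<r + d}" by simp
      then show ?thesis by (simp add: d_def)
    qed
    show "(\<lambda>k\<in>I. l k + e k * (u k - l k)) \<in> half_open_box I l u"
      "(\<lambda>k\<in>I. l' k + e k * (u' k - l' k)) \<in> half_open_box I l' u'"
      unfolding half_open_box_def using *[OF lu(1)] *[OF lu(2)] by (auto simp: PiE_iff)
  qed
  show "z = (\<lambda>k\<in>I. (1 - t) * (\<lambda>k\<in>I. l k + e k * (u k - l k)) k + t * (\<lambda>k\<in>I. l' k + e k * (u' k - l' k)) k)"
  proof (rule ext)
    fix k
    show "z k = (\<lambda>k\<in>I. (1 - t) * (\<lambda>k\<in>I. l k + e k * (u k - l k)) k + t * (\<lambda>k\<in>I. l' k + e k * (u' k - l' k)) k) k"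
    proof (cases "k \<in> I")
      case True
      have "e k * ((1 - t) * (u k - l k) + t * (u' k - l' k)) = z k - ((1 - t) * l k + t * l' k)"
        using pos[OF True] by (simp add: e_def)
      then show ?thesis using True by (simp add: algebra_simps)
    qed (use z in \<open>auto simp: half_open_box_def PiE_iff extensional_def\<close>)
  qed
qed

lemma SUP_nn_integral_zero:
  assumes "(SUP x. f x) = (0::ennreal)"
  shows "(\<integral>\<^sup>+x. f x \<partial>M) = 0"
proof -
  have "f x = 0" for x using SUP_upper[of x UNIV f] assms by simp
  then show ?thesis by simp
qed

text \<open>The function \<open>W\<close> need not be measurable: \<open>N\<close> is a bound for its lower integral.\<close>

lemma step_integral:
  fixes \<phi> \<psi> :: "'j \<Rightarrow> real \<Rightarrow> ennreal" and a b :: "'j \<Rightarrow> real"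
  assumes I: "finite I" and t: "0 < t" "t < 1" and p: "ereal (- 1 / real (card I + 1)) \<le> p"
    and Z: "finite Z" and lu: "\<And>i k. i \<in> Z \<Longrightarrow> k \<in> I \<Longrightarrow> l i k < u i k"
    and disj: "\<And>i j. i \<in> Z \<Longrightarrow> j \<in> Z \<Longrightarrow> i \<noteq> j \<Longrightarrow> \<exists>k\<in>I. u i k \<le> l j k \<or> u j k \<le> l i k"
    and qc: "\<And>i. i \<in> Z \<Longrightarrow> quasi_concave (\<phi> i)" "\<And>i. i \<in> Z \<Longrightarrow> quasi_concave (\<psi> i)"
    and a: "\<And>i. i \<in> Z \<Longrightarrow> (SUP x. \<phi> i x) = ennreal (a i)" "\<And>i. i \<in> Z \<Longrightarrow> 0 \<le> a i"
    and b: "\<And>i. i \<in> Z \<Longrightarrow> (SUP x. \<psi> i x) = ennreal (b i)" "\<And>i. i \<in> Z \<Longrightarrow> 0 \<le> b i"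
    and mass: "(\<Sum>i\<in>Z. a i * box_vol I (l i) (u i)) = (\<Sum>i\<in>Z. b i * box_vol I (l i) (u i))"
      "0 < (\<Sum>i\<in>Z. a i * box_vol I (l i) (u i))"
    and N: "\<And>w. case_prod w \<in> borel_measurable (lborel_on I \<Otimes>\<^sub>M lborel) \<Longrightarrow>
      (\<And>z \<alpha>. w z \<alpha> \<le> W z \<alpha>) \<Longrightarrow> double_integral (lborel_on I) w \<le> N"
    and W: "\<And>i j x y \<alpha>. i \<in> Z \<Longrightarrow> j \<in> Z \<Longrightarrow> x \<in> half_open_box I (l i) (u i) \<Longrightarrow> y \<in> half_open_box I (l j) (u j) \<Longrightarrow>
      sup_convolution p t (\<phi> i) (\<psi> j) \<alpha> \<le> W (\<lambda>k\<in>I. (1 - t) * x k + t * y k) \<alpha>"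
  shows "ennreal (1 - t) * (\<Sum>i\<in>Z. ennreal (box_vol I (l i) (u i)) * (nn_integral lborel (\<phi> i))) +
    ennreal t * (\<Sum>i\<in>Z. ennreal (box_vol I (l i) (u i)) * (nn_integral lborel (\<psi> i))) \<le> N"
proof -
  \<comment> \<open>Box systems need positive densities. On the cells left out the supremum is 0, so
    their fibers contribute nothing to the sums.\<close>
  define F where "F = {i\<in>Z. 0 < a i}"
  define G where "G = {i\<in>Z. 0 < b i}"
  define C where "C x y = enn2real (p_mean p (ennreal x) (ennreal y) t)" for x y
  have C: "p_mean p (ennreal x) (ennreal y) t = ennreal (C x y)" "0 < C x y" if xy: "0 < x" "0 < y" for x y
  proof -
    obtain c where "0 < c" "p_mean p (ennreal x) (ennreal y) t = ennreal c"
      using p_mean_real[OF xy t] by blast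
    then show "p_mean p (ennreal x) (ennreal y) t = ennreal (C x y)" "0 < C x y"
      by (simp_all add: C_def)
  qed
  let ?S = "\<lambda>i j. half_open_box I (\<lambda>k. (1 - t) * l i k + t * l j k) (\<lambda>k. (1 - t) * u i k + t * u j k)"
  let ?P = "lborel_on I"
  have "\<exists>v. v \<in> borel_measurable borel \<and> (\<forall>z. v z \<le> sup_convolution p t (\<phi> i) (\<psi> j) z) \<and>
    ennreal (C (a i) (b j)) * (ennreal (1 - t) * (ennreal (1 / a i) * (nn_integral lborel (\<phi> i)))
      + ennreal t * (ennreal (1 / b j) * (nn_integral lborel (\<psi> j)))) \<le> (nn_integral lborel v)"
    if "i \<in> F" "j \<in> G" for i j
  proof -
    have ij: "i \<in> Z" "j \<in> Z" "0 < a i" "0 < b j" using that by (auto simp: F_def G_def)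
    show ?thesis
      by (rule fiber_integral[OF qc(1)[OF ij(1)] qc(2)[OF ij(2)] t ij(3,4) a(1)[OF ij(1)] b(1)[OF ij(2)]
          C(1)[OF ij(3,4)]]) blast
  qed
  then obtain v where v: "\<And>i j. i \<in> F \<Longrightarrow> j \<in> G \<Longrightarrow> v i j \<in> borel_measurable borel"
    "\<And>i j z. i \<in> F \<Longrightarrow> j \<in> G \<Longrightarrow> v i j z \<le> sup_convolution p t (\<phi> i) (\<psi> j) z"
    "\<And>i j. i \<in> F \<Longrightarrow> j \<in> G \<Longrightarrow>
      ennreal (C (a i) (b j)) * (ennreal (1 - t) * (ennreal (1 / a i) * (nn_integral lborel (\<phi> i)))
      + ennreal t * (ennreal (1 / b j) * (nn_integral lborel (\<psi> j)))) \<le> (nn_integral lborel (v i j))"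
    by metis
  \<comment> \<open>The combined boxes of different pairs may overlap. The supremum over the
    finitely many pairs is measurable, stays below \<open>W\<close>, and dominates each
    \<open>v i j\<close> on its box.\<close>
  define w where "w z \<alpha> = (SUP (i, j)\<in>F \<times> G. indicator (?S i j) z * v i j \<alpha>)" for z \<alpha>
  have fin: "finite (F \<times> G)" using Z by (auto simp: F_def G_def)
  have w_meas [measurable]: "case_prod w \<in> borel_measurable (?P \<Otimes>\<^sub>M lborel)"
  proof -
    have "(\<lambda>x. indicator (?S i j) (fst x) * v i j (snd x)) \<in> borel_measurable (?P \<Otimes>\<^sub>M lborel)"
      if "i \<in> F" "j \<in> G" for i j
    proof -
      have [measurable]: "v i j \<in> borel_measurable borel" "?S i j \<in> sets ?P"
        using v(1)[OF that] half_open_box_sets[OF I] by auto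
      show ?thesis by measurable
    qed
    then show ?thesis
      unfolding w_def case_prod_beta' using fin
      by (intro borel_measurable_SUP countable_finite) auto
  qed
  have w_le: "w z \<alpha> \<le> W z \<alpha>" for z \<alpha>
    unfolding w_def
  proof (rule SUP_least)
    fix q assume "q \<in> F \<times> G"
    then obtain i j where q: "q = (i, j)" "i \<in> F" "j \<in> G" by auto
    show "(case q of (i, j) \<Rightarrow> indicator (?S i j) z * v i j \<alpha>) \<le> W z \<alpha>"
    proof (cases "z \<in> ?S i j")
      case True
      obtain x y where "x \<in> half_open_box I (l i) (u i)" "y \<in> half_open_box I (l j) (u j)"
        "z = (\<lambda>k\<in>I. (1 - t) * x k + t * y k)"
        using half_open_box_combination[OF True t] lu q by (auto simp: F_def G_def)
      then have "sup_convolution p t (\<phi> i) (\<psi> j) \<alpha> \<le> W z \<alpha>"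
        using W[of i j x y \<alpha>] q by (auto simp: F_def G_def)
      then show ?thesis using v(2)[OF q(2,3)] True q by (auto intro: order_trans)
    qed (simp add: q)
  qed
  let ?h = "\<lambda>z. \<integral>\<^sup>+\<alpha>. w z \<alpha> \<partial>lborel"
  have sysF: "box_system I F l u a" and sysG: "box_system I G l u b"
    using Z lu disj by (auto simp: box_system_def F_def G_def)
  have mF: "box_mass I F l u a = (\<Sum>i\<in>Z. a i * box_vol I (l i) (u i))"
    unfolding box_mass_def F_def using Z a(2) by (intro sum.mono_neutral_left) (auto simp: less_le)
  have mG: "box_mass I G l u b = (\<Sum>i\<in>Z. b i * box_vol I (l i) (u i))"
    unfolding box_mass_def G_def using Z b(2) by (intro sum.mono_neutral_left) (auto simp: less_le)
  have "ennreal (1 - t) * (\<Sum>i\<in>F. ennreal (a i * box_vol I (l i) (u i)) * (ennreal (1 / a i) * (nn_integral lborel (\<phi> i))))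
      + ennreal t * (\<Sum>j\<in>G. ennreal (b j * box_vol I (l j) (u j)) * (ennreal (1 / b j) * (nn_integral lborel (\<psi> j))))
    \<le> (nn_integral ?P ?h)"
  proof (rule box_system_integral[where C = C, OF I t _ _ sysF sysG])
    fix x y :: real and f g assume xy: "0 < x" "0 < y" and fg: "\<And>i. i \<in> I \<Longrightarrow> 0 < f i" "\<And>i. i \<in> I \<Longrightarrow> 0 < g i"
      "x * prod f I = y * prod g I"
    show "x * prod f I \<le> C x y * (\<Prod>i\<in>I. (1 - t) * f i + t * g i)"
      by (rule p_mean_box[OF I fg(1,2) t xy fg(3) p C(1)[OF xy] C(2)[OF xy]])
  next
    show "0 \<le> C r s" for r s :: real by (simp add: C_def)
    show "F \<noteq> {}" "G \<noteq> {}"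
      using mF mG mass by (auto simp: box_mass_def)
    show "box_mass I F l u a = box_mass I G l u b" using mF mG mass by simp
    show "?h \<in> borel_measurable ?P" by measurable
    fix i j z assume ij: "i \<in> F" "j \<in> G" and z: "z \<in> ?S i j"
    have "ennreal (C (a i) (b j)) * (ennreal (1 - t) * (ennreal (1 / a i) * (nn_integral lborel (\<phi> i)))
      + ennreal t * (ennreal (1 / b j) * (nn_integral lborel (\<psi> j)))) \<le> (nn_integral lborel (v i j))"
      by (rule v(3)[OF ij])
    also have "\<dots> \<le> ?h z"
    proof (rule nn_integral_mono)
      fix \<alpha>
      show "v i j \<alpha> \<le> w z \<alpha>"
        unfolding w_def using ij z by (intro SUP_upper2[of "(i, j)"]) auto
    qed
    finally show "ennreal (C (a i) (b j)) * (ennreal (1 - t) * (ennreal (1 / a i) * (nn_integral lborel (\<phi> i)))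
      + ennreal t * (ennreal (1 / b j) * (nn_integral lborel (\<psi> j)))) \<le> ?h z" .
  qed
  also have "\<dots> \<le> N" by (rule N[OF w_meas w_le])
  \<comment> \<open>The density \<open>a i\<close> cancels against the normalization of the fiber by
    \<open>1 / a i\<close>.\<close>
  also have "(\<Sum>i\<in>F. ennreal (a i * box_vol I (l i) (u i)) * (ennreal (1 / a i) * (nn_integral lborel (\<phi> i))))
      = (\<Sum>i\<in>F. ennreal (box_vol I (l i) (u i)) * (nn_integral lborel (\<phi> i)))"
    by (intro sum.cong refl)
      (auto simp: F_def mult.assoc[symmetric] ennreal_mult''[symmetric])
  also have "\<dots> = (\<Sum>i\<in>Z. ennreal (box_vol I (l i) (u i)) * (nn_integral lborel (\<phi> i)))"
    using Z a by (intro sum.mono_neutral_left) (auto simp: F_def less_le intro: SUP_nn_integral_zero)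
  also have "(\<Sum>i\<in>G. ennreal (b i * box_vol I (l i) (u i)) * (ennreal (1 / b i) * (nn_integral lborel (\<psi> i))))
      = (\<Sum>i\<in>G. ennreal (box_vol I (l i) (u i)) * (nn_integral lborel (\<psi> i)))"
    by (intro sum.cong refl)
      (auto simp: G_def mult.assoc[symmetric] ennreal_mult''[symmetric])
  also have "\<dots> = (\<Sum>i\<in>Z. ennreal (box_vol I (l i) (u i)) * (nn_integral lborel (\<psi> i)))"
    using Z b by (intro sum.mono_neutral_left) (auto simp: G_def less_le intro: SUP_nn_integral_zero)
  finally show ?thesis .
qed

section \<open>Dyadic approximation from below\<close>

lemma quasi_concave_iff:
  "quasi_concave f \<longleftrightarrow>
    (\<forall>x y u v. 0 \<le> u \<longrightarrow> 0 \<le> v \<longrightarrow> u + v = 1 \<longrightarrow> min (f x) (f y) \<le> f (u *\<^sub>R x + v *\<^sub>R y))"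
  (is "_ \<longleftrightarrow> ?R")
proof
  assume qc: "quasi_concave f"
  show ?R
  proof (intro allI impI, rule dense_le)
    fix x y u v s assume *: "0 \<le> u" "0 \<le> v" "u + v = (1::real)" "s < min (f x) (f y)"
    have "convex {x. s < f x}" using qc by (simp add: quasi_concave_def)
    then have "u *\<^sub>R x + v *\<^sub>R y \<in> {x. s < f x}"
      using * by (intro convexD) auto
    then show "s \<le> f (u *\<^sub>R x + v *\<^sub>R y)" by auto
  qed
next
  assume R: ?R
  show "quasi_concave f"
    unfolding quasi_concave_def convex_def
  proof (intro allI ballI impI)
    fix s x y u v assume *: "x \<in> {x. s < f x}" "y \<in> {x. s < f x}" "0 \<le> u" "0 \<le> v" "u + v = (1::real)"
    have "s < min (f x) (f y)" using * by simp
    also have "\<dots> \<le> f (u *\<^sub>R x + v *\<^sub>R y)" using R * by blast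
    finally show "u *\<^sub>R x + v *\<^sub>R y \<in> {x. s < f x}" by simp
  qed
qed

lemma quasi_concave_min_const:
  assumes "quasi_concave f"
  shows "quasi_concave (\<lambda>x. min c (f x))"
  unfolding quasi_concave_iff
proof (intro allI impI)
  fix x y u v assume "0 \<le> u" "0 \<le> v" "u + v = (1::real)"
  then have "min (f x) (f y) \<le> f (u *\<^sub>R x + v *\<^sub>R y)"
    using assms by (auto simp: quasi_concave_iff)
  then have "min c (min (f x) (f y)) \<le> min c (f (u *\<^sub>R x + v *\<^sub>R y))"
    by (intro min.mono order_refl)
  then show "min (min c (f x)) (min c (f y)) \<le> min c (f (u *\<^sub>R x + v *\<^sub>R y))"
    by (simp add: min.assoc min.left_commute)
qed

lemma quasi_concave_INF:
  assumes "\<And>i. i \<in> S \<Longrightarrow> quasi_concave (f i)"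
  shows "quasi_concave (\<lambda>x. INF i\<in>S. f i x)"
  unfolding quasi_concave_iff
proof (intro allI impI INF_greatest)
  fix x y u v i assume *: "0 \<le> u" "0 \<le> v" "u + v = (1::real)" "i \<in> S"
  have "min (INF i\<in>S. f i x) (INF i\<in>S. f i y) \<le> min (f i x) (f i y)"
    using * by (intro min.mono INF_lower)
  also have "\<dots> \<le> f i (u *\<^sub>R x + v *\<^sub>R y)"
    using assms[OF *(4)] * by (auto simp: quasi_concave_iff)
  finally show "min (INF i\<in>S. f i x) (INF i\<in>S. f i y) \<le> f i (u *\<^sub>R x + v *\<^sub>R y)" .
qed

text \<open>Lower semicontinuity in the coordinates from \<open>I\<close> at a fixed height
  \<open>\<alpha>\<close>; along the fiber nothing is demanded. In particular \<open>F c\<close>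
  depends only on the values of \<open>c\<close> on \<open>I\<close>.\<close>

definition lsc_in :: "'i set \<Rightarrow> (('i \<Rightarrow> real) \<Rightarrow> real \<Rightarrow> ennreal) \<Rightarrow> bool" where
  "lsc_in I F \<longleftrightarrow> (\<forall>c \<alpha> s. s < F c \<alpha> \<longrightarrow> (\<exists>r>0. \<forall>c'. (\<forall>i\<in>I. \<bar>c' i - c i\<bar> < r) \<longrightarrow> s < F c' \<alpha>))"

definition grid_cell :: "'i set \<Rightarrow> nat \<Rightarrow> ('i \<Rightarrow> real) \<Rightarrow> 'i \<Rightarrow> int" where
  "grid_cell I k c = (\<lambda>i\<in>I. \<lfloor>2 ^ k * c i\<rfloor>)"

definition grid_cells :: "'i set \<Rightarrow> nat \<Rightarrow> ('i \<Rightarrow> int) set" where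
  "grid_cells I k = (\<Pi>\<^sub>E i\<in>I. {- (int k * 2 ^ k)..<int k * 2 ^ k})"

definition cell_lower :: "nat \<Rightarrow> ('i \<Rightarrow> int) \<Rightarrow> 'i \<Rightarrow> real" where
  "cell_lower k z i = real_of_int (z i) / 2 ^ k"

definition cell_upper :: "nat \<Rightarrow> ('i \<Rightarrow> int) \<Rightarrow> 'i \<Rightarrow> real" where
  "cell_upper k z i = (real_of_int (z i) + 1) / 2 ^ k"

abbreviation cell_box :: "'i set \<Rightarrow> nat \<Rightarrow> ('i \<Rightarrow> int) \<Rightarrow> ('i \<Rightarrow> real) set" where
  "cell_box I k z \<equiv> half_open_box I (cell_lower k z) (cell_upper k z)"

text \<open>The infimum is taken at each height separately, so a cell carries a whole quasi-concave
  fiber. The cap \<open>k\<close> makes the supremum of this fiber finite, as the normalization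
  requires.\<close>

definition cell_inf :: "'i set \<Rightarrow> nat \<Rightarrow> (('i \<Rightarrow> real) \<Rightarrow> real \<Rightarrow> ennreal) \<Rightarrow> ('i \<Rightarrow> int) \<Rightarrow> real \<Rightarrow> ennreal" where
  "cell_inf I k F z \<alpha> = min (of_nat k) (INF c\<in>{c. grid_cell I k c = z}. F c \<alpha>)"

definition grid_approx :: "'i set \<Rightarrow> nat \<Rightarrow> (('i \<Rightarrow> real) \<Rightarrow> real \<Rightarrow> ennreal) \<Rightarrow> ('i \<Rightarrow> real) \<Rightarrow> real \<Rightarrow> ennreal" where
  "grid_approx I k F c \<alpha> =
    (if grid_cell I k c \<in> grid_cells I k then cell_inf I k F (grid_cell I k c) \<alpha> else 0)"

lemma finite_grid_cells: "finite I \<Longrightarrow> finite (grid_cells I k)"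
  unfolding grid_cells_def by (intro finite_PiE) auto

lemma grid_cell_in_grid_cells:
  "grid_cell I k c \<in> grid_cells I k \<longleftrightarrow> (\<forall>i\<in>I. - real k \<le> c i \<and> c i < real k)"
proof -
  have "- (int k * 2 ^ k) \<le> \<lfloor>2 ^ k * x\<rfloor> \<longleftrightarrow> - real k \<le> x" for x :: real
  proof -
    have "- (int k * 2 ^ k) \<le> \<lfloor>2 ^ k * x\<rfloor> \<longleftrightarrow> - (real k * 2 ^ k) \<le> 2 ^ k * x"
      by (simp add: le_floor_iff)
    also have "\<dots> \<longleftrightarrow> 2 ^ k * (- real k) \<le> 2 ^ k * x" by (simp add: mult.commute)
    also have "\<dots> \<longleftrightarrow> - real k \<le> x" by (subst mult_le_cancel_left_pos) auto
    finally show ?thesis .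
  qed
  moreover have "\<lfloor>2 ^ k * x\<rfloor> < int k * 2 ^ k \<longleftrightarrow> x < real k" for x :: real
  proof -
    have "\<lfloor>2 ^ k * x\<rfloor> < int k * 2 ^ k \<longleftrightarrow> 2 ^ k * x < real k * 2 ^ k"
      by (simp add: floor_less_iff)
    also have "\<dots> \<longleftrightarrow> 2 ^ k * x < 2 ^ k * real k" by (simp add: mult.commute)
    also have "\<dots> \<longleftrightarrow> x < real k" by (subst mult_less_cancel_left_pos) auto
    finally show ?thesis .
  qed
  ultimately show ?thesis
    by (auto simp: grid_cell_def grid_cells_def PiE_iff)
qed

lemma grid_cell_refine:
  assumes "grid_cell I (Suc k) c = grid_cell I (Suc k) c'"
  shows "grid_cell I k c = grid_cell I k c'"
proof -
  have "\<lfloor>2 ^ k * x\<rfloor> = \<lfloor>2 ^ Suc k * x\<rfloor> div 2" for x :: real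
    using floor_divide_real_eq_div[of 2 "2 ^ Suc k * x"] by simp
  moreover have "\<lfloor>2 ^ Suc k * c i\<rfloor> = \<lfloor>2 ^ Suc k * c' i\<rfloor>" if "i \<in> I" for i
    using fun_cong[OF assms, of i] that by (simp add: grid_cell_def)
  ultimately show ?thesis by (auto simp: grid_cell_def)
qed

lemma grid_approx_le: "grid_approx I k F c \<alpha> \<le> F c \<alpha>"
  by (auto simp: grid_approx_def cell_inf_def intro!: min.coboundedI2 INF_lower)

text \<open>Passing to \<open>Suc k\<close> shrinks the cells, raises the cap and enlarges the
  window; each of these can only increase the value.\<close>

lemma grid_approx_le_Suc: "grid_approx I k F c \<alpha> \<le> grid_approx I (Suc k) F c \<alpha>"
proof (cases "grid_cell I k c \<in> grid_cells I k")
  case True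
  then have "grid_cell I (Suc k) c \<in> grid_cells I (Suc k)"
    unfolding grid_cell_in_grid_cells by auto
  moreover have "cell_inf I k F (grid_cell I k c) \<alpha> \<le> cell_inf I (Suc k) F (grid_cell I (Suc k) c) \<alpha>"
    unfolding cell_inf_def using grid_cell_refine
    by (intro min.mono INF_superset_mono) (auto simp: of_nat_le_iff[symmetric] simp del: of_nat_Suc of_nat_le_iff)
  ultimately show ?thesis using True by (simp add: grid_approx_def)
qed (simp add: grid_approx_def)

lemma incseq_grid_approx: "incseq (\<lambda>k. grid_approx I k F c \<alpha>)"
  by (intro incseq_SucI grid_approx_le_Suc)

lemma SUP_grid_approx:
  assumes I: "finite I" and lsc: "lsc_in I F"
  shows "(SUP k. grid_approx I k F c \<alpha>) = F c \<alpha>"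
proof (rule antisym)
  show "(SUP k. grid_approx I k F c \<alpha>) \<le> F c \<alpha>"
    by (intro SUP_least grid_approx_le)
  show "F c \<alpha> \<le> (SUP k. grid_approx I k F c \<alpha>)"
  proof (rule dense_le)
    fix s assume s: "s < F c \<alpha>"
    then obtain r where r: "0 < r" "\<And>c'. (\<forall>i\<in>I. \<bar>c' i - c i\<bar> < r) \<Longrightarrow> s < F c' \<alpha>"
      using lsc unfolding lsc_in_def by blast
    have "s < \<infinity>" using s by (auto simp: less_top[symmetric])
    then obtain k1 :: nat where k1: "s < of_nat k1" using ennreal_Ex_less_of_nat by auto
    obtain k2 where k2: "(1 / 2) ^ k2 < r" using r(1) real_arch_pow_inv[of r "1/2"] by auto
    obtain k3 :: nat where k3: "(\<Sum>i\<in>I. \<bar>c i\<bar>) < real k3" using reals_Archimedean2 by blast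
    \<comment> \<open>Three demands: the cap exceeds \<open>s\<close>, the cells are smaller than
      \<open>r\<close>, and \<open>c\<close> lies in the window.\<close>
    define k where "k = max k1 (max k2 k3)"
    have k: "s \<le> of_nat k" "1 / 2 ^ k < r"
    proof -
      have "(of_nat k1 :: ennreal) \<le> of_nat k" by (simp add: k_def)
      then show "s \<le> of_nat k" using k1 by (meson less_imp_le order_trans)
      have "(1 / 2 :: real) ^ k \<le> (1 / 2) ^ k2" by (intro power_decreasing) (auto simp: k_def)
      then show "1 / 2 ^ k < r" using k2 by (simp add: power_divide)
    qed
    have "\<bar>c i\<bar> < real k" if "i \<in> I" for i
    proof -
      have "\<bar>c i\<bar> \<le> (\<Sum>i\<in>I. \<bar>c i\<bar>)" using that I by (intro member_le_sum) auto
      moreover have "real k3 \<le> real k" by (simp add: k_def)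
      ultimately show ?thesis using k3 by linarith
    qed
    then have in_cells: "grid_cell I k c \<in> grid_cells I k"
      unfolding grid_cell_in_grid_cells by (force simp: abs_less_iff)
    have "s \<le> F c' \<alpha>" if c': "grid_cell I k c' = grid_cell I k c" for c'
    proof -
      have "\<bar>c' i - c i\<bar> < r" if "i \<in> I" for i
      proof -
        have "\<lfloor>2 ^ k * c' i\<rfloor> = \<lfloor>2 ^ k * c i\<rfloor>"
          using fun_cong[OF c', of i] that by (simp add: grid_cell_def)
        then have "\<bar>2 ^ k * c' i - 2 ^ k * c i\<bar> < 1" by linarith
        then have "2 ^ k * \<bar>c' i - c i\<bar> < 1"
          by (simp add: abs_mult right_diff_distrib[symmetric])
        then have "\<bar>c' i - c i\<bar> < 1 / 2 ^ k" by (simp add: field_simps)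
        then show ?thesis using k(2) by linarith
      qed
      then show ?thesis using r(2)[of c'] by auto
    qed
    then have "s \<le> grid_approx I k F c \<alpha>"
      using in_cells k(1) by (auto simp: grid_approx_def cell_inf_def intro: INF_greatest)
    then show "s \<le> (SUP k. grid_approx I k F c \<alpha>)" by (rule SUP_upper2[rotated]) simp
  qed
qed

lemma grid_cell_eq_iff_box:
  assumes "c \<in> extensional I" "z \<in> grid_cells I k"
  shows "grid_cell I k c = z \<longleftrightarrow> c \<in> cell_box I k z"
proof -
  have "\<lfloor>2 ^ k * x\<rfloor> = m \<longleftrightarrow> real_of_int m / 2 ^ k \<le> x \<and> x < (real_of_int m + 1) / 2 ^ k" for x m
    unfolding floor_eq_iff by (simp add: field_simps)
  then have "grid_cell I k c = z \<longleftrightarrow> (\<forall>i\<in>I. cell_lower k z i \<le> c i \<and> c i < cell_upper k z i)"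
    using assms(2) by (auto simp: grid_cell_def cell_lower_def cell_upper_def grid_cells_def PiE_iff fun_eq_iff extensional_def)
  then show ?thesis using assms(1) by (auto simp: half_open_box_def PiE_iff)
qed

lemma cell_lower_less_upper: "cell_lower k z i < cell_upper k z i"
  by (simp add: cell_lower_def cell_upper_def divide_strict_right_mono)

lemma grid_cells_disjoint:
  assumes "z \<in> grid_cells I k" "z' \<in> grid_cells I k" "z \<noteq> z'"
  shows "\<exists>i\<in>I. cell_upper k z i \<le> cell_lower k z' i \<or> cell_upper k z' i \<le> cell_lower k z i"
proof -
  obtain i where i: "i \<in> I" "z i \<noteq> z' i"
    using assms PiE_ext unfolding grid_cells_def by metis
  have less: "(real_of_int m + 1) / 2 ^ k \<le> real_of_int m' / 2 ^ k" if "m < m'" for m m'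
    using that by (intro divide_right_mono) auto
  show ?thesis
    using i less[of "z i" "z' i"] less[of "z' i" "z i"]
    by (intro bexI[of _ i]) (auto simp: cell_lower_def cell_upper_def neq_iff)
qed

text \<open>A lookup by cell index becomes a finite sum of indicators, from which measurability and
  integrals can be read off.\<close>

lemma grid_sum:
  assumes I: "finite I" and c: "c \<in> extensional I"
  shows "(if grid_cell I k c \<in> grid_cells I k then \<Theta> (grid_cell I k c) else (0::ennreal)) =
    (\<Sum>z\<in>grid_cells I k. \<Theta> z * indicator (cell_box I k z) c)"
proof -
  have "(\<Sum>z\<in>grid_cells I k. \<Theta> z * indicator (cell_box I k z) c)
    = (\<Sum>z\<in>grid_cells I k. if grid_cell I k c = z then \<Theta> z else 0)"
    using grid_cell_eq_iff_box[OF c] by (intro sum.cong) (auto simp: indicator_def)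
  then show ?thesis using finite_grid_cells[OF I] by (simp add: sum.delta')
qed

lemma nn_integral_grid:
  assumes I: "finite I"
  shows "(\<integral>\<^sup>+c. (if grid_cell I k c \<in> grid_cells I k then \<Theta> (grid_cell I k c) else 0) \<partial>lborel_on I)
    = (\<Sum>z\<in>grid_cells I k. ennreal (box_vol I (cell_lower k z) (cell_upper k z)) * \<Theta> z)"
proof -
  have "(\<integral>\<^sup>+c. (if grid_cell I k c \<in> grid_cells I k then \<Theta> (grid_cell I k c) else 0) \<partial>lborel_on I)
    = (\<integral>\<^sup>+c. (\<Sum>z\<in>grid_cells I k. \<Theta> z * indicator (cell_box I k z) c) \<partial>lborel_on I)"
    by (intro nn_integral_cong grid_sum[OF I]) (auto simp: space_PiM PiE_iff)
  also have "\<dots> = (\<Sum>z\<in>grid_cells I k. \<integral>\<^sup>+c. \<Theta> z * indicator (cell_box I k z) c \<partial>lborel_on I)"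
    using half_open_box_sets[OF I] by (intro nn_integral_sum borel_measurable_times_ennreal borel_measurable_indicator) auto
  also have "\<dots> = (\<Sum>z\<in>grid_cells I k. ennreal (box_vol I (cell_lower k z) (cell_upper k z)) * \<Theta> z)"
    using half_open_box_sets[OF I]
    by (intro sum.cong refl)
      (auto simp: nn_integral_cmult_indicator emeasure_half_open_box[OF I less_imp_le[OF cell_lower_less_upper]] mult.commute)
  finally show ?thesis .
qed

lemma grid_measurable:
  assumes I: "finite I"
  shows "(\<lambda>c. if grid_cell I k c \<in> grid_cells I k then \<Theta> (grid_cell I k c) else (0::ennreal))
    \<in> borel_measurable (lborel_on I)"
proof -
  have "(\<lambda>c. \<Sum>z\<in>grid_cells I k. \<Theta> z * indicator (cell_box I k z) c)
    \<in> borel_measurable (lborel_on I)"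
    using half_open_box_sets[OF I]
    by (intro borel_measurable_sum borel_measurable_times_ennreal borel_measurable_indicator) auto
  then show ?thesis
    by (rule measurable_cong[THEN iffD1, rotated])
      (intro grid_sum[OF I, symmetric], auto simp: space_PiM PiE_iff)
qed

lemma quasi_concave_cell_inf:
  "(\<And>c. quasi_concave (F c)) \<Longrightarrow> quasi_concave (cell_inf I k F z)"
  unfolding cell_inf_def[abs_def] by (intro quasi_concave_min_const quasi_concave_INF)

lemma grid_approx_measurable:
  assumes I: "finite I" and qc: "\<And>c. quasi_concave (F c)"
  shows "(\<lambda>(c, \<alpha>). grid_approx I k F c \<alpha>) \<in> borel_measurable (lborel_on I \<Otimes>\<^sub>M lborel)"
proof -
  let ?P = "lborel_on I"
  have "(\<lambda>x. \<Sum>z\<in>grid_cells I k. cell_inf I k F z (snd x) *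
      indicator (cell_box I k z) (fst x))
    \<in> borel_measurable (?P \<Otimes>\<^sub>M lborel)"
  proof (rule borel_measurable_sum)
    fix z
    have [measurable]: "cell_box I k z \<in> sets ?P"
      by (rule half_open_box_sets[OF I])
    have [measurable]: "cell_inf I k F z \<in> borel_measurable borel"
      by (intro quasi_concave_borel quasi_concave_cell_inf qc)
    show "(\<lambda>x. cell_inf I k F z (snd x) *
      indicator (cell_box I k z) (fst x)) \<in> borel_measurable (?P \<Otimes>\<^sub>M lborel)"
      by measurable
  qed
  then show ?thesis
  proof (rule measurable_cong[THEN iffD1, rotated])
    fix x assume "x \<in> space (?P \<Otimes>\<^sub>M (lborel :: real measure))"
    then have "fst x \<in> extensional I" by (auto simp: space_pair_measure space_PiM PiE_iff)
    then show "(\<Sum>z\<in>grid_cells I k. cell_inf I k F z (snd x) *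
      indicator (cell_box I k z) (fst x)) = (case x of (c, \<alpha>) \<Rightarrow> grid_approx I k F c \<alpha>)"
      by (simp add: grid_sum[OF I, symmetric, where \<Theta> = "\<lambda>z. cell_inf I k F z (snd x)"] grid_approx_def case_prod_beta')
  qed
qed

text \<open>Both functions are countable suprema of grid approximations. For the second, the
  uncountable supremum over the heights is exchanged with the one over \<open>k\<close>; what
  remains for fixed \<open>k\<close> takes finitely many values.\<close>

lemma lsc_in_measurable:
  assumes I: "finite I" and qc: "\<And>c. quasi_concave (F c)" and lsc: "lsc_in I F"
  shows "case_prod F \<in> borel_measurable (lborel_on I \<Otimes>\<^sub>M lborel)"
    and "(\<lambda>c. SUP \<alpha>. F c \<alpha>) \<in> borel_measurable (lborel_on I)"
proof -
  have F: "F c \<alpha> = (SUP k. grid_approx I k F c \<alpha>)" for c \<alpha>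
    by (rule SUP_grid_approx[OF I lsc, symmetric])
  have "(\<lambda>x. SUP k. (\<lambda>(c, \<alpha>). grid_approx I k F c \<alpha>) x) \<in>
      borel_measurable (lborel_on I \<Otimes>\<^sub>M lborel)"
    by (intro borel_measurable_SUP grid_approx_measurable I qc) auto
  then show "case_prod F \<in> borel_measurable (lborel_on I \<Otimes>\<^sub>M lborel)"
    by (simp add: case_prod_beta' F[symmetric])
  have "(SUP \<alpha>. F c \<alpha>) = (SUP k. if grid_cell I k c \<in> grid_cells I k then SUP \<alpha>. cell_inf I k F (grid_cell I k c) \<alpha> else 0)" for c
  proof -
    have "(SUP \<alpha>. F c \<alpha>) = (SUP \<alpha>. SUP k. grid_approx I k F c \<alpha>)"
      by (intro SUP_cong refl F)
    also have "\<dots> = (SUP k. SUP \<alpha>. grid_approx I k F c \<alpha>)"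
      by (rule SUP_commute)
    also have "\<dots> = (SUP k. if grid_cell I k c \<in> grid_cells I k then SUP \<alpha>. cell_inf I k F (grid_cell I k c) \<alpha> else 0)"
      by (intro SUP_cong refl) (simp add: grid_approx_def)
    finally show ?thesis .
  qed
  moreover have "(\<lambda>c. SUP k. if grid_cell I k c \<in> grid_cells I k then SUP \<alpha>. cell_inf I k F (grid_cell I k c) \<alpha> else 0)
      \<in> borel_measurable (lborel_on I)"
    by (intro borel_measurable_SUP grid_measurable[OF I, where \<Theta> = "\<lambda>z. SUP \<alpha>. cell_inf I _ F z \<alpha>"]) auto
  ultimately show "(\<lambda>c. SUP \<alpha>. F c \<alpha>) \<in> borel_measurable (lborel_on I)"
    by simp
qed

text \<open>The finite sums are integrals of the grid approximations, once of the fiber suprema and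
  once of the fiber integrals. Monotone convergence gives the limits.\<close>

lemma grid_sums:
  assumes I: "finite I" and qc: "\<And>c. quasi_concave (F c)" and lsc: "lsc_in I F"
  defines "v \<equiv> \<lambda>k z. ennreal (box_vol I (cell_lower k z) (cell_upper k z))"
  shows "incseq (\<lambda>k. \<Sum>z\<in>grid_cells I k. v k z * (SUP \<alpha>. cell_inf I k F z \<alpha>))"
    and "(SUP k. \<Sum>z\<in>grid_cells I k. v k z * (SUP \<alpha>. cell_inf I k F z \<alpha>)) =
      (\<integral>\<^sup>+c. (SUP \<alpha>. F c \<alpha>) \<partial>lborel_on I)"
    and "incseq (\<lambda>k. \<Sum>z\<in>grid_cells I k. v k z * (nn_integral lborel (cell_inf I k F z)))"
    and "(SUP k. \<Sum>z\<in>grid_cells I k. v k z * (nn_integral lborel (cell_inf I k F z))) =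
      double_integral (lborel_on I) F"
proof -
  let ?P = "lborel_on I"
  define g where "g k c \<alpha> = grid_approx I k F c \<alpha>" for k c \<alpha>
  have F: "F c \<alpha> = (SUP k. g k c \<alpha>)" for c \<alpha>
    unfolding g_def by (rule SUP_grid_approx[OF I lsc, symmetric])
  have inc: "incseq g"
    unfolding g_def incseq_def le_fun_def using incseq_grid_approx[of I F] by (auto simp: incseq_def)
  have gle: "g k c \<alpha> \<le> g k' c \<alpha>" if "k \<le> k'" for k k' c \<alpha>
    using inc that by (auto simp: incseq_def le_fun_def)
  have [measurable]: "case_prod (g k) \<in> borel_measurable (?P \<Otimes>\<^sub>M lborel)" for k
    unfolding g_def using grid_approx_measurable[OF I qc] by simp
  have S: "(\<Sum>z\<in>grid_cells I k. v k z * (SUP \<alpha>. cell_inf I k F z \<alpha>)) = (\<integral>\<^sup>+c. (SUP \<alpha>. g k c \<alpha>) \<partial>?P)" for k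
    unfolding v_def nn_integral_grid[OF I, symmetric]
    by (intro nn_integral_cong) (simp add: g_def grid_approx_def)
  have T: "(\<Sum>z\<in>grid_cells I k. v k z * (nn_integral lborel (cell_inf I k F z))) = double_integral ?P (g k)" for k
    unfolding v_def nn_integral_grid[OF I, symmetric]
    by (intro nn_integral_cong) (simp add: g_def grid_approx_def)
  show "incseq (\<lambda>k. \<Sum>z\<in>grid_cells I k. v k z * (SUP \<alpha>. cell_inf I k F z \<alpha>))"
    unfolding S by (intro incseq_def[THEN iffD2] allI impI nn_integral_mono SUP_mono' gle)
  show "incseq (\<lambda>k. \<Sum>z\<in>grid_cells I k. v k z * (nn_integral lborel (cell_inf I k F z)))"
    unfolding T by (intro incseq_def[THEN iffD2] allI impI nn_integral_mono gle)
  have "(\<integral>\<^sup>+c. (SUP \<alpha>. F c \<alpha>) \<partial>?P) = (\<integral>\<^sup>+c. (SUP k. SUP \<alpha>. g k c \<alpha>) \<partial>?P)"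
  proof (rule nn_integral_cong)
    fix c
    have "(SUP \<alpha>. F c \<alpha>) = (SUP \<alpha>. SUP k. g k c \<alpha>)" by (intro SUP_cong refl F)
    also have "\<dots> = (SUP k. SUP \<alpha>. g k c \<alpha>)" by (rule SUP_commute)
    finally show "(SUP \<alpha>. F c \<alpha>) = (SUP k. SUP \<alpha>. g k c \<alpha>)" .
  qed
  also have "\<dots> = (SUP k. \<integral>\<^sup>+c. (SUP \<alpha>. g k c \<alpha>) \<partial>?P)"
  proof (rule nn_integral_monotone_convergence_SUP)
    show "incseq (\<lambda>k c. SUP \<alpha>. g k c \<alpha>)"
      unfolding incseq_def le_fun_def by (intro allI impI SUP_mono' gle)
    show "(\<lambda>c. SUP \<alpha>. g k c \<alpha>) \<in> borel_measurable ?P" for k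
    proof -
      have "(\<lambda>c. SUP \<alpha>. g k c \<alpha>) = (\<lambda>c. if grid_cell I k c \<in> grid_cells I k then
        (\<lambda>z. SUP \<alpha>. cell_inf I k F z \<alpha>) (grid_cell I k c) else 0)"
        by (auto simp: g_def grid_approx_def)
      then show ?thesis
        using grid_measurable[OF I, of k "\<lambda>z. SUP \<alpha>. cell_inf I k F z \<alpha>"] by simp
    qed
  qed
  finally show "(SUP k. \<Sum>z\<in>grid_cells I k. v k z * (SUP \<alpha>. cell_inf I k F z \<alpha>)) =
      (\<integral>\<^sup>+c. (SUP \<alpha>. F c \<alpha>) \<partial>?P)"
    unfolding S by simp
  have "double_integral ?P F = (\<integral>\<^sup>+c. \<integral>\<^sup>+\<alpha>. (SUP k. g k c \<alpha>) \<partial>lborel \<partial>?P)"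
    by (intro nn_integral_cong F)
  also have "\<dots> = (\<integral>\<^sup>+c. (SUP k. \<integral>\<^sup>+\<alpha>. g k c \<alpha> \<partial>lborel) \<partial>?P)"
  proof (intro nn_integral_cong nn_integral_monotone_convergence_SUP)
    fix c assume [measurable]: "c \<in> space ?P"
    show "incseq (\<lambda>k \<alpha>. g k c \<alpha>)" using gle by (auto simp: incseq_def le_fun_def)
    show "g k c \<in> borel_measurable lborel" for k by measurable
  qed
  also have "\<dots> = (SUP k. \<integral>\<^sup>+c. \<integral>\<^sup>+\<alpha>. g k c \<alpha> \<partial>lborel \<partial>?P)"
  proof (rule nn_integral_monotone_convergence_SUP)
    show "incseq (\<lambda>k c. \<integral>\<^sup>+\<alpha>. g k c \<alpha> \<partial>lborel)"
      unfolding incseq_def le_fun_def by (intro allI impI nn_integral_mono gle)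
  qed measurable
  finally show "(SUP k. \<Sum>z\<in>grid_cells I k. v k z * (nn_integral lborel (cell_inf I k F z))) =
      double_integral ?P F"
    unfolding T by simp
qed

section \<open>Passage to the limit and truncation\<close>

lemma ennreal_le_of_scaled_le:
  fixes x y :: ennreal
  assumes "\<And>e. 0 < e \<Longrightarrow> e < 1 \<Longrightarrow> ennreal e * x \<le> y"
  shows "x \<le> y"
proof (cases y)
  case (real r)
  show ?thesis
  proof (cases x)
    case (real q)
    have "q \<le> r"
    proof (rule field_le_mult_one_interval)
      fix e :: real assume "0 < e" "e < 1"
      then show "e * q \<le> r"
        using assms[of e] real \<open>0 \<le> r\<close> \<open>y = ennreal r\<close>
        by (simp add: ennreal_mult'[symmetric] ennreal_le_iff)
    qed
    then show ?thesis using real \<open>y = ennreal r\<close> by (simp add: ennreal_leI)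
  next
    case top
    then show ?thesis using assms[of "1/2"] by (simp add: ennreal_mult_top)
  qed
qed simp

lemma sup_convolution_le:
  assumes "\<And>x y. (1 - t) *\<^sub>R x + t *\<^sub>R y = z \<Longrightarrow> p_mean p (f x) (g y) t \<le> c"
  shows "sup_convolution p t f g z \<le> c"
  unfolding sup_convolution_def using assms by (intro SUP_least) auto

text \<open>The step inequality requires equal masses, which the approximations of \<open>F\<close>
  and \<open>G\<close> have only in the limit. A scaling repairs this, and since \<open>A\<close> is
  finite and positive its factors tend to 1.\<close>

lemma coordinate_inequality_finite:
  assumes I: "finite I" and t: "0 < t" "t < 1" and p: "ereal (- 1 / real (card I + 1)) \<le> p"
    and qc: "\<And>c. quasi_concave (F c)" "\<And>c. quasi_concave (G c)" and lsc: "lsc_in I F" "lsc_in I G"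
    and mass: "(\<integral>\<^sup>+c. (SUP \<alpha>. F c \<alpha>) \<partial>lborel_on I) = ennreal A"
      "(\<integral>\<^sup>+c. (SUP \<alpha>. G c \<alpha>) \<partial>lborel_on I) = ennreal A" and A: "0 < A"
    and N: "\<And>w. case_prod w \<in> borel_measurable (lborel_on I \<Otimes>\<^sub>M lborel) \<Longrightarrow>
      (\<And>z \<alpha>. w z \<alpha> \<le> W z \<alpha>) \<Longrightarrow> double_integral (lborel_on I) w \<le> N"
    and W: "\<And>c c' \<alpha> \<beta>. p_mean p (F c \<alpha>) (G c' \<beta>) t \<le> W (\<lambda>i\<in>I. (1 - t) * c i + t * c' i) ((1 - t) * \<alpha> + t * \<beta>)"
  shows "ennreal (1 - t) * double_integral (lborel_on I) F +
    ennreal t * double_integral (lborel_on I) G \<le> N"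
proof -
  define v where "v k z = box_vol I (cell_lower k z) (cell_upper k z)" for k and z :: "'a \<Rightarrow> int"
  have v: "0 < v k z" for k z
    unfolding v_def by (intro box_vol_pos cell_lower_less_upper)
  define a where "a H k z = enn2real (SUP \<alpha>. cell_inf I k H z \<alpha>)" for H k z
  have a: "(SUP \<alpha>. cell_inf I k H z \<alpha>) = ennreal (a H k z)" "0 \<le> a H k z" for H k z
  proof -
    have "(SUP \<alpha>. cell_inf I k H z \<alpha>) \<le> of_nat k"
      by (intro SUP_least) (simp add: cell_inf_def)
    also have "\<dots> < \<infinity>" by (simp add: of_nat_less_top)
    finally show "(SUP \<alpha>. cell_inf I k H z \<alpha>) = ennreal (a H k z)"
      by (simp add: a_def)
    show "0 \<le> a H k z" by (simp add: a_def)
  qed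
  define M where "M H k = (\<Sum>z\<in>grid_cells I k. a H k z * v k z)" for H k
  define X where "X H k = (\<Sum>z\<in>grid_cells I k. ennreal (v k z) * (nn_integral lborel (cell_inf I k H z)))" for H k
  have M: "(\<Sum>z\<in>grid_cells I k. ennreal (v k z) * (SUP \<alpha>. cell_inf I k H z \<alpha>)) = ennreal (M H k)" "0 \<le> M H k" for H k
    unfolding M_def a(1) using a(2) v
    by (auto simp: ennreal_mult[symmetric] less_imp_le sum_ennreal mult.commute intro!: sum_nonneg)
  note sF = grid_sums[OF I qc(1) lsc(1), folded v_def, folded X_def, unfolded M mass]
  note sG = grid_sums[OF I qc(2) lsc(2), folded v_def, folded X_def, unfolded M mass]
  have MA: "M H k \<le> A" if "(SUP k. ennreal (M H k)) = ennreal A" for H k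
    using SUP_upper[of k UNIV "\<lambda>k. ennreal (M H k)"] that A by (simp add: ennreal_le_iff)
  have step: "ennreal (min (M F k) (M G k) / M F k) * (ennreal (1 - t) * X F k)
      + ennreal (min (M F k) (M G k) / M G k) * (ennreal t * X G k) \<le> N"
    if pos: "0 < M F k" "0 < M G k" for k
  proof -
    \<comment> \<open>Both approximations are scaled down to the smaller mass, so they remain below
      \<open>F\<close> and \<open>G\<close>.\<close>
    define m where "m = min (M F k) (M G k)"
    have m: "0 < m" "m / M F k \<le> 1" "m / M G k \<le> 1" using pos by (auto simp: m_def)
    have 1: "ennreal r * cell_inf I k H z \<alpha> \<le> H c \<alpha>"
      if "r \<le> 1" "z \<in> grid_cells I k" "c \<in> cell_box I k z" for r z c \<alpha> H
    proof -
      have "grid_cell I k c = z"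
        using grid_cell_eq_iff_box[OF _ that(2), of c] that(3) by (auto simp: half_open_box_def PiE_iff)
      then have "cell_inf I k H z \<alpha> = grid_approx I k H c \<alpha>"
        using that(2) by (simp add: grid_approx_def)
      also have "\<dots> \<le> H c \<alpha>" by (rule grid_approx_le)
      finally show ?thesis
        using mult_mono[of "ennreal r" 1 "cell_inf I k H z \<alpha>" "H c \<alpha>"] that(1) by simp
    qed
    have "ennreal (1 - t) * (\<Sum>z\<in>grid_cells I k. ennreal (v k z) * (\<integral>\<^sup>+\<alpha>. ennreal (m / M F k) * cell_inf I k F z \<alpha> \<partial>lborel))
      + ennreal t * (\<Sum>z\<in>grid_cells I k. ennreal (v k z) * (\<integral>\<^sup>+\<alpha>. ennreal (m / M G k) * cell_inf I k G z \<alpha> \<partial>lborel)) \<le> N"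
      unfolding v_def
    proof (rule step_integral[where W = W and a = "\<lambda>z. m / M F k * a F k z" and b = "\<lambda>z. m / M G k * a G k z",
          OF I t p finite_grid_cells[OF I] cell_lower_less_upper grid_cells_disjoint])
      show "quasi_concave (\<lambda>\<alpha>. ennreal (m / M F k) * cell_inf I k F i \<alpha>)"
           "quasi_concave (\<lambda>\<alpha>. ennreal (m / M G k) * cell_inf I k G i \<alpha>)" for i
        using m pos by (auto intro!: quasi_concave_scale quasi_concave_cell_inf qc)
      show "(SUP \<alpha>. ennreal (m / M F k) * cell_inf I k F i \<alpha>) = ennreal (m / M F k * a F k i)"
        "(SUP \<alpha>. ennreal (m / M G k) * cell_inf I k G i \<alpha>) = ennreal (m / M G k * a G k i)" for i
        unfolding SUP_mult_left_ennreal[symmetric] a(1) using m pos a(2)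
        by (simp_all add: ennreal_mult'[symmetric] less_imp_le)
      show "0 \<le> m / M F k * a F k i" "0 \<le> m / M G k * a G k i" for i
        using m pos a(2) by (auto intro!: mult_nonneg_nonneg)
      have "(\<Sum>i\<in>grid_cells I k. m / M F k * a F k i * v k i) = m / M F k * M F k"
        by (simp add: M_def sum_distrib_left mult.assoc)
      also have "\<dots> = m" using pos by simp
      finally have mF: "(\<Sum>i\<in>grid_cells I k. m / M F k * a F k i * v k i) = m" .
      have "(\<Sum>i\<in>grid_cells I k. m / M G k * a G k i * v k i) = m / M G k * M G k"
        by (simp add: M_def sum_distrib_left mult.assoc)
      also have "\<dots> = m" using pos by simp
      finally have mG: "(\<Sum>i\<in>grid_cells I k. m / M G k * a G k i * v k i) = m" .
      show "(\<Sum>i\<in>grid_cells I k. m / M F k * a F k i * box_vol I (cell_lower k i) (cell_upper k i)) =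
         (\<Sum>i\<in>grid_cells I k. m / M G k * a G k i * box_vol I (cell_lower k i) (cell_upper k i))"
        "0 < (\<Sum>i\<in>grid_cells I k. m / M F k * a F k i * box_vol I (cell_lower k i) (cell_upper k i))"
        using mF mG m unfolding v_def by auto
      fix i j x y \<alpha>
      assume *: "i \<in> grid_cells I k" "j \<in> grid_cells I k" "x \<in> cell_box I k i"
         "y \<in> cell_box I k j"
      show "sup_convolution p t (\<lambda>\<alpha>. ennreal (m / M F k) * cell_inf I k F i \<alpha>)
         (\<lambda>\<alpha>. ennreal (m / M G k) * cell_inf I k G j \<alpha>) \<alpha> \<le> W (\<lambda>k\<in>I. (1 - t) * x k + t * y k) \<alpha>"
      proof (rule sup_convolution_le)
        fix r q :: real assume rq: "(1 - t) *\<^sub>R r + t *\<^sub>R q = \<alpha>"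
        have "p_mean p (ennreal (m / M F k) * cell_inf I k F i r) (ennreal (m / M G k) * cell_inf I k G j q) t
          \<le> p_mean p (F x r) (G y q) t"
          using * m t by (intro p_mean_mono 1) auto
        also have "\<dots> \<le> W (\<lambda>k\<in>I. (1 - t) * x k + t * y k) \<alpha>"
          using W[of x r y q] rq by simp
        finally show "p_mean p (ennreal (m / M F k) * cell_inf I k F i r) (ennreal (m / M G k) * cell_inf I k G j q) t
          \<le> W (\<lambda>k\<in>I. (1 - t) * x k + t * y k) \<alpha>" .
      qed
    qed (use N in auto)
    note main = this
    have scale: "(\<Sum>z\<in>grid_cells I k. ennreal (v k z) * (\<integral>\<^sup>+\<alpha>. ennreal r * cell_inf I k H z \<alpha> \<partial>lborel)) = ennreal r * X H k"
      if "\<And>c. quasi_concave (H c)" for H r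
      unfolding X_def sum_distrib_left
      by (intro sum.cong refl, subst nn_integral_cmult)
        (auto intro!: quasi_concave_borel quasi_concave_cell_inf that simp: mult_ac)
    show ?thesis
      using main[unfolded scale[OF qc(1)] scale[OF qc(2)]] unfolding m_def by (simp add: mult_ac)
  qed
  have mono: "M H k \<le> M H k'" if "incseq (\<lambda>k. ennreal (M H k))" "k \<le> k'" for H k k'
    using that M(2)[of H] by (auto simp: incseq_def ennreal_le_iff)
  show ?thesis
  proof (rule ennreal_le_of_scaled_le)
    fix e :: real assume e: "0 < e" "e < 1"
    \<comment> \<open>From some index on both masses lie between \<open>e * A\<close> and
      \<open>A\<close>. The scaling factors, quotients of the smaller mass by either of them, are
      then at least \<open>e\<close>.\<close>
    have eA: "ennreal (e * A) < ennreal A" using e A by (auto intro!: ennreal_lessI)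
    have ev: "\<exists>k. \<forall>k'\<ge>k. e * A \<le> M H k'"
      if inc: "incseq (\<lambda>k. ennreal (M H k))" and sup: "(SUP k. ennreal (M H k)) = ennreal A" for H
    proof -
      obtain k where "ennreal (e * A) < ennreal (M H k)"
        using eA unfolding sup[symmetric] less_SUP_iff by auto
      then have "e * A \<le> M H k" using e A by (simp add: ennreal_less_iff)
      then show ?thesis using mono[OF inc] by (meson order_trans)
    qed
    obtain k1 where k1: "\<And>k. k1 \<le> k \<Longrightarrow> e * A \<le> M F k" using ev[OF sF(1,2)] by blast
    obtain k2 where k2: "\<And>k. k2 \<le> k \<Longrightarrow> e * A \<le> M G k" using ev[OF sG(1,2)] by blast
    have eN: "ennreal e * (ennreal (1 - t) * X F k + ennreal t * X G k) \<le> N" if k: "k1 \<le> k" "k2 \<le> k" for k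
    proof -
      have eA0: "0 < e * A" using e A by simp
      have pos: "0 < M F k" "0 < M G k" using k1[OF k(1)] k2[OF k(2)] eA0 by linarith+
      have ge: "e \<le> min (M F k) (M G k) / M H k" if "0 < M H k" "M H k \<le> A" for H
      proof -
        have "e * M H k \<le> e * A" using that e by simp
        also have "\<dots> \<le> min (M F k) (M G k)" using k1[OF k(1)] k2[OF k(2)] by simp
        finally show ?thesis using that by (simp add: field_simps)
      qed
      have "ennreal e * (ennreal (1 - t) * X F k + ennreal t * X G k)
        = ennreal e * (ennreal (1 - t) * X F k) + ennreal e * (ennreal t * X G k)"
        by (rule distrib_left)
      also have "\<dots> \<le> ennreal (min (M F k) (M G k) / M F k) * (ennreal (1 - t) * X F k)
        + ennreal (min (M F k) (M G k) / M G k) * (ennreal t * X G k)"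
        using ge[OF pos(1) MA[OF sF(2)]] ge[OF pos(2) MA[OF sG(2)]]
        by (intro add_mono mult_right_mono ennreal_leI) auto
      also have "\<dots> \<le> N" by (rule step[OF pos])
      finally show ?thesis .
    qed
    have "(SUP k. ennreal e * (ennreal (1 - t) * X F k)) + (SUP k. ennreal e * (ennreal t * X G k)) \<le> N"
    proof (rule SUP_add_SUP_le_ennreal)
      fix i j
      define k where "k = Max {i, j, k1, k2}"
      have k: "i \<le> k" "j \<le> k" "k1 \<le> k" "k2 \<le> k" by (auto simp: k_def)
      have "X F i \<le> X F k" "X G j \<le> X G k"
        using sF(3) sG(3) k by (auto simp: incseq_def)
      then have "ennreal e * (ennreal (1 - t) * X F i) + ennreal e * (ennreal t * X G j)
          \<le> ennreal e * (ennreal (1 - t) * X F k + ennreal t * X G k)"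
        unfolding distrib_left by (intro add_mono mult_left_mono) auto
      also have "\<dots> \<le> N" using eN k by blast
      finally show "ennreal e * (ennreal (1 - t) * X F i) + ennreal e * (ennreal t * X G j) \<le> N" .
    qed auto
    then show "ennreal e * (ennreal (1 - t) * double_integral (lborel_on I) F +
      ennreal t * double_integral (lborel_on I) G) \<le> N"
      by (simp add: SUP_mult_left_ennreal[symmetric] sF(4) sG(4) distrib_left)
  qed
qed

text \<open>The bound is a tent in \<open>c\<close> that is constant in \<open>\<alpha>\<close>: it
  preserves quasi-concavity of the fibers and lower semicontinuity, makes the mass finite, and lets
  the mass vary continuously with \<open>\<tau>\<close>.\<close>

definition truncate :: "'i set \<Rightarrow> real \<Rightarrow> (('i \<Rightarrow> real) \<Rightarrow> real \<Rightarrow> ennreal) \<Rightarrow> ('i \<Rightarrow> real) \<Rightarrow> real \<Rightarrow> ennreal" where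
  "truncate I \<tau> F c \<alpha> = min (ennreal (\<tau> - (\<Sum>i\<in>I. \<bar>c i\<bar>))) (F c \<alpha>)"

lemma quasi_concave_truncate: "quasi_concave (F c) \<Longrightarrow> quasi_concave (truncate I \<tau> F c)"
  unfolding truncate_def[abs_def] by (rule quasi_concave_min_const)

lemma lsc_in_truncate:
  assumes I: "finite I" and F: "lsc_in I F"
  shows "lsc_in I (truncate I \<tau> F)"
  unfolding lsc_in_def
proof (intro allI impI)
  fix c \<alpha> s assume s: "s < truncate I \<tau> F c \<alpha>"
  then have "s < F c \<alpha>" and s2: "s < ennreal (\<tau> - (\<Sum>i\<in>I. \<bar>c i\<bar>))"
    by (auto simp: truncate_def)
  then obtain r where r: "0 < r" "\<And>c'. (\<forall>i\<in>I. \<bar>c' i - c i\<bar> < r) \<Longrightarrow> s < F c' \<alpha>"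
    using F unfolding lsc_in_def by blast
  obtain q where q: "s = ennreal q" "0 \<le> q"
    using s2 by (cases s) auto
  have q2: "q < \<tau> - (\<Sum>i\<in>I. \<bar>c i\<bar>)"
    using s2 q by (simp add: ennreal_less_iff)
  \<comment> \<open>The slack is shared among the coordinates and one further part, which keeps the
    final inequality strict.\<close>
  define d where "d = (\<tau> - (\<Sum>i\<in>I. \<bar>c i\<bar>) - q) / (real (card I) + 1)"
  have d: "0 < d" "d * (real (card I) + 1) = \<tau> - (\<Sum>i\<in>I. \<bar>c i\<bar>) - q" using q2 by (auto simp: d_def)
  show "\<exists>r>0. \<forall>c'. (\<forall>i\<in>I. \<bar>c' i - c i\<bar> < r) \<longrightarrow> s < truncate I \<tau> F c' \<alpha>"
  proof (intro exI[of _ "min r d"] conjI allI impI)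
    show "0 < min r d" using r d by simp
    fix c' assume c': "\<forall>i\<in>I. \<bar>c' i - c i\<bar> < min r d"
    have "(\<Sum>i\<in>I. \<bar>c' i\<bar>) \<le> (\<Sum>i\<in>I. \<bar>c i\<bar> + d)"
      using c' by (intro sum_mono) force
    also have "\<dots> = (\<Sum>i\<in>I. \<bar>c i\<bar>) + d * card I"
      by (simp add: sum.distrib mult.commute)
    finally have "q < \<tau> - (\<Sum>i\<in>I. \<bar>c' i\<bar>)"
      using d by (simp add: algebra_simps)
    then have "s < ennreal (\<tau> - (\<Sum>i\<in>I. \<bar>c' i\<bar>))"
      using q by (simp add: ennreal_less_iff)
    then show "s < truncate I \<tau> F c' \<alpha>"
      using r(2)[of c'] c' by (auto simp: truncate_def)
  qed
qed

lemma SUP_truncate: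
  fixes F :: "('i \<Rightarrow> real) \<Rightarrow> real \<Rightarrow> ennreal"
  shows "(SUP \<alpha>. truncate I \<tau> F c \<alpha>) = min (ennreal (\<tau> - (\<Sum>i\<in>I. \<bar>c i\<bar>))) (SUP \<alpha>. F c \<alpha>)"
  unfolding truncate_def inf_min[symmetric] by (simp add: inf_SUP)

lemma SUP_min_of_nat:
  fixes x :: ennreal
  shows "(SUP n. min (ennreal (real n - b)) x) = x"
proof (rule antisym)
  show "x \<le> (SUP n. min (ennreal (real n - b)) x)"
  proof (rule dense_le)
    fix s assume s: "s < x"
    then have "s < top" by (auto simp: less_top[symmetric])
    then obtain q where q: "s = ennreal q" "0 \<le> q" by (cases s) auto
    obtain n where "q + b < real n" using reals_Archimedean2 by blast
    then have "s \<le> min (ennreal (real n - b)) x"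
      using q s by (auto intro!: ennreal_leI)
    then show "s \<le> (SUP n. min (ennreal (real n - b)) x)" by (rule SUP_upper2[rotated]) simp
  qed
qed (auto intro: SUP_least)

text \<open>Raising the level from \<open>\<tau>\<close> to \<open>\<tau>'\<close> adds at most
  \<open>\<tau>' - \<tau>\<close> at each point, and only inside the cube \<open>?B \<tau>'\<close>.
  So the mass is Lipschitz on bounded sets of levels. It starts at 0 and, if \<open>Q\<close> has
  infinite integral, exceeds every bound, so it attains every positive value.\<close>

lemma truncated_mass:
  fixes Q :: "('i \<Rightarrow> real) \<Rightarrow> ennreal"
  assumes I: "finite I" and Q [measurable]: "Q \<in> borel_measurable (lborel_on I)"
  defines "m \<equiv> \<lambda>\<tau>. \<integral>\<^sup>+c. min (ennreal (\<tau> - (\<Sum>i\<in>I. \<bar>c i\<bar>))) (Q c) \<partial>lborel_on I"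
  shows "m \<tau> < \<infinity>" and "\<tau> \<le> \<tau>' \<Longrightarrow> m \<tau> \<le> m \<tau>'"
    and "(nn_integral (lborel_on I) Q) = \<infinity> \<Longrightarrow> 0 < j \<Longrightarrow> \<exists>\<tau>. m \<tau> = ennreal j"
proof -
  let ?P = "lborel_on I"
  let ?s = "\<lambda>c. \<Sum>i\<in>I. \<bar>c i\<bar>"
  let ?B = "\<lambda>\<tau>. half_open_box I (\<lambda>_. - \<tau>) (\<lambda>_. \<tau>)"
  have [measurable]: "(\<lambda>c. c i) \<in> borel_measurable ?P" if "i \<in> I" for i
    using measurable_component_singleton[OF that, of "\<lambda>_. lborel :: real measure"] by simp
  have [measurable]: "?s \<in> borel_measurable ?P" by measurable
  have [measurable]: "?B \<tau> \<in> sets ?P" for \<tau> by (rule half_open_box_sets[OF I])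
  have B: "c \<in> ?B \<tau>" if "c \<in> space ?P" "?s c < \<tau>" for c \<tau>
  proof -
    have "\<bar>c i\<bar> < \<tau>" if "i \<in> I" for i
      using member_le_sum[of i I "\<lambda>i. \<bar>c i\<bar>"] that I \<open>?s c < \<tau>\<close> by simp
    then have "- \<tau> \<le> c i \<and> c i < \<tau>" if "i \<in> I" for i
      using that by (force simp: abs_less_iff)
    then show ?thesis using that(1) by (auto simp: half_open_box_def space_PiM PiE_iff)
  qed
  have vol: "emeasure ?P (?B \<tau>) = ennreal ((2 * \<tau>) ^ card I)" if "0 \<le> \<tau>" for \<tau>
    using that by (subst emeasure_half_open_box[OF I]) (auto simp: box_vol_def)
  show mono: "m \<tau> \<le> m \<tau>'" if "\<tau> \<le> \<tau>'" for \<tau> \<tau>'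
    unfolding m_def using that by (intro nn_integral_mono min.mono ennreal_leI) auto
  have lip: "m \<tau>' \<le> m \<tau> + ennreal ((\<tau>' - \<tau>) * (2 * \<tau>') ^ card I)" if "\<tau> \<le> \<tau>'" "0 \<le> \<tau>'" for \<tau> \<tau>'
  proof -
    have "m \<tau>' \<le> (\<integral>\<^sup>+c. min (ennreal (\<tau> - ?s c)) (Q c) + ennreal (\<tau>' - \<tau>) * indicator (?B \<tau>') c \<partial>?P)"
      unfolding m_def
    proof (rule nn_integral_mono)
      fix c assume c: "c \<in> space ?P"
      show "min (ennreal (\<tau>' - ?s c)) (Q c) \<le> min (ennreal (\<tau> - ?s c)) (Q c) + ennreal (\<tau>' - \<tau>) * indicator (?B \<tau>') c"
      proof (cases "?s c < \<tau>'")
        case True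
        have "ennreal (\<tau>' - ?s c) \<le> ennreal (\<tau> - ?s c) + ennreal (\<tau>' - \<tau>)"
          using that by (cases "?s c \<le> \<tau>") (auto simp: ennreal_plus[symmetric] ennreal_neg intro!: ennreal_leI simp del: ennreal_plus)
        then have "min (ennreal (\<tau>' - ?s c)) (Q c) \<le> min (ennreal (\<tau> - ?s c)) (Q c) + ennreal (\<tau>' - \<tau>)"
          by (cases "ennreal (\<tau> - ?s c) \<le> Q c") (auto simp: min_def intro: order_trans)
        then show ?thesis using B[OF c True] by simp
      next
        case False
        then show ?thesis by (simp add: ennreal_neg)
      qed
    qed
    also have "\<dots> = m \<tau> + ennreal (\<tau>' - \<tau>) * ennreal ((2 * \<tau>') ^ card I)"
      unfolding m_def using vol[OF that(2)]
      by (subst nn_integral_add) (auto simp: nn_integral_cmult_indicator)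
    also have "\<dots> = m \<tau> + ennreal ((\<tau>' - \<tau>) * (2 * \<tau>') ^ card I)"
      using that by (simp add: ennreal_mult')
    finally show ?thesis .
  qed
  have m0: "m 0 = 0"
  proof -
    have "m 0 = (\<integral>\<^sup>+c. 0 \<partial>?P)"
      unfolding m_def by (intro nn_integral_cong) (auto simp: ennreal_neg sum_nonneg)
    then show ?thesis by simp
  qed
  show fin: "m \<tau> < \<infinity>" for \<tau>
  proof -
    have "m \<tau> \<le> m (max 0 \<tau>)" by (rule mono) simp
    also have "\<dots> \<le> ennreal (max 0 \<tau> * (2 * max 0 \<tau>) ^ card I)"
      using lip[of 0 "max 0 \<tau>"] m0 by simp
    finally show ?thesis by (simp add: le_less_trans)
  qed
  show "\<exists>\<tau>. m \<tau> = ennreal j" if inf: "(nn_integral ?P Q) = \<infinity>" and j: "0 < j"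
  proof -
    have "(nn_integral ?P Q) = (\<integral>\<^sup>+c. (SUP n. min (ennreal (real n - ?s c)) (Q c)) \<partial>?P)"
      by (simp add: SUP_min_of_nat)
    also have "\<dots> = (SUP n. m (real n))"
      unfolding m_def
    proof (rule nn_integral_monotone_convergence_SUP)
      show "incseq (\<lambda>n c. min (ennreal (real n - ?s c)) (Q c))"
        unfolding incseq_def le_fun_def by (intro allI impI min.mono ennreal_leI) auto
    qed measurable
    finally have "ennreal j < (SUP n. m (real n))" using inf by simp
    then obtain n where n: "ennreal j < m (real n)" by (auto simp: less_SUP_iff)
    define g where "g \<tau> = enn2real (m \<tau>)" for \<tau>
    have g: "m \<tau> = ennreal (g \<tau>)" for \<tau> using fin[of \<tau>] by (simp add: g_def)
    have g0: "0 \<le> g \<tau>" for \<tau> by (simp add: g_def)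
    define L where "L = (2 * real n) ^ card I"
    have gd: "\<bar>g \<tau>' - g \<tau>\<bar> \<le> L * \<bar>\<tau>' - \<tau>\<bar>" if "0 \<le> \<tau>" "\<tau> \<le> \<tau>'" "\<tau>' \<le> real n" for \<tau> \<tau>'
    proof -
      have "g \<tau> \<le> g \<tau>'" using mono[OF that(2)] g0 by (simp add: g ennreal_le_iff)
      moreover have "ennreal (g \<tau>') \<le> ennreal (g \<tau> + (\<tau>' - \<tau>) * (2 * \<tau>') ^ card I)"
        using lip[of \<tau> \<tau>'] that g0[of \<tau>] by (simp add: g ennreal_plus[symmetric] del: ennreal_plus)
      then have "g \<tau>' \<le> g \<tau> + (\<tau>' - \<tau>) * (2 * \<tau>') ^ card I"
        using that g0[of \<tau>] by (subst (asm) ennreal_le_iff) auto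
      moreover have "(\<tau>' - \<tau>) * (2 * \<tau>') ^ card I \<le> (\<tau>' - \<tau>) * L"
        unfolding L_def using that by (intro mult_left_mono power_mono) auto
      ultimately show ?thesis using that by (simp add: mult.commute)
    qed
    have "L-lipschitz_on {0..real n} g"
    proof (rule lipschitz_onI)
      fix x y assume "x \<in> {0..real n}" "y \<in> {0..real n}"
      then show "dist (g x) (g y) \<le> L * dist x y"
        using gd[of x y] gd[of y x] by (cases "x \<le> y") (auto simp: dist_real_def abs_minus_commute)
    qed (simp add: L_def)
    then have "continuous_on {0..real n} g" by (rule lipschitz_on_continuous_on)
    moreover have "g 0 \<le> j"
      using m0 j by (simp add: g_def)
    moreover have "j \<le> g (real n)"
      using n[unfolded g] j by (simp add: ennreal_less_iff)
    ultimately obtain \<tau> where "g \<tau> = j" using IVT'[of g 0 j "real n"] by auto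
    then show ?thesis using g by metis
  qed
qed

lemma nn_integral_SUP_zero:
  fixes H :: "'c \<Rightarrow> real \<Rightarrow> ennreal"
  assumes "(\<lambda>c. SUP \<alpha>. H c \<alpha>) \<in> borel_measurable M" "(\<integral>\<^sup>+c. (SUP \<alpha>. H c \<alpha>) \<partial>M) = 0"
  shows "(\<integral>\<^sup>+c. \<integral>\<^sup>+\<alpha>. H c \<alpha> \<partial>lborel \<partial>M) = 0"
proof -
  have "AE c in M. (SUP \<alpha>. H c \<alpha>) = 0"
    using assms by (subst (asm) nn_integral_0_iff_AE) auto
  then have "AE c in M. (nn_integral lborel (H c)) = 0"
    by eventually_elim (rule SUP_nn_integral_zero)
  then have "(\<integral>\<^sup>+c. \<integral>\<^sup>+\<alpha>. H c \<alpha> \<partial>lborel \<partial>M) = (\<integral>\<^sup>+c. 0 \<partial>M)"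
    by (rule nn_integral_cong_AE)
  then show ?thesis by simp
qed

text \<open>If the common mass is infinite, \<open>F\<close> and \<open>G\<close> are truncated at
  two different levels, chosen such that the truncated masses coincide.\<close>

lemma coordinate_inequality:
  assumes I: "finite I" and t: "0 < t" "t < 1" and p: "ereal (- 1 / real (card I + 1)) \<le> p"
    and qc: "\<And>c. quasi_concave (F c)" "\<And>c. quasi_concave (G c)" and lsc: "lsc_in I F" "lsc_in I G"
    and mass: "(\<integral>\<^sup>+c. (SUP \<alpha>. F c \<alpha>) \<partial>lborel_on I) = (\<integral>\<^sup>+c. (SUP \<alpha>. G c \<alpha>) \<partial>lborel_on I)"
    and N: "\<And>w. case_prod w \<in> borel_measurable (lborel_on I \<Otimes>\<^sub>M lborel) \<Longrightarrow>
      (\<And>z \<alpha>. w z \<alpha> \<le> W z \<alpha>) \<Longrightarrow> double_integral (lborel_on I) w \<le> N"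
    and W: "\<And>c c' \<alpha> \<beta>. p_mean p (F c \<alpha>) (G c' \<beta>) t \<le> W (\<lambda>i\<in>I. (1 - t) * c i + t * c' i) ((1 - t) * \<alpha> + t * \<beta>)"
  shows "ennreal (1 - t) * double_integral (lborel_on I) F +
    ennreal t * double_integral (lborel_on I) G \<le> N"
proof -
  let ?P = "lborel_on I"
  note meas = lsc_in_measurable[OF I qc(1) lsc(1)] lsc_in_measurable[OF I qc(2) lsc(2)]
  note [measurable] = meas
  define A where "A = (\<integral>\<^sup>+c. (SUP \<alpha>. F c \<alpha>) \<partial>?P)"
  have A': "(\<integral>\<^sup>+c. (SUP \<alpha>. G c \<alpha>) \<partial>?P) = A" using mass by (simp add: A_def)
  consider "A = 0" | r where "A = ennreal r" "0 < r" | "A = \<infinity>"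
    by (cases A) (force simp: le_less)+
  then show ?thesis
  proof cases
    case 1
    show ?thesis using nn_integral_SUP_zero[OF meas(2)] nn_integral_SUP_zero[OF meas(4)] 1 A' by (simp add: A_def)
  next
    case (2 r)
    show ?thesis
      by (rule coordinate_inequality_finite[OF I t p qc lsc _ _ 2(2) N W]) (use 2 A' A_def in auto)
  next
    case 3
    define m where "m H \<tau> = (\<integral>\<^sup>+c. (SUP \<alpha>. truncate I \<tau> H c \<alpha>) \<partial>?P)" for H \<tau>
    have mF: "m F \<tau> < \<infinity>" "\<tau> \<le> \<tau>' \<Longrightarrow> m F \<tau> \<le> m F \<tau>'" "0 < j \<Longrightarrow> \<exists>\<tau>. m F \<tau> = ennreal j" for \<tau> \<tau>' j
      unfolding m_def SUP_truncate using truncated_mass[OF I meas(2)] 3 by (auto simp: A_def)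
    have mG: "m G \<tau> < \<infinity>" "\<tau> \<le> \<tau>' \<Longrightarrow> m G \<tau> \<le> m G \<tau>'" "0 < j \<Longrightarrow> \<exists>\<tau>. m G \<tau> = ennreal j" for \<tau> \<tau>' j
      unfolding m_def SUP_truncate using truncated_mass[OF I meas(4)] 3 A' by (auto simp: A_def)
    define X where "X H \<tau> = double_integral ?P (truncate I \<tau> H)" for H \<tau>
    have X_mono: "X H \<tau> \<le> X H \<tau>'" if "\<tau> \<le> \<tau>'" for H \<tau> \<tau>'
      unfolding X_def truncate_def using that by (intro nn_integral_mono min.mono ennreal_leI) auto
    have X_SUP: "(SUP n. X H (real n)) = double_integral ?P H"
      if H: "\<And>c. quasi_concave (H c)" "lsc_in I H" for H
    proof -
      have [measurable]: "case_prod (truncate I \<tau> H) \<in> borel_measurable (?P \<Otimes>\<^sub>M lborel)" for \<tau>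
        by (intro lsc_in_measurable I quasi_concave_truncate lsc_in_truncate H)
      have mono: "truncate I (real n) H c \<alpha> \<le> truncate I (real n') H c \<alpha>" if "n \<le> n'" for n n' c \<alpha>
        unfolding truncate_def using that by (intro min.mono ennreal_leI) auto
      have "double_integral ?P H = (\<integral>\<^sup>+c. \<integral>\<^sup>+\<alpha>. (SUP n. truncate I (real n) H c \<alpha>) \<partial>lborel \<partial>?P)"
        unfolding truncate_def SUP_min_of_nat ..
      also have "\<dots> = (\<integral>\<^sup>+c. (SUP n. \<integral>\<^sup>+\<alpha>. truncate I (real n) H c \<alpha> \<partial>lborel) \<partial>?P)"
      proof (intro nn_integral_cong nn_integral_monotone_convergence_SUP)
        fix c assume [measurable]: "c \<in> space ?P"
        show "incseq (\<lambda>n. truncate I (real n) H c)" using mono by (auto simp: incseq_def le_fun_def)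
        show "truncate I (real n) H c \<in> borel_measurable lborel" for n by measurable
      qed
      also have "\<dots> = (SUP n. X H (real n))"
        unfolding X_def
      proof (rule nn_integral_monotone_convergence_SUP)
        show "incseq (\<lambda>n c. \<integral>\<^sup>+\<alpha>. truncate I (real n) H c \<alpha> \<partial>lborel)"
          unfolding incseq_def le_fun_def by (intro allI impI nn_integral_mono mono)
      qed measurable
      finally show ?thesis by simp
    qed
    have step: "ennreal (1 - t) * X F (real n) + ennreal t * X G (real n) \<le> N" for n
    proof -
      \<comment> \<open>The target mass exceeds that of both truncations at level \<open>n\<close>.
        By monotonicity the levels \<open>\<tau>\<close> and \<open>\<sigma>\<close> at which it is
        reached are at least \<open>n\<close>, so nothing below level \<open>n\<close> is
        lost.\<close>
      define j where "j = max (enn2real (m F (real n))) (enn2real (m G (real n))) + 1"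
      have j: "0 < j" unfolding j_def by (intro add_nonneg_pos) (auto simp: le_max_iff_disj)
      have jF: "m F (real n) < ennreal j" and jG: "m G (real n) < ennreal j"
      proof -
        have *: "x < ennreal j" if "x < \<infinity>" "enn2real x < j" for x
          using that by (cases x) (auto simp: ennreal_less_iff)
        show "m F (real n) < ennreal j" by (rule *[OF mF(1)]) (simp add: j_def)
        show "m G (real n) < ennreal j" by (rule *[OF mG(1)]) (simp add: j_def)
      qed
      obtain \<tau> \<sigma> where ts: "m F \<tau> = ennreal j" "m G \<sigma> = ennreal j"
        using mF(3) mG(3) j by meson
      have "real n \<le> \<tau>" using mF(2)[of \<tau> "real n"] ts jF by (metis linorder_not_le nle_le)
      moreover have "real n \<le> \<sigma>" using mG(2)[of \<sigma> "real n"] ts jG by (metis linorder_not_le nle_le)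
      ultimately have "ennreal (1 - t) * X F (real n) + ennreal t * X G (real n)
          \<le> ennreal (1 - t) * X F \<tau> + ennreal t * X G \<sigma>"
        by (intro add_mono mult_left_mono X_mono) auto
      also have "\<dots> \<le> N"
        unfolding X_def
      proof (rule coordinate_inequality_finite[where W = W, OF I t p _ _ _ _ _ _ j N])
        show "quasi_concave (truncate I \<tau> F c)" "quasi_concave (truncate I \<sigma> G c)" for c
          by (intro quasi_concave_truncate qc)+
        show "lsc_in I (truncate I \<tau> F)" "lsc_in I (truncate I \<sigma> G)"
          by (intro lsc_in_truncate I lsc)+
        show "(\<integral>\<^sup>+c. (SUP \<alpha>. truncate I \<tau> F c \<alpha>) \<partial>?P) = ennreal j" "(\<integral>\<^sup>+c. (SUP \<alpha>. truncate I \<sigma> G c \<alpha>) \<partial>?P) = ennreal j"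
          using ts by (auto simp: m_def)
        fix c c' \<alpha> \<beta>
        have "p_mean p (truncate I \<tau> F c \<alpha>) (truncate I \<sigma> G c' \<beta>) t \<le> p_mean p (F c \<alpha>) (G c' \<beta>) t"
          using t by (intro p_mean_mono) (auto simp: truncate_def)
        also note W
        finally show "p_mean p (truncate I \<tau> F c \<alpha>) (truncate I \<sigma> G c' \<beta>) t \<le>
            W (\<lambda>i\<in>I. (1 - t) * c i + t * c' i) ((1 - t) * \<alpha> + t * \<beta>)" .
      qed
      finally show ?thesis .
    qed
    have "(SUP n. ennreal (1 - t) * X F (real n)) + (SUP n. ennreal t * X G (real n)) \<le> N"
    proof (rule SUP_add_SUP_le_ennreal)
      fix i k :: nat
      have "ennreal (1 - t) * X F (real i) + ennreal t * X G (real k)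
          \<le> ennreal (1 - t) * X F (real (max i k)) + ennreal t * X G (real (max i k))"
        by (intro add_mono mult_left_mono X_mono) auto
      also have "\<dots> \<le> N" by (rule step)
      finally show "ennreal (1 - t) * X F (real i) + ennreal t * X G (real k) \<le> N" .
    qed auto
    then show ?thesis
      by (simp add: SUP_mult_left_ennreal[symmetric] X_SUP[OF qc(1) lsc(1)] X_SUP[OF qc(2) lsc(2)])
  qed
qed

section \<open>Sheared orthonormal coordinates\<close>

lemma nn_integral_lborel_translate:
  fixes f :: "'a::euclidean_space \<Rightarrow> ennreal"
  assumes [measurable]: "f \<in> borel_measurable borel"
  shows "(\<integral>\<^sup>+x. f (c + x) \<partial>lborel) = nn_integral lborel f"
proof -
  have "(nn_integral lborel f) = (\<integral>\<^sup>+x. f x \<partial>distr lborel borel ((+) c))"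
    by (simp add: lborel_distr_plus)
  also have "\<dots> = (\<integral>\<^sup>+x. f (c + x) \<partial>lborel)"
    by (subst nn_integral_distr) auto
  finally show ?thesis by simp
qed

text \<open>
  Uniqueness of the translation invariant measure: integrate \<open>1\<^sub>A(T x) 1\<^sub>B(y - T x)\<close> over
  \<open>x\<close> and \<open>y\<close> in both orders, where \<open>B\<close> is the unit ball.
\<close>

lemma lborel_distr_orthogonal:
  fixes T :: "'a::euclidean_space \<Rightarrow> 'a"
  assumes T: "orthogonal_transformation T"
  shows "distr lborel borel T = lborel"
proof (rule measure_eqI)
  fix A assume "A \<in> sets (distr lborel borel T)"
  then have [measurable]: "A \<in> sets borel" by simp
  have lin: "linear T" and inj: "surj T"
    using T by (auto simp: orthogonal_transformation_linear orthogonal_transformation_surj)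
  have [measurable]: "T \<in> borel_measurable borel"
    using lin by (intro borel_measurable_continuous_onI linear_continuous_on linear_conv_bounded_linear[THEN iffD1])
  define i where "i = (indicator A :: 'a \<Rightarrow> ennreal)"
  define j where "j = (indicator (ball 0 1) :: 'a \<Rightarrow> ennreal)"
  have [measurable]: "i \<in> borel_measurable borel" "j \<in> borel_measurable borel"
    unfolding i_def j_def by (auto intro!: borel_measurable_indicator)
  let ?b = "emeasure lborel (ball 0 1 :: 'a set)"
  have jb: "(nn_integral lborel j) = ?b"
    by (simp add: j_def)
  have jT: "j (- T x) = j x" for x
    using T by (simp add: j_def indicator_def orthogonal_transformation_norm)
  have "(\<integral>\<^sup>+x. i (T x) \<partial>lborel) * ?b = (\<integral>\<^sup>+x. \<integral>\<^sup>+y. i (T x) * j y \<partial>lborel \<partial>lborel)"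
    by (simp add: nn_integral_cmult nn_integral_multc jb)
  also have "\<dots> = (\<integral>\<^sup>+x. \<integral>\<^sup>+y. i (T x) * j (- T x + y) \<partial>lborel \<partial>lborel)"
  proof (rule nn_integral_cong)
    fix x
    show "(\<integral>\<^sup>+y. i (T x) * j y \<partial>lborel) = (\<integral>\<^sup>+y. i (T x) * j (- T x + y) \<partial>lborel)"
      by (rule nn_integral_lborel_translate[symmetric]) measurable
  qed
  also have "\<dots> = (\<integral>\<^sup>+y. \<integral>\<^sup>+x. i (T x) * j (- T x + y) \<partial>lborel \<partial>lborel)"
    by (rule lborel_pair.Fubini'[symmetric]) measurable
  also have "\<dots> = (\<integral>\<^sup>+y. \<integral>\<^sup>+x. i (T x + y) * j (- T x) \<partial>lborel \<partial>lborel)"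
  proof (rule nn_integral_cong)
    fix y
    \<comment> \<open>A shift by \<open>y\<close> after \<open>T\<close> is a shift by
      \<open>z\<close> before \<open>T\<close>, and the latter leaves the integral
      unchanged.\<close>
    obtain z where z: "y = T z" using inj by (auto simp: surj_def)
    have "(\<integral>\<^sup>+x. i (T x) * j (- T x + y) \<partial>lborel) = (\<integral>\<^sup>+x. i (T (z + x)) * j (- T (z + x) + y) \<partial>lborel)"
      by (rule nn_integral_lborel_translate[symmetric]) measurable
    also have "\<dots> = (\<integral>\<^sup>+x. i (T x + y) * j (- T x) \<partial>lborel)"
      using lin by (intro nn_integral_cong) (simp add: z linear_add add.commute)
    finally show "(\<integral>\<^sup>+x. i (T x) * j (- T x + y) \<partial>lborel) = (\<integral>\<^sup>+x. i (T x + y) * j (- T x) \<partial>lborel)" .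
  qed
  also have "\<dots> = (\<integral>\<^sup>+x. \<integral>\<^sup>+y. i (T x + y) * j (- T x) \<partial>lborel \<partial>lborel)"
    by (rule lborel_pair.Fubini') measurable
  also have "\<dots> = (\<integral>\<^sup>+x. (\<integral>\<^sup>+y. i y \<partial>lborel) * j x \<partial>lborel)"
    by (intro nn_integral_cong) (simp add: jT nn_integral_multc nn_integral_lborel_translate)
  also have "\<dots> = (nn_integral lborel i) * ?b"
    by (simp add: nn_integral_cmult jb)
  finally have "(\<integral>\<^sup>+x. i (T x) \<partial>lborel) * ?b = emeasure lborel A * ?b"
    by (simp add: i_def)
  moreover have "?b \<noteq> 0" "?b \<noteq> \<infinity>"
  proof -
    show "?b \<noteq> 0"
    proof
      assume "?b = 0"
      then have "negligible (ball 0 1 :: 'a set)"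
        by (simp add: negligible_iff_null_sets null_sets_def)
      then show False using open_not_negligible[of "ball 0 1 :: 'a set"] by simp
    qed
    show "?b \<noteq> \<infinity>" using emeasure_lborel_ball_finite[of "0::'a" 1] by auto
  qed
  ultimately have "(\<integral>\<^sup>+x. i (T x) \<partial>lborel) = emeasure lborel A"
  proof -
    assume eq: "(\<integral>\<^sup>+x. i (T x) \<partial>lborel) * ?b = emeasure lborel A * ?b" and "?b \<noteq> 0" "?b \<noteq> \<infinity>"
    then obtain r where r: "?b = ennreal r" "0 < r"
      by (cases ?b) (auto simp: ennreal_eq_0_iff not_le)
    have inv: "x * ennreal r * ennreal (1 / r) = x" for x
      using r(2) by (simp add: mult.assoc ennreal_mult[symmetric])
    show ?thesis using arg_cong[OF eq[unfolded r(1)], of "\<lambda>x. x * ennreal (1 / r)"] by (simp only: inv)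
  qed
  moreover have "emeasure (distr lborel borel T) A = (\<integral>\<^sup>+x. i (T x) \<partial>lborel)"
  proof -
    have "(\<integral>\<^sup>+x. i x \<partial>distr lborel borel T) = (\<integral>\<^sup>+x. i (T x) \<partial>lborel)"
      by (rule nn_integral_distr) measurable
    then show ?thesis by (simp add: i_def)
  qed
  ultimately show "emeasure (distr lborel borel T) A = emeasure lborel A" by simp
qed simp

lemma PiM_reindex:
  assumes fin: "finite J" and bij: "bij_betw \<sigma> J K" 
  shows "distr (lborel_on J) (lborel_on K) (\<lambda>f. \<lambda>k\<in>K. f (the_inv_into J \<sigma> k))
    = (lborel_on K)"
proof (rule lborel_product.PiM_eqI)
  let ?\<tau> = "the_inv_into J \<sigma>"
  have \<tau>: "bij_betw ?\<tau> K J" by (rule bij_betw_the_inv_into[OF bij])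
  show "finite K" using fin bij by (simp add: bij_betw_finite)
  have m: "(\<lambda>f. \<lambda>k\<in>K. f (?\<tau> k)) \<in> (lborel_on J) \<rightarrow>\<^sub>M (lborel_on K)"
    using \<tau> by (intro measurable_restrict measurable_component_singleton) (auto simp: bij_betw_def)
  fix A assume A: "\<And>k. k \<in> K \<Longrightarrow> A k \<in> sets (lborel :: real measure)"
  have "emeasure (distr (lborel_on J) (lborel_on K) (\<lambda>f. \<lambda>k\<in>K. f (?\<tau> k))) (\<Pi>\<^sub>E k\<in>K. A k)
    = emeasure (lborel_on J) ((\<lambda>f. \<lambda>k\<in>K. f (?\<tau> k)) -` (\<Pi>\<^sub>E k\<in>K. A k) \<inter> space (lborel_on J))"
    using A \<open>finite K\<close> by (intro emeasure_distr m sets_PiM_I_finite) auto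
  also have "(\<lambda>f. \<lambda>k\<in>K. f (?\<tau> k)) -` (\<Pi>\<^sub>E k\<in>K. A k) \<inter> space (lborel_on J) = (\<Pi>\<^sub>E j\<in>J. A (\<sigma> j))"
  proof -
    have "(\<forall>k\<in>K. f (?\<tau> k) \<in> A k) \<longleftrightarrow> (\<forall>j\<in>J. f j \<in> A (\<sigma> j))" for f :: "'a \<Rightarrow> real"
      using bij by (auto simp: bij_betw_def the_inv_into_f_f)
    then show ?thesis by (auto simp: space_PiM PiE_iff)
  qed
  also have "emeasure (lborel_on J) (\<Pi>\<^sub>E j\<in>J. A (\<sigma> j)) = (\<Prod>j\<in>J. emeasure lborel (A (\<sigma> j)))"
    using A bij fin by (intro lborel_product.emeasure_PiM) (auto simp: bij_betw_def)
  also have "\<dots> = (\<Prod>k\<in>K. emeasure lborel (A k))"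
    by (rule prod.reindex_bij_betw[OF bij])
  finally show "emeasure (distr (lborel_on J) (lborel_on K) (\<lambda>f. \<lambda>k\<in>K. f (?\<tau> k))) (\<Pi>\<^sub>E k\<in>K. A k)
    = (\<Prod>k\<in>K. emeasure lborel (A k))" .
qed simp

text \<open>The linear map \<open>T\<close> that carries \<open>Basis\<close> to \<open>K\<close> is
  orthogonal and preserves \<open>lborel\<close>. The rest is a renaming of coordinates along
  \<open>\<sigma>\<close>.\<close>

lemma nn_integral_orthonormal_basis:
  fixes F :: "'a::euclidean_space \<Rightarrow> ennreal"
  assumes K: "finite K" "card K = DIM('a)" "pairwise orthogonal K" "\<And>b. b \<in> K \<Longrightarrow> norm b = 1"
    and [measurable]: "F \<in> borel_measurable borel"
  shows "(nn_integral lborel F) = (\<integral>\<^sup>+c. F (\<Sum>b\<in>K. c b *\<^sub>R b) \<partial>lborel_on K)"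
proof -
  obtain \<sigma> where \<sigma>: "bij_betw \<sigma> (Basis :: 'a set) K"
    using finite_same_card_bij[OF finite_Basis K(1)] K(2) by auto
  define T where "T x = (\<Sum>e\<in>Basis. (x \<bullet> e) *\<^sub>R \<sigma> e)" for x :: 'a
  have \<sigma>\<sigma>: "\<sigma> e \<bullet> \<sigma> e' = (if e = e' then 1 else 0)" if "e \<in> Basis" "e' \<in> Basis" for e e'
  proof -
    have "\<sigma> e \<in> K" "\<sigma> e' \<in> K" "e \<noteq> e' \<Longrightarrow> \<sigma> e \<noteq> \<sigma> e'"
      using \<sigma> that by (auto simp: bij_betw_def inj_on_def)
    then show ?thesis
      using K(3,4) by (auto simp: pairwise_def orthogonal_def norm_eq_1)
  qed
  have "orthogonal_transformation T"
    unfolding orthogonal_transformation_def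
  proof (intro conjI allI)
    show "linear T"
      unfolding T_def
      by (intro linearI) (auto simp: inner_add_left scaleR_add_left sum.distrib scaleR_sum_right)
    fix v w
    have "T v \<bullet> T w = (\<Sum>e\<in>Basis. \<Sum>e'\<in>Basis. (v \<bullet> e) * ((w \<bullet> e') * (\<sigma> e \<bullet> \<sigma> e')))"
      unfolding T_def inner_sum_left unfolding inner_sum_right by (simp add: mult_ac)
    also have "\<dots> = (\<Sum>e\<in>Basis. \<Sum>e'\<in>Basis. if e = e' then (v \<bullet> e) * (w \<bullet> e') else 0)"
      by (intro sum.cong refl) (simp add: \<sigma>\<sigma>)
    also have "\<dots> = v \<bullet> w"
      by (simp add: euclidean_inner[of v w])
    finally show "T v \<bullet> T w = v \<bullet> w" .
  qed
  then have lin: "linear T" and dist: "distr lborel borel T = lborel"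
    by (auto simp: orthogonal_transformation_linear lborel_distr_orthogonal)
  have [measurable]: "T \<in> borel_measurable borel"
    using lin by (intro borel_measurable_continuous_onI linear_continuous_on linear_conv_bounded_linear[THEN iffD1])
  have "(nn_integral lborel F) = (\<integral>\<^sup>+x. F (T x) \<partial>lborel)"
    by (subst dist[symmetric], subst nn_integral_distr) auto
  also have "\<dots> = (\<integral>\<^sup>+c. F (T (\<Sum>e\<in>Basis. c e *\<^sub>R e)) \<partial>(lborel_on Basis))"
    by (subst lborel_eq, subst nn_integral_distr) auto
  also have "\<dots> = (\<integral>\<^sup>+c. F (\<Sum>b\<in>K. (\<lambda>k\<in>K. c (the_inv_into Basis \<sigma> k)) b *\<^sub>R b) \<partial>(lborel_on Basis))"
  proof (intro nn_integral_cong arg_cong[of _ _ F])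
    fix c :: "'a \<Rightarrow> real"
    have "T (\<Sum>e\<in>Basis. c e *\<^sub>R e) = (\<Sum>e\<in>Basis. c e *\<^sub>R \<sigma> e)"
      unfolding T_def by (intro sum.cong refl) simp
    also have "\<dots> = (\<Sum>e\<in>Basis. (\<lambda>k\<in>K. c (the_inv_into Basis \<sigma> k)) (\<sigma> e) *\<^sub>R \<sigma> e)"
      using \<sigma> by (intro sum.cong refl) (auto simp: bij_betw_def the_inv_into_f_f)
    also have "\<dots> = (\<Sum>b\<in>K. (\<lambda>k\<in>K. c (the_inv_into Basis \<sigma> k)) b *\<^sub>R b)"
      by (rule sum.reindex_bij_betw[OF \<sigma>])
    finally show "T (\<Sum>e\<in>Basis. c e *\<^sub>R e) = (\<Sum>b\<in>K. (\<lambda>k\<in>K. c (the_inv_into Basis \<sigma> k)) b *\<^sub>R b)" .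
  qed
  also have "\<dots> = (\<integral>\<^sup>+c. F (\<Sum>b\<in>K. c b *\<^sub>R b) \<partial>lborel_on K)"
  proof -
    have "(\<lambda>f. \<lambda>k\<in>K. f (the_inv_into Basis \<sigma> k)) \<in> (lborel_on Basis) \<rightarrow>\<^sub>M (lborel_on K)"
      using bij_betw_the_inv_into[OF \<sigma>]
      by (intro measurable_restrict measurable_component_singleton) (auto simp: bij_betw_def)
    note m = this
    have "(\<integral>\<^sup>+c. F (\<Sum>b\<in>K. c b *\<^sub>R b) \<partial>distr (lborel_on Basis) (lborel_on K)
        (\<lambda>f. \<lambda>k\<in>K. f (the_inv_into Basis \<sigma> k)))
      = (\<integral>\<^sup>+c. F (\<Sum>b\<in>K. (\<lambda>k\<in>K. c (the_inv_into Basis \<sigma> k)) b *\<^sub>R b) \<partial>(lborel_on Basis))"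
      by (rule nn_integral_distr[OF m]) measurable
    then show ?thesis by (simp only: PiM_reindex[OF finite_Basis \<sigma>])
  qed
  finally show ?thesis .
qed

text \<open>
  Coordinates of a point with respect to the basis \<open>b + \<kappa> b \<nu>\<close> (\<open>b \<in> B\<close>), \<open>\<nu>\<close>, which is a shear of an
  orthonormal one.
\<close>

locale sheared_basis =
  fixes B :: "'a::euclidean_space set" and \<nu> :: 'a and \<kappa> :: "'a \<Rightarrow> real"
  assumes fin: "finite B" and card: "card B + 1 = DIM('a)" and new: "\<nu> \<notin> B"
    and orth: "pairwise orthogonal (insert \<nu> B)" and unit: "\<And>b. b \<in> insert \<nu> B \<Longrightarrow> norm b = 1"
begin

text \<open>\<open>shadow\<close> parametrizes the hyperplane \<open>span B\<close> and
  \<open>lin\<close> the tilted one. They differ by a multiple of \<open>\<nu>\<close>, so the fiber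
  over \<open>c\<close> is the same line for every shear and only its point of height 0
  moves.\<close>

definition "shadow c = (\<Sum>b\<in>B. c b *\<^sub>R b)"
definition "lin c = (\<Sum>b\<in>B. c b *\<^sub>R (b + \<kappa> b *\<^sub>R \<nu>))"
definition "point c \<alpha> = lin c + \<alpha> *\<^sub>R \<nu>"
definition "coords x = (\<lambda>b\<in>B. x \<bullet> b)"
definition "height x = x \<bullet> \<nu> - (\<Sum>b\<in>B. (x \<bullet> b) * \<kappa> b)"

lemma lin_shadow: "lin c = shadow c + (\<Sum>b\<in>B. c b * \<kappa> b) *\<^sub>R \<nu>"
  by (simp add: lin_def shadow_def scaleR_add_right sum.distrib scaleR_sum_left)

lemma point_shadow: "point c \<alpha> = shadow c + ((\<Sum>b\<in>B. c b * \<kappa> b) + \<alpha>) *\<^sub>R \<nu>"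
  by (simp add: point_def lin_shadow scaleR_add_left)

lemma lin_cong: "(\<And>b. b \<in> B \<Longrightarrow> c b = d b) \<Longrightarrow> lin c = lin d"
  unfolding lin_def by (intro sum.cong) auto

lemma lin_add: "lin (\<lambda>b. c b + d b) = lin c + lin d"
  by (simp add: lin_def scaleR_add_left sum.distrib)

lemma lin_scale: "lin (\<lambda>b. r * c b) = r *\<^sub>R lin c"
  by (simp add: lin_def scaleR_sum_right)

lemma point_convex:
  "point (\<lambda>b\<in>B. r * c b + s * d b) (r * \<alpha> + s * \<beta>) = r *\<^sub>R point c \<alpha> + s *\<^sub>R point d \<beta>"
proof -
  have "lin (\<lambda>b\<in>B. r * c b + s * d b) = lin (\<lambda>b. r * c b + s * d b)" by (rule lin_cong) simp
  also have "\<dots> = r *\<^sub>R lin c + s *\<^sub>R lin d" by (simp add: lin_add lin_scale)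
  finally show ?thesis by (simp add: point_def algebra_simps)
qed

lemma span_basis: "span (insert \<nu> B) = UNIV"
proof -
  have nz: "0 \<notin> insert \<nu> B" using unit by force
  have "independent (insert \<nu> B)" by (rule pairwise_orthogonal_independent[OF orth nz])
  moreover have "card (insert \<nu> B) = DIM('a)" using fin card new by simp
  ultimately show ?thesis
    using card_ge_dim_independent[of "insert \<nu> B" UNIV] by (simp add: dim_UNIV) blast
qed

lemma expand: "x = (\<Sum>b\<in>B. (x \<bullet> b) *\<^sub>R b) + (x \<bullet> \<nu>) *\<^sub>R \<nu>"
proof -
  have "(\<Sum>b\<in>insert \<nu> B. (x \<bullet> b) *\<^sub>R b) = x"
    using fin unit span_basis by (intro orthonormal_basis_expand orth) auto
  then show ?thesis using fin new by (simp add: add.commute)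
qed

lemma inner_basis:
  "b \<in> insert \<nu> B \<Longrightarrow> b' \<in> insert \<nu> B \<Longrightarrow> b \<bullet> b' = (if b = b' then 1 else 0)"
  using orth unit by (auto simp: pairwise_def orthogonal_def norm_eq_1)

lemma shadow_inner: "b \<in> B \<Longrightarrow> shadow c \<bullet> b = c b" "shadow c \<bullet> \<nu> = 0"
proof -
  have "shadow c \<bullet> b = (\<Sum>b'\<in>B. if b' = b then c b' else 0)" if "b \<in> B" for b
    unfolding shadow_def inner_sum_left using that by (intro sum.cong) (auto simp: inner_basis)
  then show "b \<in> B \<Longrightarrow> shadow c \<bullet> b = c b" using fin by (simp add: sum.delta)
  show "shadow c \<bullet> \<nu> = 0"
    unfolding shadow_def inner_sum_left using new by (intro sum.neutral) (auto simp: inner_basis)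
qed

lemma point_coords: "point (coords x) (height x) = x"
proof -
  have "shadow (coords x) = (\<Sum>b\<in>B. (x \<bullet> b) *\<^sub>R b)"
    by (auto simp: shadow_def coords_def intro!: sum.cong)
  moreover have "(\<Sum>b\<in>B. coords x b * \<kappa> b) + height x = x \<bullet> \<nu>"
    by (simp add: coords_def height_def)
  ultimately show ?thesis unfolding point_shadow using expand[of x] by simp
qed

lemma coords_point:
  assumes "c \<in> extensional B"
  shows "coords (point c \<alpha>) = c" "height (point c \<alpha>) = \<alpha>"
proof -
  have *: "point c \<alpha> \<bullet> b = c b" if "b \<in> B" for b
  proof -
    have "\<nu> \<bullet> b = 0" using that new by (auto simp: inner_basis)
    then show ?thesis using that by (simp add: point_shadow inner_add_left shadow_inner)
  qed
  then show "coords (point c \<alpha>) = c"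
    using assms by (auto simp: coords_def extensional_def)
  have "point c \<alpha> \<bullet> \<nu> = (\<Sum>b\<in>B. c b * \<kappa> b) + \<alpha>"
    by (simp add: point_shadow inner_add_left shadow_inner inner_basis)
  then show "height (point c \<alpha>) = \<alpha>" using * by (simp add: height_def)
qed

lemma coords_measurable [measurable]: "coords \<in> borel \<rightarrow>\<^sub>M (lborel_on B)"
  unfolding coords_def[abs_def] by (intro measurable_restrict) auto

lemma height_measurable [measurable]: "height \<in> borel_measurable borel"
  unfolding height_def[abs_def] by measurable

lemma component_measurable [measurable]: "b \<in> B \<Longrightarrow> (\<lambda>c. c b) \<in> borel_measurable (lborel_on B)"
  using measurable_component_singleton[of b B "\<lambda>_. lborel :: real measure"] by simp

lemma shadow_measurable [measurable]: "shadow \<in> borel_measurable (lborel_on B)"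
  unfolding shadow_def[abs_def] by measurable

lemma nn_integral_lborel_shadow:
  assumes [measurable]: "F \<in> borel_measurable borel"
  shows "(nn_integral lborel F) = (\<integral>\<^sup>+c. \<integral>\<^sup>+\<alpha>. F (shadow c + \<alpha> *\<^sub>R \<nu>) \<partial>lborel \<partial>lborel_on B)"
proof -
  have "(nn_integral lborel F) = (\<integral>\<^sup>+c. F (\<Sum>b\<in>insert \<nu> B. c b *\<^sub>R b) \<partial>(lborel_on (insert \<nu> B)))"
    using fin card new unit orth by (intro nn_integral_orthonormal_basis) auto
  also have "\<dots> = (\<integral>\<^sup>+c. \<integral>\<^sup>+\<alpha>. F (\<Sum>b\<in>insert \<nu> B. (c(\<nu> := \<alpha>)) b *\<^sub>R b) \<partial>lborel \<partial>lborel_on B)"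
  proof (rule lborel_product.product_nn_integral_insert[OF fin new])
    have [measurable]: "(\<lambda>c. c b) \<in> borel_measurable (lborel_on (insert \<nu> B))"
      if "b \<in> insert \<nu> B" for b
      using measurable_component_singleton[OF that, of "\<lambda>_. lborel :: real measure"] by simp
    have "(\<lambda>c. \<Sum>b\<in>insert \<nu> B. c b *\<^sub>R b) \<in> borel_measurable (lborel_on (insert \<nu> B))"
      by (intro borel_measurable_sum borel_measurable_scaleR) auto
    then show "(\<lambda>c. F (\<Sum>b\<in>insert \<nu> B. c b *\<^sub>R b)) \<in> borel_measurable (lborel_on (insert \<nu> B))"
      by measurable
  qed
  also have "\<dots> = (\<integral>\<^sup>+c. \<integral>\<^sup>+\<alpha>. F (shadow c + \<alpha> *\<^sub>R \<nu>) \<partial>lborel \<partial>lborel_on B)"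
  proof (intro nn_integral_cong arg_cong[of _ _ F])
    fix c \<alpha>
    have "(\<Sum>b\<in>B. (c(\<nu> := \<alpha>)) b *\<^sub>R b) = shadow c"
      unfolding shadow_def using new by (intro sum.cong) auto
    then show "(\<Sum>b\<in>insert \<nu> B. (c(\<nu> := \<alpha>)) b *\<^sub>R b) = shadow c + \<alpha> *\<^sub>R \<nu>"
      using fin new by (simp add: add.commute)
  qed
  finally show ?thesis .
qed

text \<open>A shear translates each fiber by a constant, which does not affect the inner
  integral.\<close>

lemma nn_integral_lborel_point:
  assumes [measurable]: "F \<in> borel_measurable borel"
  shows "(nn_integral lborel F) = (\<integral>\<^sup>+c. \<integral>\<^sup>+\<alpha>. F (point c \<alpha>) \<partial>lborel \<partial>lborel_on B)"
  unfolding nn_integral_lborel_shadow[OF assms] point_shadow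
proof (rule nn_integral_cong)
  fix c
  show "(\<integral>\<^sup>+\<alpha>. F (shadow c + \<alpha> *\<^sub>R \<nu>) \<partial>lborel)
      = (\<integral>\<^sup>+\<alpha>. F (shadow c + ((\<Sum>b\<in>B. c b * \<kappa> b) + \<alpha>) *\<^sub>R \<nu>) \<partial>lborel)"
    by (rule nn_integral_lborel_translate[symmetric]) measurable
qed

end

section \<open>Regularization of concave functions\<close>

lemma p_concaveD:
  "p_concave p f \<Longrightarrow> 0 < t \<Longrightarrow> t < 1 \<Longrightarrow> p_mean p (f x) (f y) t \<le> f ((1 - t) *\<^sub>R x + t *\<^sub>R y)"
  by (auto simp: p_concave_def)

lemma p_concave_imp_quasi_concave:
  assumes "p_concave p f"
  shows "quasi_concave f"
  unfolding quasi_concave_iff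
proof (intro allI impI)
  fix x y and u v :: real assume uv: "0 \<le> u" "0 \<le> v" "u + v = 1"
  show "min (f x) (f y) \<le> f (u *\<^sub>R x + v *\<^sub>R y)"
  proof (cases "v = 0 \<or> v = 1")
    case True
    then show ?thesis using uv by auto
  next
    case False
    then have v: "0 < v" "v < 1" "u = 1 - v" using uv by auto
    then show ?thesis
      using p_mean_ge_min[OF v(1,2), of "f x" "f y" p] p_concaveD[OF assms v(1,2)] by (simp add: order_trans)
  qed
qed

text \<open>As its second weight \<open>e\<close> tends to 0, the mean with exponent
  \<open>-q\<close> tends to its first argument. So moving slightly towards a point with a positive
  value costs arbitrarily little. Finite \<open>a0\<close> and \<open>m0\<close> below
  \<open>a\<close> and \<open>m\<close> keep the limit within the reals.\<close>

lemma p_mean_near: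
  assumes "s < a" "0 < m" "0 < q" "ereal (- q) \<le> p"
  obtains e where "0 < e" "e < 1" "s < p_mean p a m e"
proof -
  obtain a1 where a1: "s < a1" "a1 < a" using dense assms(1) by blast
  then obtain s0 a0 where s0: "s = ennreal s0" "0 \<le> s0" and a0: "a1 = ennreal a0" "0 \<le> a0"
    by (cases s; cases a1) (auto simp: top_unique)
  have sa: "s0 < a0" using a1 s0 a0 by (simp add: ennreal_less_iff)
  obtain m1 where m1: "0 < m1" "m1 < m" using dense assms(2) by blast
  then obtain m0 where m0: "m1 = ennreal m0" "0 < m0" by (cases m1) auto
  have "((\<lambda>e. ((1 - e) * a0 powr (-q) + e * m0 powr (-q)) powr (-1/q)) \<longlongrightarrow>
      ((1 - 0) * a0 powr (-q) + 0 * m0 powr (-q)) powr (-1/q)) (at_right 0)"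
    using sa s0 by (intro tendsto_intros) auto
  moreover have "((1 - 0) * a0 powr (-q) + 0 * m0 powr (-q)) powr (-1/q) = a0"
    using sa s0 assms(3) by (simp add: powr_powr)
  ultimately have "\<forall>\<^sub>F e in at_right 0. s0 < ((1 - e) * a0 powr (-q) + e * m0 powr (-q)) powr (-1/q)"
    using sa by (intro order_tendstoD) auto
  moreover have "\<forall>\<^sub>F e in at_right (0::real). e \<in> {0<..<1}"
    by (rule eventually_at_right_real) simp
  ultimately have "\<forall>\<^sub>F e in at_right 0. s0 < ((1 - e) * a0 powr (-q) + e * m0 powr (-q)) powr (-1/q) \<and> e \<in> {0<..<1}"
    by (rule eventually_conj)
  then have "\<exists>e. s0 < ((1 - e) * a0 powr (-q) + e * m0 powr (-q)) powr (-1/q) \<and> e \<in> {0<..<1}"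
    by (rule eventually_happens'[rotated]) simp
  then obtain e where e: "s0 < ((1 - e) * a0 powr (-q) + e * m0 powr (-q)) powr (-1/q)" "0 < e" "e < 1"
    by auto
  have "s < ennreal (((1 - e) * a0 powr (-q) + e * m0 powr (-q)) powr (-1/q))"
    using e s0 by (simp add: ennreal_less_iff)
  also have "\<dots> \<le> p_mean p (ennreal a0) (ennreal m0) e"
    using sa s0 m0 e assms by (intro p_mean_ge_power_mean) auto
  also have "\<dots> \<le> p_mean p a m e"
    using a0 a1 m0 m1 e by (intro p_mean_mono) auto
  finally show thesis using that e by blast
qed

definition positive_set :: "('a \<Rightarrow> ennreal) \<Rightarrow> 'a set" where
  "positive_set f = {x. 0 < f x}"

lemma convex_positive_set: "quasi_concave f \<Longrightarrow> convex (positive_set f)"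
  by (simp add: quasi_concave_def positive_set_def)

context sheared_basis
begin

text \<open>
  The interior relative to translations parallel to the span of the vectors \<open>b + \<kappa> b \<nu>\<close>.
\<close>

definition core :: "'a set \<Rightarrow> 'a set" where
  "core C = {x. \<exists>r>0. \<forall>c. (\<forall>b\<in>B. \<bar>c b\<bar> < r) \<longrightarrow> x + lin c \<in> C}"

text \<open>The union of all lines in direction \<open>\<nu>\<close> through \<open>C\<close>. It
  replaces the projection of \<open>C\<close>, so that interior and frontier can be taken in the
  whole space.\<close>

definition cylinder :: "'a set \<Rightarrow> 'a set" where
  "cylinder C = {x. \<exists>\<alpha>. x + \<alpha> *\<^sub>R \<nu> \<in> C}"

text \<open>Lower semicontinuity along the cells can fail only where the support ends; the values
  outside the core are therefore erased.\<close>

definition regular_part :: "('a \<Rightarrow> ennreal) \<Rightarrow> 'a \<Rightarrow> ennreal" where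
  "regular_part f x = (if x \<in> core (positive_set f) then f x else 0)"

definition in_coords :: "('a \<Rightarrow> ennreal) \<Rightarrow> ('a \<Rightarrow> real) \<Rightarrow> real \<Rightarrow> ennreal" where
  "in_coords f c \<alpha> = regular_part f (point c \<alpha>)"

lemma lin_zero [simp]: "lin (\<lambda>_. 0) = 0"
  by (simp add: lin_def)

lemma core_subset: "core C \<subseteq> C"
proof
  fix x assume "x \<in> core C"
  then obtain r :: real where "0 < r" "\<And>c. (\<forall>b\<in>B. \<bar>c b\<bar> < r) \<Longrightarrow> x + lin c \<in> C"
    unfolding core_def by blast
  from this(2)[of "\<lambda>_. 0"] this(1) show "x \<in> C" by simp
qed

text \<open>The segment principle for interiors: combining \<open>x\<close> with the cube of radius
  \<open>r\<close> around \<open>y\<close> produces a cube of radius \<open>e * r\<close>.\<close>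

lemma core_combination:
  assumes "convex C" "x \<in> C" "y \<in> core C" "0 < e" "e \<le> 1"
  shows "(1 - e) *\<^sub>R x + e *\<^sub>R y \<in> core C"
proof -
  obtain r where r: "0 < r" "\<And>c. (\<forall>b\<in>B. \<bar>c b\<bar> < r) \<Longrightarrow> y + lin c \<in> C"
    using assms(3) unfolding core_def by blast
  have "(1 - e) *\<^sub>R x + e *\<^sub>R y + lin c \<in> C" if c: "\<forall>b\<in>B. \<bar>c b\<bar> < e * r" for c
  proof -
    have "\<forall>b\<in>B. \<bar>(1 / e) * c b\<bar> < r"
      using c assms(4) by (auto simp: abs_mult field_simps)
    then have "y + (1 / e) *\<^sub>R lin c \<in> C"
      using r(2)[of "\<lambda>b. (1 / e) * c b"] unfolding lin_scale by blast
    then have "(1 - e) *\<^sub>R x + e *\<^sub>R (y + (1 / e) *\<^sub>R lin c) \<in> C"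
      using assms by (intro convexD) auto
    then show ?thesis using assms(4) by (simp add: scaleR_add_right add.assoc)
  qed
  moreover have "0 < e * r" using r assms by simp
  ultimately show ?thesis unfolding core_def by blast
qed

lemma lin_small:
  assumes "0 < e"
  obtains r where "0 < r" "\<And>c. (\<forall>b\<in>B. \<bar>c b\<bar> < r) \<Longrightarrow> norm (lin c) < e"
proof
  let ?S = "\<Sum>b\<in>B. norm (b + \<kappa> b *\<^sub>R \<nu>)"
  have S: "0 \<le> ?S" by (simp add: sum_nonneg)
  show "0 < e / (?S + 1)" using assms S by simp
  fix c :: "'a \<Rightarrow> real" assume c: "\<forall>b\<in>B. \<bar>c b\<bar> < e / (?S + 1)"
  have "norm (lin c) \<le> (\<Sum>b\<in>B. \<bar>c b\<bar> * norm (b + \<kappa> b *\<^sub>R \<nu>))"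
    unfolding lin_def by (rule order_trans[OF norm_sum]) simp
  also have "\<dots> \<le> (\<Sum>b\<in>B. e / (?S + 1) * norm (b + \<kappa> b *\<^sub>R \<nu>))"
    using c by (intro sum_mono mult_right_mono) (auto simp: less_imp_le)
  also have "\<dots> = e * (?S / (?S + 1))"
    by (subst sum_distrib_left[symmetric]) simp
  also have "\<dots> < e * 1"
    using assms S by (intro mult_strict_left_mono) auto
  finally show "norm (lin c) < e" by simp
qed

lemma interior_subset_core: "interior C \<subseteq> core C"
proof
  fix x assume "x \<in> interior C"
  then obtain e where e: "0 < e" "ball x e \<subseteq> C" by (auto simp: mem_interior)
  obtain r where r: "0 < r" "\<And>c. (\<forall>b\<in>B. \<bar>c b\<bar> < r) \<Longrightarrow> norm (lin c) < e"
    using lin_small[OF e(1)] by blast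
  have "x + lin c \<in> C" if "\<forall>b\<in>B. \<bar>c b\<bar> < r" for c
    using r(2)[OF that] e(2) by (auto simp: dist_norm subset_iff)
  then show "x \<in> core C" unfolding core_def using r(1) by blast
qed

lemma regular_part_le: "regular_part f x \<le> f x"
  by (simp add: regular_part_def)

lemma regular_part_pos: "0 < regular_part f x \<Longrightarrow> x \<in> core (positive_set f) \<and> regular_part f x = f x"
  by (auto simp: regular_part_def split: if_splits)

lemma quasi_concave_regular_part:
  assumes "quasi_concave f"
  shows "quasi_concave (regular_part f)"
  unfolding quasi_concave_iff
proof (intro allI impI)
  fix x y and u v :: real assume uv: "0 \<le> u" "0 \<le> v" "u + v = 1"
  let ?K = "core (positive_set f)"
  show "min (regular_part f x) (regular_part f y) \<le> regular_part f (u *\<^sub>R x + v *\<^sub>R y)"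
  proof (cases "x \<in> ?K \<and> y \<in> ?K")
    case True
    have "u *\<^sub>R x + v *\<^sub>R y \<in> ?K"
    proof (cases "v = 0")
      case False
      then have "(1 - v) *\<^sub>R x + v *\<^sub>R y \<in> ?K"
        using True core_subset uv by (intro core_combination convex_positive_set assms) auto
      moreover have "u = 1 - v" using uv by simp
      ultimately show ?thesis by simp
    qed (use True uv in auto)
    moreover have "min (f x) (f y) \<le> f (u *\<^sub>R x + v *\<^sub>R y)"
      using assms uv by (auto simp: quasi_concave_iff)
    ultimately show ?thesis using True by (simp add: regular_part_def)
  qed (auto simp: regular_part_def)
qed

lemma quasi_concave_in_coords:
  assumes "quasi_concave f"
  shows "quasi_concave (in_coords f c)"
  unfolding quasi_concave_iff
proof (intro allI impI)
  fix \<alpha> \<beta> u v :: real assume uv: "0 \<le> u" "0 \<le> v" "u + v = 1"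
  have "u *\<^sub>R lin c + v *\<^sub>R lin c = lin c"
    using uv by (simp add: scaleR_add_left[symmetric])
  then have "point c (u *\<^sub>R \<alpha> + v *\<^sub>R \<beta>) = u *\<^sub>R point c \<alpha> + v *\<^sub>R point c \<beta>"
    by (simp add: point_def algebra_simps)
  then show "min (in_coords f c \<alpha>) (in_coords f c \<beta>) \<le> in_coords f c (u *\<^sub>R \<alpha> + v *\<^sub>R \<beta>)"
    using quasi_concave_regular_part[OF assms] uv by (auto simp: in_coords_def quasi_concave_iff)
qed

text \<open>Near a core point \<open>f\<close> is positive at the centre and at the vertices of a
  small cross-polytope. Quasi-concavity extends the minimum of these finitely many values to their
  convex hull, which is why the neighbourhood is measured by the sum of the
  \<open>\<bar>d b\<bar>\<close>.\<close>

lemma core_lower_bound: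
  assumes qc: "quasi_concave f" and x: "x \<in> core (positive_set f)"
  obtains m r where "0 < m" "0 < r" "\<And>d. (\<Sum>b\<in>B. \<bar>d b\<bar>) \<le> r \<Longrightarrow> m \<le> f (x + lin d)"
proof -
  obtain r' where r': "0 < r'" "\<And>c. (\<forall>b\<in>B. \<bar>c b\<bar> < r') \<Longrightarrow> x + lin c \<in> positive_set f"
    using x unfolding core_def by blast
  define r where "r = r' / 2"
  have r: "0 < r" "r < r'" using r' by (auto simp: r_def)
  let ?w = "\<lambda>b. b + \<kappa> b *\<^sub>R \<nu>"
  define S where "S = insert (f x) ((\<lambda>b. f (x + r *\<^sub>R ?w b)) ` B \<union> (\<lambda>b. f (x - r *\<^sub>R ?w b)) ` B)"
  have S: "finite S" "S \<noteq> {}" using fin by (auto simp: S_def)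
  have one: "lin (\<lambda>b'. if b' = b then k else 0) = k *\<^sub>R ?w b" if "b \<in> B" for b k
  proof -
    have "lin (\<lambda>b'. if b' = b then k else 0) = (\<Sum>b'\<in>B. if b' = b then k *\<^sub>R ?w b' else 0)"
      unfolding lin_def by (intro sum.cong) auto
    then show ?thesis using fin that by (simp add: sum.delta)
  qed
  have "0 < f (x + k *\<^sub>R ?w b)" if "b \<in> B" "\<bar>k\<bar> < r'" for b k
    using r'(2)[of "\<lambda>b'. if b' = b then k else 0"] that r'(1) by (simp add: one positive_set_def)
  from this[of _ r] this[of _ "- r"] have "0 < f (x + r *\<^sub>R ?w b)" "0 < f (x - r *\<^sub>R ?w b)" if "b \<in> B" for b
    using that r by auto
  moreover have "0 < f x" using x core_subset by (auto simp: positive_set_def)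
  ultimately have m: "0 < Min S"
    using S by (auto simp: S_def)
  have conv: "convex {y. Min S \<le> f y}"
    unfolding convex_def
  proof (intro ballI allI impI CollectI)
    fix y z and u v :: real
    assume *: "y \<in> {y. Min S \<le> f y}" "z \<in> {y. Min S \<le> f y}" "0 \<le> u" "0 \<le> v" "u + v = 1"
    then have "Min S \<le> min (f y) (f z)" by simp
    also have "\<dots> \<le> f (u *\<^sub>R y + v *\<^sub>R z)" using qc * by (auto simp: quasi_concave_iff)
    finally show "Min S \<le> f (u *\<^sub>R y + v *\<^sub>R z)" .
  qed
  show thesis
  proof (rule that[OF m r(1)])
    fix d assume d: "(\<Sum>b\<in>B. \<bar>d b\<bar>) \<le> r"
    \<comment> \<open>Barycentric coordinates in the cross-polytope: \<open>\<nu>\<close>, which is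
      not in \<open>B\<close>, serves as the index of the centre and takes the remaining
      weight.\<close>
    define a where "a b = (if b = \<nu> then 1 - (\<Sum>b\<in>B. \<bar>d b\<bar>) / r else \<bar>d b\<bar> / r)" for b
    define y where "y b = (if b = \<nu> then x else x + (sgn (d b) * r) *\<^sub>R ?w b)" for b
    have aB: "a b = \<bar>d b\<bar> / r" "y b = x + (sgn (d b) * r) *\<^sub>R ?w b" if "b \<in> B" for b
      using that new by (auto simp: a_def y_def)
    have sum_a: "(\<Sum>b\<in>B. a b) = (\<Sum>b\<in>B. \<bar>d b\<bar>) / r"
      using aB by (simp add: sum_divide_distrib)
    have "(\<Sum>b\<in>insert \<nu> B. a b *\<^sub>R y b) \<in> {y. Min S \<le> f y}"
    proof (rule convex_sum[OF _ conv])
      show "finite (insert \<nu> B)" using fin by simp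
      show "(\<Sum>b\<in>insert \<nu> B. a b) = 1" using fin new sum_a by (simp add: a_def)
      fix b assume b: "b \<in> insert \<nu> B"
      show "0 \<le> a b" using d r by (auto simp: a_def)
      have "f (y b) \<in> S"
      proof (cases "b = \<nu> \<or> d b = 0")
        case False
        then have "sgn (d b) = 1 \<or> sgn (d b) = -1" by (auto simp: sgn_if)
        then show ?thesis using False b by (auto simp: y_def S_def)
      qed (auto simp: y_def S_def)
      then show "y b \<in> {y. Min S \<le> f y}" using S by simp
    qed
    also have "(\<Sum>b\<in>insert \<nu> B. a b *\<^sub>R y b) = a \<nu> *\<^sub>R x + (\<Sum>b\<in>B. a b *\<^sub>R y b)"
      using fin new by (simp add: y_def)
    also have "(\<Sum>b\<in>B. a b *\<^sub>R y b) = (\<Sum>b\<in>B. a b *\<^sub>R x + d b *\<^sub>R ?w b)"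
    proof (intro sum.cong refl)
      fix b assume b: "b \<in> B"
      have "\<bar>d b\<bar> / r * (sgn (d b) * r) = d b" using r by (simp add: abs_mult_sgn)
      then show "a b *\<^sub>R y b = a b *\<^sub>R x + d b *\<^sub>R ?w b"
        unfolding aB[OF b] by (simp only: scaleR_add_right[of _ x] scaleR_scaleR)
    qed
    also have "\<dots> = (\<Sum>b\<in>B. a b) *\<^sub>R x + lin d"
      by (simp only: sum.distrib scaleR_sum_left[symmetric] lin_def)
    also have "a \<nu> *\<^sub>R x + ((\<Sum>b\<in>B. a b) *\<^sub>R x + lin d) = x + lin d"
      unfolding sum_a by (simp add: a_def algebra_simps)
    finally show "Min S \<le> f (x + lin d)" by simp
  qed
qed

text \<open>A nearby point \<open>x + lin d\<close> is the combination, with small weight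
  \<open>e\<close>, of \<open>x\<close> and the remote point
  \<open>x + (1 / e) *\<^sub>R lin d\<close>, where \<open>f\<close> is still at least
  \<open>m\<close>. By concavity its value is at least the mean of \<open>f x\<close> and
  \<open>m\<close>, which exceeds \<open>s\<close> once \<open>e\<close> is small.\<close>

lemma lsc_in_coords:
  assumes pc: "p_concave p f" and q: "0 < q" "ereal (- q) \<le> p"
  shows "lsc_in B (in_coords f)"
  unfolding lsc_in_def
proof (intro allI impI)
  fix c \<alpha> s assume s: "s < in_coords f c \<alpha>"
  define x where "x = point c \<alpha>"
  have "0 < regular_part f x"
    using le_less_trans[OF zero_le s] by (simp add: in_coords_def x_def)
  then have x: "x \<in> core (positive_set f)" and sx: "s < f x"
    using regular_part_pos[of f x] s by (auto simp: in_coords_def x_def)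
  obtain r where r: "0 < r" "\<And>c. (\<forall>b\<in>B. \<bar>c b\<bar> < r) \<Longrightarrow> x + lin c \<in> positive_set f"
    using x unfolding core_def by blast
  obtain m \<rho> where m: "0 < m" "0 < \<rho>" "\<And>d. (\<Sum>b\<in>B. \<bar>d b\<bar>) \<le> \<rho> \<Longrightarrow> m \<le> f (x + lin d)"
    using core_lower_bound[OF p_concave_imp_quasi_concave[OF pc] x] by blast
  obtain e where e: "0 < e" "e < 1" "s < p_mean p (f x) m e"
    using p_mean_near[OF sx m(1) q] by blast
  \<comment> \<open>The first bound leaves a cube of radius \<open>r / 2\<close> around the new
    point inside the support. The second keeps the sum of the \<open>\<bar>d b\<bar> / e\<close>
    below \<open>\<rho>\<close>.\<close>
  define \<delta> where "\<delta> = min (r / 2) (e * \<rho> / (card B + 1))"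
  have \<delta>: "0 < \<delta>" using r m e by (simp add: \<delta>_def)
  show "\<exists>r>0. \<forall>c'. (\<forall>i\<in>B. \<bar>c' i - c i\<bar> < r) \<longrightarrow> s < in_coords f c' \<alpha>"
  proof (intro exI[of _ \<delta>] conjI allI impI \<delta>)
    fix c' assume c': "\<forall>i\<in>B. \<bar>c' i - c i\<bar> < \<delta>"
    define d where "d b = c' b - c b" for b
    have d: "\<bar>d b\<bar> < r / 2" "\<bar>d b\<bar> \<le> e * \<rho> / (card B + 1)" if "b \<in> B" for b
      using c' that by (auto simp: d_def \<delta>_def)
    have pt: "point c' \<alpha> = x + lin d"
    proof -
      have "lin c' = lin (\<lambda>b. c b + d b)" by (simp add: d_def)
      then show ?thesis by (simp add: lin_add point_def x_def algebra_simps)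
    qed
    have "x + lin d + lin d' \<in> positive_set f" if "\<forall>b\<in>B. \<bar>d' b\<bar> < r / 2" for d'
    proof -
      have "\<bar>d b + d' b\<bar> < r" if "b \<in> B" for b
        using d(1)[OF that] \<open>\<forall>b\<in>B. \<bar>d' b\<bar> < r / 2\<close> that by (smt (verit) field_sum_of_halves)
      then show ?thesis using r(2)[of "\<lambda>b. d b + d' b"] by (simp add: lin_add add.assoc)
    qed
    then have core: "point c' \<alpha> \<in> core (positive_set f)"
      unfolding core_def pt using r(1) by (auto intro!: exI[of _ "r / 2"])
    have "(\<Sum>b\<in>B. \<bar>(1 / e) * d b\<bar>) \<le> \<rho>"
    proof -
      have "(\<Sum>b\<in>B. \<bar>(1 / e) * d b\<bar>) \<le> (\<Sum>b\<in>B. \<rho> / (card B + 1))"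
      proof (intro sum_mono)
        fix b assume "b \<in> B"
        from d(2)[OF this] have "(1 / e) * \<bar>d b\<bar> \<le> (1 / e) * (e * \<rho> / (card B + 1))"
          using e by (intro mult_left_mono) auto
        also have "\<dots> = \<rho> / (card B + 1)" using e by simp
        finally show "\<bar>(1 / e) * d b\<bar> \<le> \<rho> / (card B + 1)" using e by (simp add: abs_mult)
      qed
      also have "\<dots> = \<rho> * (card B / (card B + 1))" by simp
      also have "\<dots> \<le> \<rho> * 1" using m by (intro mult_left_mono) auto
      finally show ?thesis by simp
    qed
    then have "m \<le> f (x + (1 / e) *\<^sub>R lin d)"
      using m(3)[of "\<lambda>b. (1 / e) * d b"] unfolding lin_scale by blast
    then have "p_mean p (f x) m e \<le> p_mean p (f x) (f (x + (1 / e) *\<^sub>R lin d)) e"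
      using e by (intro p_mean_mono) auto
    also have "\<dots> \<le> f ((1 - e) *\<^sub>R x + e *\<^sub>R (x + (1 / e) *\<^sub>R lin d))"
      using e by (intro p_concaveD[OF pc])
    also have "(1 - e) *\<^sub>R x + e *\<^sub>R (x + (1 / e) *\<^sub>R lin d) = x + lin d"
      using e by (simp add: algebra_simps)
    finally have "s < f (x + lin d)" using e(3) by (rule less_le_trans[rotated])
    then show "s < in_coords f c' \<alpha>"
      using core by (simp add: in_coords_def regular_part_def pt)
  qed
qed

section \<open>Fibers over the interior of the projected support\<close>

lemma cylinder_translate: "x + \<beta> *\<^sub>R \<nu> \<in> cylinder C \<longleftrightarrow> x \<in> cylinder C"
proof
  assume "x + \<beta> *\<^sub>R \<nu> \<in> cylinder C"
  then obtain \<alpha> where "x + \<beta> *\<^sub>R \<nu> + \<alpha> *\<^sub>R \<nu> \<in> C" by (auto simp: cylinder_def)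
  then have "x + (\<beta> + \<alpha>) *\<^sub>R \<nu> \<in> C" by (simp add: algebra_simps)
  then show "x \<in> cylinder C" unfolding cylinder_def by blast
next
  assume "x \<in> cylinder C"
  then obtain \<alpha> where "x + \<alpha> *\<^sub>R \<nu> \<in> C" by (auto simp: cylinder_def)
  then have "x + \<beta> *\<^sub>R \<nu> + (\<alpha> - \<beta>) *\<^sub>R \<nu> \<in> C" by (simp add: algebra_simps)
  then show "x + \<beta> *\<^sub>R \<nu> \<in> cylinder C" unfolding cylinder_def by blast
qed

lemma convex_cylinder:
  assumes "convex C"
  shows "convex (cylinder C)"
  unfolding convex_def
proof (intro ballI allI impI)
  fix x y and u v :: real assume xy: "x \<in> cylinder C" "y \<in> cylinder C" and uv: "0 \<le> u" "0 \<le> v" "u + v = 1"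
  obtain \<alpha> \<beta> where "x + \<alpha> *\<^sub>R \<nu> \<in> C" "y + \<beta> *\<^sub>R \<nu> \<in> C" using xy by (auto simp: cylinder_def)
  then have "u *\<^sub>R (x + \<alpha> *\<^sub>R \<nu>) + v *\<^sub>R (y + \<beta> *\<^sub>R \<nu>) \<in> C" using assms uv by (intro convexD)
  then have "u *\<^sub>R x + v *\<^sub>R y + (u * \<alpha> + v * \<beta>) *\<^sub>R \<nu> \<in> C" by (simp add: algebra_simps)
  then show "u *\<^sub>R x + v *\<^sub>R y \<in> cylinder C" unfolding cylinder_def by blast
qed

text \<open>Prolong the segment from the core point \<open>y\<close> through \<open>z\<close> to
  \<open>z + e *\<^sub>R (z - y)\<close>, still in the cylinder, and lift this point along
  \<open>\<nu>\<close> into \<open>C\<close>. Combining the lift with \<open>y\<close> leads back to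
  the line over \<open>z\<close>, and the result inherits core membership from
  \<open>y\<close>.\<close>

lemma interior_cylinder:
  assumes C: "convex C" and ne: "core C \<noteq> {}" and z: "z \<in> interior (cylinder C)"
  obtains \<alpha> where "z + \<alpha> *\<^sub>R \<nu> \<in> core C"
proof -
  obtain y where y: "y \<in> core C" using ne by blast
  obtain r where r: "0 < r" "ball z r \<subseteq> cylinder C" using z by (auto simp: mem_interior)
  \<comment> \<open>The prolongation has length less than \<open>r\<close>; the added 1 covers
    \<open>z = y\<close>.\<close>
  define e where "e = r / (2 * (norm (z - y) + 1))"
  have e: "0 < e" using r by (simp add: e_def add_nonneg_pos)
  have "norm (e *\<^sub>R (z - y)) = e * norm (z - y)"
    using e by simp
  also have "\<dots> = r / 2 * (norm (z - y) / (norm (z - y) + 1))"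
    by (simp add: e_def)
  also have "\<dots> \<le> r / 2 * 1"
  proof (intro mult_left_mono)
    have "0 < norm (z - y) + 1" using norm_ge_zero[of "z - y"] by linarith
    then show "norm (z - y) / (norm (z - y) + 1) \<le> 1" by simp
  qed (use r in simp)
  finally have "norm (e *\<^sub>R (z - y)) < r" using r by simp
  then have "z + e *\<^sub>R (z - y) \<in> cylinder C" using r(2) by (auto simp: dist_norm subset_iff)
  then obtain \<alpha> where "z + e *\<^sub>R (z - y) + \<alpha> *\<^sub>R \<nu> \<in> C" by (auto simp: cylinder_def)
  then have "(1 - e / (1 + e)) *\<^sub>R (z + e *\<^sub>R (z - y) + \<alpha> *\<^sub>R \<nu>) + (e / (1 + e)) *\<^sub>R y \<in> core C"
    using C y e by (intro core_combination) auto
  moreover have "(1 - e / (1 + e)) *\<^sub>R (z + e *\<^sub>R (z - y) + \<alpha> *\<^sub>R \<nu>) + (e / (1 + e)) *\<^sub>R y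
      = z + (\<alpha> / (1 + e)) *\<^sub>R \<nu>"
  proof -
    have "(1 - e / (1 + e)) = 1 / (1 + e)" using e by (simp add: field_simps)
    then have "(1 - e / (1 + e)) *\<^sub>R (z + e *\<^sub>R (z - y) + \<alpha> *\<^sub>R \<nu>) + (e / (1 + e)) *\<^sub>R y
        = (1 / (1 + e)) *\<^sub>R (z + e *\<^sub>R (z - y) + \<alpha> *\<^sub>R \<nu> + e *\<^sub>R y)"
      by (simp add: scaleR_add_right)
    also have "z + e *\<^sub>R (z - y) + \<alpha> *\<^sub>R \<nu> + e *\<^sub>R y = (1 + e) *\<^sub>R z + \<alpha> *\<^sub>R \<nu>"
      by (simp add: algebra_simps)
    finally show ?thesis using e by (simp add: scaleR_add_right)
  qed
  ultimately show thesis using that by metis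
qed

definition fiber_sup :: "('a \<Rightarrow> ennreal) \<Rightarrow> 'a \<Rightarrow> ennreal" where
  "fiber_sup f h = (SUP \<alpha>. f (h + \<alpha> *\<^sub>R \<nu>))"

lemma fiber_sup_shift: "fiber_sup f (h + \<beta> *\<^sub>R \<nu>) = fiber_sup f h"
  unfolding fiber_sup_def
proof (rule antisym; rule SUP_least)
  fix \<alpha>
  have *: "h + \<beta> *\<^sub>R \<nu> + \<alpha> *\<^sub>R \<nu> = h + (\<beta> + \<alpha>) *\<^sub>R \<nu>" "h + \<alpha> *\<^sub>R \<nu> = h + \<beta> *\<^sub>R \<nu> + (\<alpha> - \<beta>) *\<^sub>R \<nu>"
    by (simp_all add: algebra_simps)
  show "f (h + \<beta> *\<^sub>R \<nu> + \<alpha> *\<^sub>R \<nu>) \<le> (SUP \<alpha>. f (h + \<alpha> *\<^sub>R \<nu>))"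
    unfolding *(1) by (rule SUP_upper) simp
  show "f (h + \<alpha> *\<^sub>R \<nu>) \<le> (SUP \<alpha>. f (h + \<beta> *\<^sub>R \<nu> + \<alpha> *\<^sub>R \<nu>))"
    unfolding *(2) by (rule SUP_upper) simp
qed

lemma SUP_in_coords: "(SUP \<alpha>. in_coords f c \<alpha>) = fiber_sup (regular_part f) (shadow c)"
  unfolding in_coords_def point_def fiber_sup_def[symmetric] lin_shadow by (rule fiber_sup_shift)

lemma fiber_sup_zero:
  assumes "h \<notin> cylinder (positive_set f)"
  shows "fiber_sup f h = 0"
proof -
  have "f (h + \<alpha> *\<^sub>R \<nu>) = 0" for \<alpha>
    using assms by (auto simp: cylinder_def positive_set_def)
  then show ?thesis by (simp add: fiber_sup_def)
qed

text \<open>Over an interior point of the cylinder the fiber meets the core. From any point of the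
  support on this fiber, a small step towards the core point enters the core and loses arbitrarily
  little of the value, so erasing the other values leaves the supremum unchanged.\<close>

lemma fiber_sup_regular_part:
  assumes pc: "p_concave p f" and q: "0 < q" "ereal (- q) \<le> p"
    and ne: "core (positive_set f) \<noteq> {}" and h: "h \<notin> frontier (cylinder (positive_set f))"
  shows "fiber_sup f h = fiber_sup (regular_part f) h"
proof (cases "h \<in> cylinder (positive_set f)")
  case False
  have "fiber_sup (regular_part f) h \<le> fiber_sup f h"
    unfolding fiber_sup_def by (intro SUP_mono' regular_part_le)
  then show ?thesis using fiber_sup_zero[OF False] by simp
next
  case True
  note conv = convex_positive_set[OF p_concave_imp_quasi_concave[OF pc]]
  have "h \<in> interior (cylinder (positive_set f))"
    using True h closure_subset by (auto simp: frontier_def)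
  then obtain \<beta> where \<beta>: "h + \<beta> *\<^sub>R \<nu> \<in> core (positive_set f)"
    using interior_cylinder[OF conv ne] by blast
  show ?thesis
  proof (rule antisym)
    show "fiber_sup f h \<le> fiber_sup (regular_part f) h"
      unfolding fiber_sup_def[of f]
    proof (rule SUP_least, rule dense_le)
      fix \<alpha> s assume s: "s < f (h + \<alpha> *\<^sub>R \<nu>)"
      let ?x = "h + \<alpha> *\<^sub>R \<nu>" and ?y = "h + \<beta> *\<^sub>R \<nu>"
      have x: "?x \<in> positive_set f" using le_less_trans[OF zero_le s] by (simp add: positive_set_def)
      have "0 < f ?y" using \<beta> core_subset by (auto simp: positive_set_def)
      then obtain e where e: "0 < e" "e < 1" "s < p_mean p (f ?x) (f ?y) e"
        using p_mean_near[OF s _ q] by blast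
      note e(3)
      also have "p_mean p (f ?x) (f ?y) e \<le> f ((1 - e) *\<^sub>R ?x + e *\<^sub>R ?y)"
        by (rule p_concaveD[OF pc e(1,2)])
      also have "\<dots> = regular_part f ((1 - e) *\<^sub>R ?x + e *\<^sub>R ?y)"
        using core_combination[OF conv x \<beta>, of e] e by (simp add: regular_part_def)
      also have "(1 - e) *\<^sub>R ?x + e *\<^sub>R ?y = h + ((1 - e) * \<alpha> + e * \<beta>) *\<^sub>R \<nu>"
        by (simp add: algebra_simps)
      also have "regular_part f \<dots> \<le> fiber_sup (regular_part f) h"
        unfolding fiber_sup_def by (rule SUP_upper) simp
      finally show "s \<le> fiber_sup (regular_part f) h" by simp
    qed
    show "fiber_sup (regular_part f) h \<le> fiber_sup f h"
      unfolding fiber_sup_def by (intro SUP_mono' regular_part_le)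
  qed
qed

section \<open>Null frontiers and the transfer of integrals to coordinates\<close>

lemma frontier_null:
  assumes "convex C"
  shows "frontier C \<in> sets borel" "AE x in lborel. x \<notin> frontier C"
proof -
  show S: "frontier C \<in> sets borel" by (intro borel_closed frontier_closed)
  have "negligible (frontier C)" by (rule negligible_convex_frontier[OF assms])
  then have "emeasure lebesgue (frontier C) = 0"
    by (simp add: negligible_iff_null_sets null_sets_def)
  then have "emeasure lborel (frontier C) = 0"
    using S by (simp add: emeasure_completion)
  then show "AE x in lborel. x \<notin> frontier C"
    using S by (intro AE_not_in) (simp add: null_sets_def)
qed

text \<open>The frontier of the cylinder is null and invariant under translations along
  \<open>\<nu>\<close>. Its intersection with a fiber therefore has length 0 or \<infinity>, and
  Fubini's theorem excludes \<infinity> for almost every \<open>c\<close>.\<close>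

lemma AE_shadow_frontier:
  assumes C: "convex C"
  shows "AE c in (lborel_on B). shadow c \<notin> frontier (cylinder C)"
proof -
  let ?Z = "cylinder C"
  have inv: "x + \<alpha> *\<^sub>R \<nu> \<in> frontier ?Z \<longleftrightarrow> x \<in> frontier ?Z" for x \<alpha>
  proof -
    have "?Z = (+) (\<alpha> *\<^sub>R \<nu>) ` ?Z"
    proof (intro set_eqI iffI)
      fix y assume "y \<in> ?Z"
      then have "y + (- \<alpha>) *\<^sub>R \<nu> \<in> ?Z" by (simp only: cylinder_translate)
      then show "y \<in> (+) (\<alpha> *\<^sub>R \<nu>) ` ?Z" by (intro image_eqI[where x = "y + (- \<alpha>) *\<^sub>R \<nu>"]) auto
    next
      fix y assume "y \<in> (+) (\<alpha> *\<^sub>R \<nu>) ` ?Z"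
      then obtain w where "w \<in> ?Z" "y = w + \<alpha> *\<^sub>R \<nu>" by (auto simp: add.commute)
      then show "y \<in> ?Z" by (simp add: cylinder_translate)
    qed
    then have "frontier ?Z = (+) (\<alpha> *\<^sub>R \<nu>) ` frontier ?Z"
      using frontier_translation[of "\<alpha> *\<^sub>R \<nu>" ?Z] by simp
    then show ?thesis by (metis (no_types, lifting) add.commute add_left_cancel imageE image_eqI)
  qed
  have [measurable]: "frontier ?Z \<in> sets borel"
    by (rule frontier_null(1)[OF convex_cylinder[OF C]])
  have "(nn_integral lborel (indicator (frontier ?Z))) = (\<integral>\<^sup>+x. 0 \<partial>(lborel :: 'a measure))"
    using frontier_null(2)[OF convex_cylinder[OF C]]
    by (intro nn_integral_cong_AE) (auto elim: eventually_mono)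
  then have "(\<integral>\<^sup>+c. \<integral>\<^sup>+\<alpha>. indicator (frontier ?Z) (shadow c + \<alpha> *\<^sub>R \<nu>) \<partial>lborel \<partial>lborel_on B) = 0"
    by (subst nn_integral_lborel_shadow[symmetric]) auto
  moreover have "(\<integral>\<^sup>+\<alpha>. indicator (frontier ?Z) (shadow c + \<alpha> *\<^sub>R \<nu>) \<partial>lborel)
      = indicator (frontier ?Z) (shadow c) * (\<infinity>::ennreal)" for c
  proof -
    have "(\<integral>\<^sup>+\<alpha>. indicator (frontier ?Z) (shadow c + \<alpha> *\<^sub>R \<nu>) \<partial>lborel)
        = (\<integral>\<^sup>+\<alpha>. indicator (frontier ?Z) (shadow c) \<partial>(lborel :: real measure))"
      by (intro nn_integral_cong) (simp add: indicator_def inv)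
    then show ?thesis by simp
  qed
  ultimately have "(\<integral>\<^sup>+c. indicator (frontier ?Z) (shadow c) * (\<infinity>::ennreal) \<partial>lborel_on B) = 0"
    by simp
  then have "AE c in (lborel_on B). indicator (frontier ?Z) (shadow c) * (\<infinity>::ennreal) = 0"
    by (subst (asm) nn_integral_0_iff_AE) auto
  then show ?thesis
    by eventually_elim (auto simp: indicator_def split: if_splits)
qed

lemma shadow_space_measurable: "shadow \<in> (lborel_on B) \<rightarrow>\<^sub>M restrict_space borel (span B)"
proof (rule measurable_restrict_space2)
  show "shadow \<in> space (lborel_on B) \<rightarrow> span B"
    unfolding shadow_def by (intro funcsetI span_sum span_scale span_base)
qed measurable

lemma AE_hyperplane_frontier:
  assumes "convex C"
  shows "AE h in distr (lborel_on B) (restrict_space borel (span B)) shadow. h \<notin> frontier (cylinder C)"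
proof -
  have "{h \<in> space (restrict_space borel (span B)). h \<notin> frontier (cylinder C)} \<in> sets (restrict_space borel (span B))"
  proof -
    have "{h \<in> space (restrict_space borel (span B)). h \<notin> frontier (cylinder C)} = span B \<inter> (- frontier (cylinder C))"
      by (auto simp: space_restrict_space)
    moreover have "- frontier (cylinder C) \<in> sets borel"
      using frontier_null(1)[OF convex_cylinder[OF assms]] by (simp add: sets.compl_sets borel_comp)
    ultimately show ?thesis by (auto simp: sets_restrict_space)
  qed
  then show ?thesis
    using AE_shadow_frontier[OF assms] by (subst AE_distr_iff[OF shadow_space_measurable]) auto
qed

text \<open>For the basis chosen in \<open>subspace_lebesgue\<close> this is the same
  measure.\<close>

definition "hyperplane_measure = completion (distr (lborel_on B) (restrict_space borel (span B)) shadow)"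

text \<open>A cylinder without interior points is contained in its own frontier, which almost every
  point of the hyperplane avoids.\<close>

lemma nn_integral_fiber_sup_zero:
  assumes "quasi_concave f" "interior (cylinder (positive_set f)) = {}"
  shows "(nn_integral hyperplane_measure (fiber_sup f)) = 0"
proof -
  let ?M = "distr (lborel_on B) (restrict_space borel (span B)) shadow"
  have "AE h in ?M. fiber_sup f h = 0"
    using AE_hyperplane_frontier[OF convex_positive_set[OF assms(1)]]
  proof eventually_elim
    fix h assume "h \<notin> frontier (cylinder (positive_set f))"
    then have "h \<notin> cylinder (positive_set f)"
      using assms(2) closure_subset by (auto simp: frontier_def)
    then show "fiber_sup f h = 0" by (rule fiber_sup_zero)
  qed
  then have "(nn_integral ?M (fiber_sup f)) = (\<integral>\<^sup>+h. 0 \<partial>?M)" by (rule nn_integral_cong_AE)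
  then show ?thesis by (simp add: hyperplane_measure_def nn_integral_completion)
qed

text \<open>The change of variables needs a measurable integrand. So \<open>fiber_sup f\<close> is
  first replaced, off a null set, by the fiber supremum of the regular part, which is a measurable
  function of the coordinates.\<close>

lemma nn_integral_fiber_sup:
  assumes pc: "p_concave p f" and q: "0 < q" "ereal (- q) \<le> p"
    and ne: "core (positive_set f) \<noteq> {}"
  shows "(nn_integral hyperplane_measure (fiber_sup f)) = (\<integral>\<^sup>+c. (SUP \<alpha>. in_coords f c \<alpha>) \<partial>lborel_on B)"
proof -
  let ?M = "distr (lborel_on B) (restrict_space borel (span B)) shadow"
  note qc = p_concave_imp_quasi_concave[OF pc]
  have [measurable]: "(\<lambda>c. SUP \<alpha>. in_coords f c \<alpha>) \<in> borel_measurable (lborel_on B)"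
    by (rule lsc_in_measurable(2)[OF fin quasi_concave_in_coords[OF qc] lsc_in_coords[OF pc q]])
  have eq: "fiber_sup (regular_part f) h = (SUP \<alpha>. in_coords f (coords h) \<alpha>)" for h
  proof -
    have "h = shadow (coords h) + ((\<Sum>b\<in>B. coords h b * \<kappa> b) + height h) *\<^sub>R \<nu>"
      using point_coords[of h] by (simp add: point_shadow)
    then show ?thesis unfolding SUP_in_coords by (metis fiber_sup_shift)
  qed
  have meas: "fiber_sup (regular_part f) \<in> borel_measurable (restrict_space borel (span B))"
  proof (rule measurable_restrict_space1)
    have "(\<lambda>h. SUP \<alpha>. in_coords f (coords h) \<alpha>) \<in> borel_measurable borel" by measurable
    moreover have "fiber_sup (regular_part f) = (\<lambda>h. SUP \<alpha>. in_coords f (coords h) \<alpha>)"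
      using eq by (rule ext)
    ultimately show "fiber_sup (regular_part f) \<in> borel_measurable borel" by simp
  qed
  have "AE h in ?M. fiber_sup f h = fiber_sup (regular_part f) h"
    using AE_hyperplane_frontier[OF convex_positive_set[OF qc]]
    by eventually_elim (rule fiber_sup_regular_part[OF pc q ne])
  then have "(nn_integral ?M (fiber_sup f)) = (nn_integral ?M (fiber_sup (regular_part f)))"
    by (rule nn_integral_cong_AE)
  also have "\<dots> = (\<integral>\<^sup>+c. fiber_sup (regular_part f) (shadow c) \<partial>lborel_on B)"
    using meas by (intro nn_integral_distr shadow_space_measurable) simp
  finally show ?thesis
    by (simp add: hyperplane_measure_def nn_integral_completion SUP_in_coords)
qed

text \<open>A point of the support off its null frontier is interior, hence in the core, so erasing
  values changes \<open>f\<close> only on a null set.\<close>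

lemma nn_integral_in_coords:
  assumes pc: "p_concave p f" and q: "0 < q" "ereal (- q) \<le> p"
  shows "(nn_integral lebesgue f) \<le> double_integral (lborel_on B) (in_coords f)"
proof -
  note qc = p_concave_imp_quasi_concave[OF pc]
  note conv = convex_positive_set[OF qc]
  have [measurable]: "case_prod (in_coords f) \<in> borel_measurable (lborel_on B \<Otimes>\<^sub>M lborel)"
    by (rule lsc_in_measurable(1)[OF fin quasi_concave_in_coords[OF qc] lsc_in_coords[OF pc q]])
  have "regular_part f = (\<lambda>x. case_prod (in_coords f) (coords x, height x))"
    by (simp add: in_coords_def point_coords fun_eq_iff)
  also have "\<dots> \<in> borel_measurable borel" by measurable
  finally have meas: "regular_part f \<in> borel_measurable borel" .
  have "AE x in lborel. f x = regular_part f x"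
    using frontier_null(2)[OF conv]
  proof eventually_elim
    fix x assume x: "x \<notin> frontier (positive_set f)"
    show "f x = regular_part f x"
    proof (cases "x \<in> positive_set f")
      case True
      then have "x \<in> interior (positive_set f)" using x closure_subset by (auto simp: frontier_def)
      then show ?thesis using interior_subset_core by (auto simp: regular_part_def)
    next
      case False
      then show ?thesis by (simp add: regular_part_def positive_set_def)
    qed
  qed
  then have "(nn_integral lborel f) = nn_integral lborel (regular_part f)"
    by (rule nn_integral_cong_AE)
  then show ?thesis
    by (simp add: nn_integral_completion nn_integral_lborel_point[OF meas] in_coords_def)
qed

text \<open>The coordinates \<open>point c \<alpha>\<close> respect convex combinations and Lebesgue
  measure, and \<open>in_coords\<close> lies below the given functions. So the inequality in
  coordinates transfers as soon as both cores are nonempty.\<close>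

lemma sheared_inequality:
  assumes pc: "p_concave p f" "p_concave p g" and t: "0 < t" "t < 1"
    and p: "ereal (- 1 / real (DIM('a))) \<le> p"
    and ne: "core (positive_set f) \<noteq> {}" "core (positive_set g) \<noteq> {}"
    and eq: "(nn_integral hyperplane_measure (fiber_sup f)) = nn_integral hyperplane_measure (fiber_sup g)"
  shows "ennreal (1 - t) * (nn_integral lebesgue f) + ennreal t * (nn_integral lebesgue g)
    \<le> (nn_integral lebesgue (sup_convolution p t f g))"
proof -
  define q where "q = 1 / real (DIM('a))"
  have q: "0 < q" "ereal (- q) \<le> p" using p by (auto simp: q_def)
  note qc = p_concave_imp_quasi_concave[OF pc(1)] p_concave_imp_quasi_concave[OF pc(2)]
  have "ennreal (1 - t) * (nn_integral lebesgue f) + ennreal t * (nn_integral lebesgue g)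
    \<le> ennreal (1 - t) * double_integral (lborel_on B) (in_coords f)
      + ennreal t * double_integral (lborel_on B) (in_coords g)"
    by (intro add_mono mult_left_mono nn_integral_in_coords[OF pc(1) q] nn_integral_in_coords[OF pc(2) q]) auto
  also have "\<dots> \<le> (nn_integral lebesgue (sup_convolution p t f g))"
  proof (rule coordinate_inequality[where W = "\<lambda>c \<alpha>. sup_convolution p t f g (point c \<alpha>)", OF fin t])
    show "ereal (- 1 / real (card B + 1)) \<le> p" using p card by simp
    show "quasi_concave (in_coords f c)" "quasi_concave (in_coords g c)" for c
      by (intro quasi_concave_in_coords qc)+
    show "lsc_in B (in_coords f)" "lsc_in B (in_coords g)"
      by (rule lsc_in_coords[OF pc(1) q] lsc_in_coords[OF pc(2) q])+
    show "(\<integral>\<^sup>+c. (SUP \<alpha>. in_coords f c \<alpha>) \<partial>lborel_on B) = (\<integral>\<^sup>+c. (SUP \<alpha>. in_coords g c \<alpha>) \<partial>lborel_on B)"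
      using eq nn_integral_fiber_sup[OF pc(1) q ne(1)] nn_integral_fiber_sup[OF pc(2) q ne(2)] by simp
  next
    \<comment> \<open>A measurable function below the sup-convolution in coordinates becomes, by
      composition with \<open>coords\<close> and \<open>height\<close>, a measurable function below
      it on the space.\<close>
    fix w :: "('a \<Rightarrow> real) \<Rightarrow> real \<Rightarrow> ennreal"
    assume [measurable]: "case_prod w \<in> borel_measurable (lborel_on B \<Otimes>\<^sub>M lborel)"
      and le: "\<And>c \<alpha>. w c \<alpha> \<le> sup_convolution p t f g (point c \<alpha>)"
    have "(\<lambda>x. case_prod w (coords x, height x)) \<in> borel_measurable borel" by measurable
    then have meas: "(\<lambda>x. w (coords x) (height x)) \<in> borel_measurable borel" by simp
    have "double_integral (lborel_on B) w
      = (\<integral>\<^sup>+c. \<integral>\<^sup>+\<alpha>. w (coords (point c \<alpha>)) (height (point c \<alpha>)) \<partial>lborel \<partial>lborel_on B)"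
      by (intro nn_integral_cong) (simp add: coords_point space_PiM PiE_iff)
    also have "\<dots> = (\<integral>\<^sup>+x. w (coords x) (height x) \<partial>lborel)"
      by (rule nn_integral_lborel_point[OF meas, symmetric])
    also have "\<dots> \<le> (nn_integral lborel (sup_convolution p t f g))"
    proof (rule nn_integral_mono)
      show "w (coords x) (height x) \<le> sup_convolution p t f g x" for x
        using le[of "coords x" "height x"] by (simp add: point_coords)
    qed
    finally show "double_integral (lborel_on B) w \<le> (nn_integral lebesgue (sup_convolution p t f g))"
      by (simp add: nn_integral_completion)
  next
    fix c c' :: "'a \<Rightarrow> real" and \<alpha> \<beta> :: real
    have "p_mean p (in_coords f c \<alpha>) (in_coords g c' \<beta>) t \<le> p_mean p (f (point c \<alpha>)) (g (point c' \<beta>)) t"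
      unfolding in_coords_def by (intro p_mean_mono regular_part_le t)
    also have "\<dots> \<le> sup_convolution p t f g ((1 - t) *\<^sub>R point c \<alpha> + t *\<^sub>R point c' \<beta>)"
      unfolding sup_convolution_def by (intro SUP_upper2[of "(point c \<alpha>, point c' \<beta>)"]) auto
    finally show "p_mean p (in_coords f c \<alpha>) (in_coords g c' \<beta>) t \<le>
        sup_convolution p t f g (point (\<lambda>i\<in>B. (1 - t) * c i + t * c' i) ((1 - t) * \<alpha> + t * \<beta>))"
      by (simp add: point_convex)
  qed
  finally show ?thesis .
qed

section \<open>Flat supports\<close>

lemma nn_integral_degenerate:
  fixes f :: "'a \<Rightarrow> ennreal"
  assumes "quasi_concave f" "interior (positive_set f) = {}"
  shows "(nn_integral lebesgue f) = 0"
proof -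
  have "AE x in lborel. f x = 0"
    using frontier_null(2)[OF convex_positive_set[OF assms(1)]]
  proof eventually_elim
    fix x assume "x \<notin> frontier (positive_set f)"
    then have "x \<notin> positive_set f" using assms(2) closure_subset by (auto simp: frontier_def)
    then show "f x = 0" by (simp add: positive_set_def)
  qed
  then have "(nn_integral lborel f) = (\<integral>\<^sup>+x. 0 \<partial>(lborel :: 'a measure))" by (rule nn_integral_cong_AE)
  then show ?thesis by (simp add: nn_integral_completion)
qed

text \<open>
  A convex set with empty interior whose projection has interior points is a piece of the graph of
  an affine function over the hyperplane. A shear makes this function constant.
\<close>

lemma exists_shear:
  assumes C: "convex C" "interior C = {}" and Z: "interior (cylinder C) \<noteq> {}"
  shows "\<exists>\<kappa>'. sheared_basis.core B \<nu> \<kappa>' C \<noteq> {}"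
proof -
  obtain w \<beta> where w: "w \<noteq> 0" "C \<subseteq> {x. w \<bullet> x = \<beta>}"
    using empty_interior_subset_hyperplane[OF C] by blast
  have w\<nu>: "w \<bullet> \<nu> \<noteq> 0"
  proof
    assume "w \<bullet> \<nu> = 0"
    then have "cylinder C \<subseteq> {x. w \<bullet> x = \<beta>}"
      using w(2) by (force simp: cylinder_def inner_add_right)
    then have "interior (cylinder C) \<subseteq> interior {x. w \<bullet> x = \<beta>}" by (rule interior_mono)
    then show False using Z interior_hyperplane[OF w(1)] by simp
  qed
  \<comment> \<open>The choice that makes each \<open>b + \<kappa>' b *\<^sub>R \<nu>\<close>
    orthogonal to \<open>w\<close>, so that the tilted directions run parallel to the hyperplane
    containing \<open>C\<close>.\<close>
  define \<kappa>' where "\<kappa>' b = - (w \<bullet> b) / (w \<bullet> \<nu>)" for b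
  interpret S: sheared_basis B \<nu> \<kappa>'
    using fin card new orth unit by unfold_locales
  have w_lin: "w \<bullet> S.lin c = 0" for c
    unfolding S.lin_def inner_sum_right using w\<nu>
    by (intro sum.neutral) (simp add: \<kappa>'_def inner_diff_right)
  obtain z e where z: "0 < e" "ball z e \<subseteq> cylinder C"
    using Z by (auto simp: mem_interior)
  then have "z \<in> cylinder C" by auto
  then obtain \<alpha> where \<alpha>: "z + \<alpha> *\<^sub>R \<nu> \<in> C" by (auto simp: cylinder_def)
  obtain r where r: "0 < r" "\<And>c. (\<forall>b\<in>B. \<bar>c b\<bar> < r) \<Longrightarrow> norm (S.lin c) < e"
    using S.lin_small[OF z(1)] by blast
  have "z + \<alpha> *\<^sub>R \<nu> + S.lin c \<in> C" if "\<forall>b\<in>B. \<bar>c b\<bar> < r" for c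
  proof -
    have "z + S.lin c \<in> cylinder C" using z(2) r(2)[OF that] by (auto simp: dist_norm subset_iff)
    then obtain s where s: "z + S.lin c + s *\<^sub>R \<nu> \<in> C" by (auto simp: cylinder_def)
    \<comment> \<open>Both points lie in the hyperplane and \<open>S.lin c\<close> does not change
      the product with \<open>w\<close>, so the lift has the same height \<open>\<alpha>\<close>
      over all nearby points.\<close>
    then have "w \<bullet> (z + S.lin c + s *\<^sub>R \<nu>) = w \<bullet> (z + \<alpha> *\<^sub>R \<nu>)" using \<alpha> w(2) by auto
    then have "s = \<alpha>" using w\<nu> by (simp add: inner_add_right w_lin)
    then show ?thesis using s by (simp add: add_ac)
  qed
  then have "z + \<alpha> *\<^sub>R \<nu> \<in> S.core C" unfolding S.core_def using r(1) by blast
  then show ?thesis by blast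
qed

text \<open>If the projected support of \<open>f\<close> is flat as well, the projection of
  \<open>f\<close> has integral 0. By hypothesis so has that of \<open>g\<close>, and
  \<open>g\<close> vanishes almost everywhere. Otherwise a shear gives the support of
  \<open>f\<close> a core, and it suits \<open>g\<close> too, since interior points belong to the
  core for every shear.\<close>

lemma degenerate_cases:
  assumes pc: "p_concave p f" "p_concave p g" and q: "0 < q" "ereal (- q) \<le> p"
    and int: "interior (positive_set f) = {}" "interior (positive_set g) \<noteq> {}"
    and eq: "(nn_integral hyperplane_measure (fiber_sup f)) = nn_integral hyperplane_measure (fiber_sup g)"
  shows "(\<exists>\<kappa>'. sheared_basis.core B \<nu> \<kappa>' (positive_set f) \<noteq> {} \<and> sheared_basis.core B \<nu> \<kappa>' (positive_set g) \<noteq> {})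
    \<or> (nn_integral lebesgue g) = 0"
proof (cases "interior (cylinder (positive_set f)) = {}")
  case True
  note qc = p_concave_imp_quasi_concave[OF pc(1)] p_concave_imp_quasi_concave[OF pc(2)]
  have ne: "core (positive_set g) \<noteq> {}" using int(2) interior_subset_core by blast
  have meas: "(\<lambda>c. SUP \<alpha>. in_coords g c \<alpha>) \<in> borel_measurable (lborel_on B)"
    by (rule lsc_in_measurable(2)[OF fin quasi_concave_in_coords[OF qc(2)] lsc_in_coords[OF pc(2) q]])
  have "(\<integral>\<^sup>+c. (SUP \<alpha>. in_coords g c \<alpha>) \<partial>lborel_on B) = 0"
    using nn_integral_fiber_sup[OF pc(2) q ne] nn_integral_fiber_sup_zero[OF qc(1) True] eq by simp
  then have "double_integral (lborel_on B) (in_coords g) = 0"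
    by (rule nn_integral_SUP_zero[OF meas])
  then show ?thesis using nn_integral_in_coords[OF pc(2) q] by simp
next
  case False
  have conv: "convex (positive_set f)" by (rule convex_positive_set[OF p_concave_imp_quasi_concave[OF pc(1)]])
  obtain \<kappa>' where \<kappa>': "sheared_basis.core B \<nu> \<kappa>' (positive_set f) \<noteq> {}"
    using exists_shear[OF conv int(1) False] by blast
  interpret S: sheared_basis B \<nu> \<kappa>'
    using fin card new orth unit by unfold_locales
  show ?thesis using \<kappa>' S.interior_subset_core int(2) by blast
qed

end

section \<open>Return to the hyperplane \<open>H\<close>\<close>

lemma sheared_basis_hyperplane:
  fixes H :: "'a::euclidean_space set"
  assumes H: "subspace H" "dim H = DIM('a) - 1" and B: "orthonormal_basis_of H B"
  shows "sheared_basis B (unit_normal H)"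
proof
  note u = unit_normal[OF H]
  have orthB: "pairwise orthogonal B" and unitB: "\<And>b. b \<in> B \<Longrightarrow> norm b = 1" and sp: "span B = H"
    using B by (auto simp: orthonormal_basis_of_def)
  have BH: "B \<subseteq> H" using sp span_superset by blast
  have "0 \<notin> B" using unitB by force
  then have ind: "independent B" by (intro pairwise_orthogonal_independent orthB)
  then show "finite B" by (rule independent_imp_finite)
  have "card B = dim H" using ind sp by (metis dim_span dim_eq_card_independent)
  then show "card B + 1 = DIM('a)" using H(2) DIM_positive[where 'a='a] by simp
  show "unit_normal H \<notin> B"
    using u(1) u(2)[of "unit_normal H"] BH by (auto simp: orthogonal_def norm_eq_1)
  show "pairwise orthogonal (insert (unit_normal H) B)"
    using orthB u(2) BH by (auto simp: pairwise_insert orthogonal_commute)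
  show "\<And>b. b \<in> insert (unit_normal H) B \<Longrightarrow> norm b = 1" using u(1) unitB by auto
qed

theorem theorem1p6:
  fixes f g :: "real ^ 'n \<Rightarrow> ennreal" and p :: ereal and t :: real
  assumes "ereal (- 1 / real CARD('n)) \<le> p" and "p \<le> \<infinity>"
    and "p_concave p f" and "p_concave p g"
    and "p = 0 \<Longrightarrow> (\<forall>x. f x \<noteq> \<infinity>) \<and> (\<forall>x. g x \<noteq> \<infinity>)"
    and "0 < t" and "t < 1"
    and "\<exists>H. subspace H \<and> dim H = CARD('n) - 1 \<and>
           (\<integral>\<^sup>+ h. hyperplane_proj H f h \<partial>subspace_lebesgue H) =
           (\<integral>\<^sup>+ h. hyperplane_proj H g h \<partial>subspace_lebesgue H)"
  shows "(\<integral>\<^sup>+ x. sup_convolution p t f g x \<partial>lebesgue) \<ge>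
           ennreal (1 - t) * (\<integral>\<^sup>+ x. f x \<partial>lebesgue) + ennreal t * (\<integral>\<^sup>+ x. g x \<partial>lebesgue)"
proof -
  obtain H where H: "subspace H" "dim H = CARD('n) - 1"
    and eq: "(\<integral>\<^sup>+ h. hyperplane_proj H f h \<partial>subspace_lebesgue H) =
       (\<integral>\<^sup>+ h. hyperplane_proj H g h \<partial>subspace_lebesgue H)"
    using assms(8) by blast
  define B where "B = (SOME B. orthonormal_basis_of H B)"
  define \<nu> where "\<nu> = unit_normal H"
  have B: "orthonormal_basis_of H B"
    unfolding B_def by (rule orthonormal_basis_of_some[OF H(1)])
  have basis: "sheared_basis B \<nu>"
    unfolding \<nu>_def using H B by (intro sheared_basis_hyperplane) auto
  interpret sheared_basis B \<nu> "\<lambda>_. 0" by (rule basis)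
  have measure: "subspace_lebesgue H = hyperplane_measure"
    using B unfolding subspace_lebesgue_def hyperplane_measure_def Let_def B_def[symmetric] shadow_def[abs_def]
    by (simp add: orthonormal_basis_of_def)
  have proj: "hyperplane_proj H k = fiber_sup k" for k
    unfolding fiber_sup_def[abs_def] unfolding hyperplane_proj_def[abs_def] \<nu>_def ..
  note eq' = eq[unfolded measure proj]
  have q: "0 < 1 / real CARD('n)" "ereal (- (1 / real CARD('n))) \<le> p" using assms(1) by auto
  have p: "ereal (- 1 / real (DIM(real ^ 'n))) \<le> p" using assms(1) by simp
  have qc: "quasi_concave f" "quasi_concave g"
    using assms(3,4) by (auto intro: p_concave_imp_quasi_concave)
  \<comment> \<open>Neither \<open>hyperplane_measure\<close> nor \<open>fiber_sup\<close> involves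
    the shear, so the equation \<open>eq'\<close> obtained for the zero shear holds for every
    \<open>\<kappa>\<close>.\<close>
  have main: ?thesis
    if "sheared_basis.core B \<nu> \<kappa> (positive_set f) \<noteq> {}" "sheared_basis.core B \<nu> \<kappa> (positive_set g) \<noteq> {}" for \<kappa>
    by (rule sheared_basis.sheared_inequality[OF basis assms(3,4,6,7) p that eq'])
  consider "interior (positive_set f) \<noteq> {}" "interior (positive_set g) \<noteq> {}"
    | "interior (positive_set f) = {}" "interior (positive_set g) = {}"
    | "interior (positive_set f) = {}" "interior (positive_set g) \<noteq> {}"
    | "interior (positive_set f) \<noteq> {}" "interior (positive_set g) = {}"
    by blast
  then show ?thesis
  proof cases
    case 1
    then show ?thesis using interior_subset_core by (intro main[of "\<lambda>_. 0"]) blast+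
  next
    case 2
    then show ?thesis using nn_integral_degenerate qc by simp
  next
    case 3
    \<comment> \<open>Either a common shear exists, or the integral of \<open>g\<close> is 0; that
      of \<open>f\<close> is 0 because its support is flat.\<close>
    then show ?thesis
      using degenerate_cases[OF assms(3,4) q 3 eq'] main nn_integral_degenerate[OF qc(1) 3(1)] by auto
  next
    case 4
    then show ?thesis
      using degenerate_cases[OF assms(4,3) q 4(2,1) eq'[symmetric]] main nn_integral_degenerate[OF qc(2) 4(2)]
      by auto
  qed
qed

end
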